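(* Let $K\subset K^*$ be fields with $K^*$ a (finite) Galois extension of $K$, let $\nu^*$ be a rank 1 valuation of $K^*$ with restriction $\nu$ to $K$, and suppose that $\nu^*$ is the unique extension of $\nu$ to $K^*$. Let $p>0$ be the residue characteristic of $V_{\nu^*}$ and suppose that $[\Gamma_{\nu^*}:\Gamma_{\nu}]$ is a power of $p$ and that $V_{\nu^*}/m_{\nu^*}$ is purely inseparable over $V_{\nu}/m_{\nu}$ (so that $[K^*:K]=p^n$ for some $n$). Suppose that $R$ is a normal local ring of $K$ which is dominated by $\nu$ and that $S$ is the localization of the integral closure of $R$ in $K^*$ at the center of $\nu^*$. Then ${\rm gr}_{\nu^*}(S)^{p^n}\subset {\rm gr}_{\nu}(R)$, that is, $h^{p^n}\in{\rm gr}_\nu(R)$ for every $h\in{\rm gr}_{\nu^*}(S)$.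
   Context: For a valuation $\nu$ of a field $K$, $V_\nu$ is its valuation ring, $m_\nu$ the maximal ideal of $V_\nu$, and $\Gamma_\nu$ its value group. A local ring of $K$ is a local domain with quotient field $K$ (local rings are not required to be Noetherian). The valuation $\nu$ dominates a local ring $R$ of $K$ if $R\subset V_\nu$ and $m_\nu\cap R=m_R$. The center of $\nu^*$ on a subring $A\subset V_{\nu^*}$ is the prime ideal $m_{\nu^*}\cap A$. For a local ring $R$ of $K$ dominated by $\nu$ and $\gamma\in\Gamma_\nu$, let $\mathcal P_\gamma(R)=\{f\in R\mid \nu(f)\ge\gamma\}$ and $\mathcal P_\gamma^+(R)=\{f\in R\mid \nu(f)>\gamma\}$ (with $\nu(0)=\infty$). The associated graded ring of $R$ along $\nu$ is ${\rm gr}_\nu(R)=\bigoplus_{\gamma\in\Gamma_\nu}\mathcal P_\gamma(R)/\mathcal P_\gamma^+(R)$, with multiplication induced by that of $R$. Since $\nu=\nu^*|K$ and $R\subset S$, there is a natural graded inclusion ${\rm gr}_\nu(R)\subset{\rm gr}_{\nu^*}(S)$. *)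

theory Defs
  imports "HOL-Algebra.Algebra"
begin

section \<open>Fields\<close>

text \<open>
  Subrings of a field \<open>L\<close> are given by their carriers; as rings in their own right they are
  \<open>L\<lparr>carrier := A\<rparr>\<close>.
\<close>

definition galois_extension :: "('a, 'b) ring_scheme \<Rightarrow> 'a set \<Rightarrow> bool" where
  "galois_extension L K \<longleftrightarrow>
     field L \<and> subfield K L \<and> ring.finite_dimension L K (carrier L) \<and>
     {x \<in> carrier L. \<forall>\<sigma> \<in> ring_iso L L. (\<forall>y \<in> K. \<sigma> y = y) \<longrightarrow> \<sigma> x = x} = K"

definition purely_inseparable_over :: "nat \<Rightarrow> ('a, 'b) ring_scheme \<Rightarrow> 'a set \<Rightarrow> bool" where
  "purely_inseparable_over p E F \<longleftrightarrow> (\<forall>x \<in> carrier E. \<exists>k::nat. x [^]\<^bsub>E\<^esub> (p ^ k) \<in> F)"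

definition has_characteristic :: "('a, 'b) ring_scheme \<Rightarrow> nat \<Rightarrow> bool" where
  "has_characteristic A p \<longleftrightarrow> (\<forall>n::nat. add_pow A n \<one>\<^bsub>A\<^esub> = \<zero>\<^bsub>A\<^esub> \<longleftrightarrow> p dvd n)"


section \<open>Valuations\<close>

text \<open>
  A valuation is a function on the nonzero elements of the field; its value at \<open>\<zero>\<close> is irrelevant,
  and the convention \<open>v \<zero> = \<infinity>\<close> is spelled out wherever it is used.  The values lie in a linearly
  ordered abelian group \<open>'g\<close>, which may be larger than the value group.
\<close>

definition valuation ::
    "('a, 'b) ring_scheme \<Rightarrow> ('a \<Rightarrow> 'g::linordered_ab_group_add) \<Rightarrow> bool" where
  "valuation F v \<longleftrightarrow>
     field F \<and>
     (\<forall>x \<in> carrier F - {\<zero>\<^bsub>F\<^esub>}. \<forall>y \<in> carrier F - {\<zero>\<^bsub>F\<^esub>}.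
        v (x \<otimes>\<^bsub>F\<^esub> y) = v x + v y \<and>
        (x \<oplus>\<^bsub>F\<^esub> y \<noteq> \<zero>\<^bsub>F\<^esub> \<longrightarrow> min (v x) (v y) \<le> v (x \<oplus>\<^bsub>F\<^esub> y)))"

definition val_ring ::
    "('a, 'b) ring_scheme \<Rightarrow> ('a \<Rightarrow> 'g::linordered_ab_group_add) \<Rightarrow> 'a set" where
  "val_ring F v = {x \<in> carrier F. x = \<zero>\<^bsub>F\<^esub> \<or> 0 \<le> v x}"

definition val_ideal ::
    "('a, 'b) ring_scheme \<Rightarrow> ('a \<Rightarrow> 'g::linordered_ab_group_add) \<Rightarrow> 'a set" where
  "val_ideal F v = {x \<in> carrier F. x = \<zero>\<^bsub>F\<^esub> \<or> 0 < v x}"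

definition residue_field ::
    "('a, 'b) ring_scheme \<Rightarrow> ('a \<Rightarrow> 'g::linordered_ab_group_add) \<Rightarrow> 'a set ring" where
  "residue_field F v = (F\<lparr>carrier := val_ring F v\<rparr>) Quot (val_ideal F v)"

text \<open>
  The image of the residue field of \<open>K\<close> (with valuation \<open>u\<close>) in the residue field of \<open>L\<close>
  under \<open>a + m\<^sub>u \<mapsto> a + m\<^sub>v\<close>, where \<open>u\<close> is the restriction of \<open>v\<close>.
\<close>

definition residue_subfield ::
    "('a, 'b) ring_scheme \<Rightarrow> ('a \<Rightarrow> 'g::linordered_ab_group_add) \<Rightarrow> 'a set \<Rightarrow> ('a \<Rightarrow> 'g) \<Rightarrow> 'a set set"
  where
  "residue_subfield L v K u =
     (\<lambda>a. val_ideal L v +>\<^bsub>L\<^esub> a) ` val_ring (L\<lparr>carrier := K\<rparr>) u"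

definition value_group ::
    "('a, 'b) ring_scheme \<Rightarrow> ('a \<Rightarrow> 'g::linordered_ab_group_add) \<Rightarrow> 'g set" where
  "value_group F v = v ` (carrier F - {\<zero>\<^bsub>F\<^esub>})"

definition additive_group :: "'g::ab_group_add set \<Rightarrow> 'g monoid" where
  "additive_group \<Gamma> = \<lparr>carrier = \<Gamma>, monoid.mult = (+), one = 0\<rparr>"

definition group_index :: "'g::ab_group_add set \<Rightarrow> 'g set \<Rightarrow> nat" where
  "group_index \<Gamma> \<Delta> = card (rcosets\<^bsub>additive_group \<Gamma>\<^esub> \<Delta>)"

definition convex_subgroup :: "'g::linordered_ab_group_add set \<Rightarrow> 'g set \<Rightarrow> bool" where
  "convex_subgroup H \<Gamma> \<longleftrightarrow>
     subgroup H (additive_group \<Gamma>) \<and> (\<forall>a \<in> \<Gamma>. \<forall>b \<in> H. 0 \<le> a \<and> a \<le> b \<longrightarrow> a \<in> H)"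

text \<open>
  The rank of a valuation is the number of proper convex subgroups of its value group
  (only meaningful if that number is finite; \<open>card\<close> returns \<open>0\<close> otherwise).
\<close>

definition val_rank ::
    "('a, 'b) ring_scheme \<Rightarrow> ('a \<Rightarrow> 'g::linordered_ab_group_add) \<Rightarrow> nat" where
  "val_rank F v =
     card {H. convex_subgroup H (value_group F v) \<and> H \<noteq> value_group F v}"

definition valuation_subring :: "('a, 'b) ring_scheme \<Rightarrow> 'a set \<Rightarrow> bool" where
  "valuation_subring F W \<longleftrightarrow>
     subring W F \<and> (\<forall>x \<in> carrier F - {\<zero>\<^bsub>F\<^esub>}. x \<in> W \<or> inv\<^bsub>F\<^esub> x \<in> W)"

text \<open>
  Extensions of a valuation to a larger field have arbitrary value groups and are taken up to
  equivalence, so they are represented by their valuation rings: \<open>w\<close> extends \<open>u\<close> up to equivalence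
  iff \<open>V\<^sub>w \<inter> K = V\<^sub>u\<close>, and \<open>w\<close> is equivalent to \<open>v\<close> iff \<open>V\<^sub>w = V\<^sub>v\<close>.
\<close>

definition unique_extension ::
    "('a, 'b) ring_scheme \<Rightarrow> ('a \<Rightarrow> 'g::linordered_ab_group_add) \<Rightarrow> 'a set \<Rightarrow> ('a \<Rightarrow> 'g) \<Rightarrow> bool"
  where
  "unique_extension L v K u \<longleftrightarrow>
     (\<forall>W. valuation_subring L W \<and> W \<inter> K = val_ring (L\<lparr>carrier := K\<rparr>) u \<longrightarrow> W = val_ring L v)"


section \<open>Local rings\<close>

text \<open>Local rings of a field: no Noetherian hypothesis.\<close>

definition local_ring_of :: "('a, 'b) ring_scheme \<Rightarrow> 'a set \<Rightarrow> bool" where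
  "local_ring_of F R \<longleftrightarrow>
     subring R F \<and> (\<exists>!M. maximalideal M (F\<lparr>carrier := R\<rparr>)) \<and>
     (\<forall>x \<in> carrier F. \<exists>a \<in> R. \<exists>b \<in> R - {\<zero>\<^bsub>F\<^esub>}. x = a \<otimes>\<^bsub>F\<^esub> inv\<^bsub>F\<^esub> b)"

definition max_ideal :: "('a, 'b) ring_scheme \<Rightarrow> 'a set \<Rightarrow> 'a set" where
  "max_ideal F R = (THE M. maximalideal M (F\<lparr>carrier := R\<rparr>))"

definition dominates ::
    "('a, 'b) ring_scheme \<Rightarrow> ('a \<Rightarrow> 'g::linordered_ab_group_add) \<Rightarrow> 'a set \<Rightarrow> bool" where
  "dominates F v R \<longleftrightarrow> R \<subseteq> val_ring F v \<and> val_ideal F v \<inter> R = max_ideal F R"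

text \<open>Polynomials are coefficient lists with the leading coefficient first.\<close>

definition integral_closure :: "('a, 'b) ring_scheme \<Rightarrow> 'a set \<Rightarrow> 'a set" where
  "integral_closure F R =
     {x \<in> carrier F. \<exists>p. p \<noteq> [] \<and> set p \<subseteq> R \<and> lead_coeff p = \<one>\<^bsub>F\<^esub> \<and> ring.eval F p x = \<zero>\<^bsub>F\<^esub>}"

definition localization_at :: "('a, 'b) ring_scheme \<Rightarrow> 'a set \<Rightarrow> 'a set \<Rightarrow> 'a set" where
  "localization_at F A \<pp> = {a \<otimes>\<^bsub>F\<^esub> inv\<^bsub>F\<^esub> b | a b. a \<in> A \<and> b \<in> A - \<pp>}"

definition val_center ::
    "('a, 'b) ring_scheme \<Rightarrow> ('a \<Rightarrow> 'g::linordered_ab_group_add) \<Rightarrow> 'a set \<Rightarrow> 'a set" where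
  "val_center F v A = val_ideal F v \<inter> A"


section \<open>The associated graded ring along a valuation\<close>

definition val_part ::
    "('a, 'b) ring_scheme \<Rightarrow> ('a \<Rightarrow> 'g::linordered_ab_group_add) \<Rightarrow> 'a set \<Rightarrow> 'g \<Rightarrow> 'a set" where
  "val_part F v R \<gamma> = {f \<in> R. f = \<zero>\<^bsub>F\<^esub> \<or> \<gamma> \<le> v f}"

definition val_part_plus ::
    "('a, 'b) ring_scheme \<Rightarrow> ('a \<Rightarrow> 'g::linordered_ab_group_add) \<Rightarrow> 'a set \<Rightarrow> 'g \<Rightarrow> 'a set" where
  "val_part_plus F v R \<gamma> = {f \<in> R. f = \<zero>\<^bsub>F\<^esub> \<or> \<gamma> < v f}"

text \<open>The additive group \<open>P\<^sub>\<gamma>(R) / P\<^sub>\<gamma>\<^sup>+(R)\<close>, written multiplicatively as a \<open>monoid\<close> record.\<close>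

definition gr_part ::
    "('a, 'b) ring_scheme \<Rightarrow> ('a \<Rightarrow> 'g::linordered_ab_group_add) \<Rightarrow> 'a set \<Rightarrow> 'g \<Rightarrow> 'a set monoid"
  where
  "gr_part F v R \<gamma> =
     add_monoid (F\<lparr>carrier := val_part F v R \<gamma>\<rparr>) Mod (val_part_plus F v R \<gamma>)"

text \<open>
  The additive group is the direct sum of the \<open>gr_part\<close>s, so an element is a finitely supported family
  \<open>h\<close> of cosets indexed by the value group of \<open>F\<close>.  The product in degree \<open>\<gamma>\<close> is the sum in
  \<open>gr_part F v R \<gamma>\<close> of the products \<open>h \<alpha> \<cdot> k (\<gamma> - \<alpha>)\<close> over the support of \<open>h\<close>; here \<open>rcoset_mult\<close>
  with modulus \<open>P\<^sub>\<gamma>\<^sup>+(R)\<close> sends \<open>(a + P\<^sub>\<alpha>\<^sup>+(R), b + P\<^sub>\<beta>\<^sup>+(R))\<close> to \<open>ab + P\<^sub>\<gamma>\<^sup>+(R)\<close> for \<open>\<alpha> + \<beta> = \<gamma>\<close>.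
\<close>

definition assoc_graded ::
    "('a, 'b) ring_scheme \<Rightarrow> ('a \<Rightarrow> 'g::linordered_ab_group_add) \<Rightarrow> 'a set \<Rightarrow> ('g \<Rightarrow> 'a set) ring"
  where
  "assoc_graded F v R =
     (let \<Gamma> = value_group F v; G = gr_part F v R in
      \<lparr>carrier = carrier (sum_group \<Gamma> G),
       monoid.mult = (\<lambda>h k. \<lambda>\<gamma>\<in>\<Gamma>. finprod (G \<gamma>)
                 (\<lambda>\<alpha>. rcoset_mult F (val_part_plus F v R \<gamma>) (h \<alpha>) (k (\<gamma> - \<alpha>)))
                 {\<alpha> \<in> \<Gamma>. h \<alpha> \<noteq> \<one>\<^bsub>G \<alpha>\<^esub>}),
       one = (\<lambda>\<gamma>\<in>\<Gamma>. if \<gamma> = 0 then val_part_plus F v R 0 +>\<^bsub>F\<^esub> \<one>\<^bsub>F\<^esub> else \<one>\<^bsub>G \<gamma>\<^esub>),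
       ring.zero = \<one>\<^bsub>sum_group \<Gamma> G\<^esub>,
       ring.add = monoid.mult (sum_group \<Gamma> G)\<rparr>)"

text \<open>
  The natural inclusion of the graded ring of \<open>R \<subseteq> K\<close> along \<open>u\<close> into that of \<open>S \<subseteq> L\<close> along \<open>v\<close>,
  where \<open>u\<close> is the restriction of \<open>v\<close> and \<open>R \<subseteq> S\<close>: in each degree \<open>\<gamma>\<close> of the value group of \<open>u\<close> it is
  \<open>f + P\<^sub>\<gamma>\<^sup>+(R) \<mapsto> f + P\<^sub>\<gamma>\<^sup>+(S)\<close>, computed as the set sum \<open>P\<^sub>\<gamma>\<^sup>+(S) + (f + P\<^sub>\<gamma>\<^sup>+(R))\<close>.
\<close>

definition gr_inclusion ::
    "('a, 'b) ring_scheme \<Rightarrow> ('a \<Rightarrow> 'g::linordered_ab_group_add) \<Rightarrow> 'a set \<Rightarrow> 'a set \<Rightarrow> ('a \<Rightarrow> 'g)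
      \<Rightarrow> ('g \<Rightarrow> 'a set) \<Rightarrow> ('g \<Rightarrow> 'a set)"
  where
  "gr_inclusion L v S K u h =
     (\<lambda>\<gamma> \<in> value_group L v.
        if \<gamma> \<in> value_group (L\<lparr>carrier := K\<rparr>) u
        then val_part_plus L v S \<gamma> <+>\<^bsub>L\<^esub> h \<gamma>
        else \<one>\<^bsub>gr_part L v S \<gamma>\<^esub>)"

end

(*
  Let G be the Galois group. Uniqueness of the extension makes every h in G preserve V_v, and since
  the index of the value groups is a power of p and the residue extension is purely inseparable,
  h x / x has residue 1 for every nonzero x. Hence the trace over a subgroup of order prime to p is
  injective, which forces the order of G, equal to [K*:K] by Dedekind and Artin, to be p^n. The norm
  N x = product of the h x over G then agrees with x^(p^n) up to terms of larger value, and N maps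
  S into R because R is normal. Finally the (p^n)-th power map of the graded ring is additive,
  since p has positive value, so the (p^n)-th power of the class of a sum of homogeneous elements f_i
  is the sum of the classes of the elements N f_i of R.
*)

theory Submission
  imports Defs
begin

section \<open>Integral elements\<close>

text \<open>The power x^(p^n) itself has no reason to lie in K; the norm does, and only its initial
  form has to agree with that of the power. Hence conjugates must be congruent modulo larger value,
  not merely of equal value. Uniqueness of the extension gives only that automorphisms preserve the
  valuation ring; equal values also take the index hypothesis, and congruence the residue hypothesis
  on top. Both steps pass to a p-power, where a comparison with K is possible, and then extract the
  root: for values because ordered groups are torsion free, for residues because Frobenius is
  injective in characteristic p. Subgroups of order prime to p come from Sylow, one for each prime
  divisor of the group order other than p. An element of S is a fraction a/b, so normality handles
  only the norms of a and b; that the norm of b is a unit of R comes from domination. Behind all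
  this lies the fact that integral elements form a ring, proved by elimination in a linear system
  instead of determinants. Homogeneous elements are handled through representatives, and powers of
  sums through words, on which rotation acts.\<close>

context ring
begin

text \<open>The \<open>A\<close>-span of 1, z, ..., z^(n-1). A monic equation of degree
  \<open>n\<close> for \<open>z\<close> is then membership of \<open>z [^] n\<close> in
  \<open>low_degree A z n\<close>, which can be manipulated without coefficient lists.\<close>

fun low_degree :: "'a set \<Rightarrow> 'a \<Rightarrow> nat \<Rightarrow> 'a set" where
  "low_degree A z 0 = {\<zero>}"
| "low_degree A z (Suc n) = {a \<otimes> z [^] n \<oplus> f | a f. a \<in> A \<and> f \<in> low_degree A z n}"

text \<open>The recursion peels off the top power, just as \<open>eval\<close> consumes a list with
  the leading coefficient first; this is the bridge to the list-based definition of
  integrality.\<close>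

lemma low_degree_eq_eval: "low_degree A z n = {eval p z | p. set p \<subseteq> A \<and> length p = n}"
proof (induction n)
  case 0
  then show ?case by auto
next
  case (Suc n)
  show ?case
  proof (intro equalityI subsetI)
    fix x assume "x \<in> low_degree A z (Suc n)"
    then obtain a p where "a \<in> A" "set p \<subseteq> A" "length p = n" "x = a \<otimes> z [^] n \<oplus> eval p z"
      by (auto simp: Suc)
    then have "set (a # p) \<subseteq> A \<and> length (a # p) = Suc n \<and> x = eval (a # p) z" by auto
    then show "x \<in> {eval p z | p. set p \<subseteq> A \<and> length p = Suc n}" by blast
  next
    fix x assume "x \<in> {eval p z | p. set p \<subseteq> A \<and> length p = Suc n}"
    then obtain p where "set p \<subseteq> A" "length p = Suc n" "x = eval p z" by blast
    then show "x \<in> low_degree A z (Suc n)"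
      by (cases p) (auto simp: Suc)
  qed
qed

end

lemma (in abelian_group) a_minus_cancel_left:
  assumes "x \<in> carrier G" "y \<in> carrier G" "w \<in> carrier G"
  shows "x \<oplus> y \<ominus> w \<ominus> x = y \<ominus> w"
proof -
  have "x \<oplus> y \<ominus> w \<ominus> x = (x \<oplus> \<ominus> x) \<oplus> (y \<ominus> w)"
    unfolding a_minus_def using assms a_ac by simp
  then show ?thesis using assms by (simp add: r_neg)
qed

context cring
begin

context
  fixes A z
  assumes A: "subring A R" and z: "z \<in> carrier R"
begin

lemma low_degree_SucI: "a \<in> A \<Longrightarrow> f \<in> low_degree A z n \<Longrightarrow> a \<otimes> z [^] n \<oplus> f \<in> low_degree A z (Suc n)"
  by auto

lemma low_degree_SucE:
  assumes "f \<in> low_degree A z (Suc n)"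
  obtains a f' where "a \<in> A" "f' \<in> low_degree A z n" "f = a \<otimes> z [^] n \<oplus> f'"
  using assms by auto

lemma low_degree_carrier: "low_degree A z n \<subseteq> carrier R"
  using subringE(1)[OF A] z by (induction n) (auto simp: low_degree.simps(2))

declare low_degree.simps(2) [simp del]

lemma low_degree_closed: "f \<in> low_degree A z n \<Longrightarrow> f \<in> carrier R"
  using low_degree_carrier by blast

lemma low_degree_zero: "\<zero> \<in> low_degree A z n"
proof (induction n)
  case (Suc n)
  have "\<zero> = \<zero> \<otimes> z [^] n \<oplus> \<zero>" using z by simp
  then show ?case using Suc subringE(2)[OF A] low_degree_SucI by metis
qed simp

lemma low_degree_add: "f \<in> low_degree A z n \<Longrightarrow> g \<in> low_degree A z n \<Longrightarrow> f \<oplus> g \<in> low_degree A z n"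
proof (induction n arbitrary: f g)
  case (Suc n)
  then obtain a f' b g' where *: "a \<in> A" "b \<in> A" "f' \<in> low_degree A z n" "g' \<in> low_degree A z n"
    "f = a \<otimes> z [^] n \<oplus> f'" "g = b \<otimes> z [^] n \<oplus> g'" by (elim low_degree_SucE) blast
  have "f \<oplus> g = (a \<oplus> b) \<otimes> z [^] n \<oplus> (f' \<oplus> g')"
    using * subringE(1)[OF A] z low_degree_closed by (simp add: subsetD l_distr a_ac)
  then show ?case using * Suc.IH subringE(7)[OF A] low_degree_SucI by metis
qed simp

lemma low_degree_smult: "b \<in> A \<Longrightarrow> f \<in> low_degree A z n \<Longrightarrow> b \<otimes> f \<in> low_degree A z n"
proof (induction n arbitrary: f)
  case 0
  then show ?case using subringE(1)[OF A] by auto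
next
  case (Suc n)
  then obtain a f' where *: "a \<in> A" "f' \<in> low_degree A z n" "f = a \<otimes> z [^] n \<oplus> f'" by (elim low_degree_SucE)
  have "b \<otimes> f = (b \<otimes> a) \<otimes> z [^] n \<oplus> b \<otimes> f'"
    using * Suc.prems subringE(1)[OF A] z low_degree_closed by (simp add: subsetD r_distr m_assoc)
  then show ?case using * Suc subringE(6)[OF A] low_degree_SucI by metis
qed

lemma low_degree_uminus: "f \<in> low_degree A z n \<Longrightarrow> \<ominus> f \<in> low_degree A z n"
  using low_degree_smult[of "\<ominus> \<one>" f n] low_degree_closed[of f n] subringE(3,5)[OF A]
  by (simp add: l_minus)

lemma low_degree_minus:
  "f \<in> low_degree A z n \<Longrightarrow> g \<in> low_degree A z n \<Longrightarrow> f \<ominus> g \<in> low_degree A z n"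
  by (simp add: a_minus_def low_degree_add low_degree_uminus)

lemma low_degree_Suc: "f \<in> low_degree A z n \<Longrightarrow> f \<in> low_degree A z (Suc n)"
proof -
  assume f: "f \<in> low_degree A z n"
  then have "f = \<zero> \<otimes> z [^] n \<oplus> f" using z low_degree_closed by simp
  then show ?thesis using f subringE(2)[OF A] low_degree_SucI by metis
qed

lemma low_degree_z_mult: "f \<in> low_degree A z n \<Longrightarrow> z \<otimes> f \<in> low_degree A z (Suc n)"
proof (induction n arbitrary: f)
  case 0
  then show ?case using z low_degree_zero[of "Suc 0"] by simp
next
  case (Suc n)
  then obtain a f' where *: "a \<in> A" "f' \<in> low_degree A z n" "f = a \<otimes> z [^] n \<oplus> f'" by (elim low_degree_SucE)
  have "z \<otimes> f = a \<otimes> z [^] Suc n \<oplus> z \<otimes> f'"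
    using * Suc.prems subringE(1)[OF A] z low_degree_closed
    by (simp add: subsetD r_distr m_ac)
  then show ?case using * Suc.IH low_degree_SucI by metis
qed

lemma low_degree_pow_mult: "f \<in> low_degree A z n \<Longrightarrow> z [^] k \<otimes> f \<in> low_degree A z (k + n)"
proof (induction k)
  case 0
  then show ?case using low_degree_closed by simp
next
  case (Suc k)
  have "z [^] Suc k \<otimes> f = z \<otimes> (z [^] k \<otimes> f)"
    using z low_degree_closed[OF Suc.prems] by (simp add: m_ac)
  then show ?case using low_degree_z_mult[OF Suc.IH[OF Suc.prems]] by simp
qed

text \<open>The bounds count coefficients, so a product has one fewer than the sum of the two
  counts; \<open>Suc\<close> on the second factor avoids truncated subtraction.\<close>

lemma low_degree_mult_Suc:
  "f \<in> low_degree A z m \<Longrightarrow> g \<in> low_degree A z (Suc n) \<Longrightarrow> f \<otimes> g \<in> low_degree A z (m + n)"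
proof (induction m arbitrary: f)
  case 0
  then have "f \<otimes> g = \<zero>" using low_degree_closed[OF 0(2)] by simp
  then show ?case using low_degree_zero by simp
next
  case (Suc m)
  then obtain a f' where *: "a \<in> A" "f' \<in> low_degree A z m" "f = a \<otimes> z [^] m \<oplus> f'" by (elim low_degree_SucE)
  have g: "g \<in> carrier R" using Suc.prems low_degree_closed by blast
  have "f \<otimes> g = a \<otimes> (z [^] m \<otimes> g) \<oplus> f' \<otimes> g"
    using * g subringE(1)[OF A] z low_degree_closed by (simp add: subsetD l_distr m_assoc)
  moreover have "a \<otimes> (z [^] m \<otimes> g) \<in> low_degree A z (Suc m + n)"
    using low_degree_pow_mult[OF Suc.prems(2), of m] * low_degree_smult by simp
  moreover have "f' \<otimes> g \<in> low_degree A z (Suc m + n)"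
    using Suc.IH[OF *(2) Suc.prems(2)] low_degree_Suc by simp
  ultimately show ?case using low_degree_add by (metis)
qed

lemma low_degree_mult:
  "f \<in> low_degree A z m \<Longrightarrow> g \<in> low_degree A z n \<Longrightarrow> f \<otimes> g \<in> low_degree A z (m + n)"
  using low_degree_mult_Suc[of f m g n] low_degree_Suc[of g n] by simp

end

end

section \<open>Cayley-Hamilton over a domain by elimination\<close>

context domain
begin

text \<open>Division-free elimination: the matrix keeps monic entries of degree \<open>D\<close> in \<open>z\<close> on the diagonal
  and entries of lower degree elsewhere, and \<open>D\<close> doubles with each eliminated unknown.\<close>

lemma dependent_monic_system:
  assumes A: "subring A R" and z: "z \<in> carrier R"
    and "finite I" and "\<And>i j. i \<in> I \<Longrightarrow> j \<in> I \<Longrightarrow> B i j \<in> carrier R"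
    and "\<And>i. i \<in> I \<Longrightarrow> m i \<in> carrier R"
    and "\<And>i. i \<in> I \<Longrightarrow> (\<Oplus>j\<in>I. B i j \<otimes> m j) = \<zero>"
    and "\<And>i. i \<in> I \<Longrightarrow> B i i \<ominus> z [^] D \<in> low_degree A z D"
    and "\<And>i j. i \<in> I \<Longrightarrow> j \<in> I \<Longrightarrow> i \<noteq> j \<Longrightarrow> B i j \<in> low_degree A z D"
    and "\<exists>i\<in>I. m i \<noteq> \<zero>"
  shows "\<exists>D. z [^] (D::nat) \<in> low_degree A z D"
  using assms(3-)
proof (induction I arbitrary: B D rule: finite_induct)
  case empty
  then show ?case by simp
next
  case (insert n J)
  note zc = z low_degree_closed[OF A z]
  note Bc = insert.prems(1)
  note mc = insert.prems(2)
  have Bnn: "B n n \<ominus> z [^] D \<in> low_degree A z D" using insert.prems(4) by simp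
  show ?case
  proof (cases "\<exists>i\<in>J. m i \<noteq> \<zero>")
    case False
    \<comment> \<open>Row \<open>n\<close> has only the term \<open>B n n \<otimes> m n\<close>
      left. As \<open>m n\<close> is nonzero, \<open>B n n\<close> vanishes, and this is already a
      monic relation of degree \<open>D\<close>.\<close>
    then have m0: "\<And>i. i \<in> J \<Longrightarrow> m i = \<zero>" and mn: "m n \<noteq> \<zero>" using insert.prems by auto
    have "(\<Oplus>j\<in>J. B n j \<otimes> m j) = \<zero>"
      by (rule add.finprod_one_eqI) (simp add: m0 Bc)
    then have "B n n \<otimes> m n = \<zero>"
      using insert.prems(3)[of n] insert.hyps Bc mc by (simp add: finsum_insert Pi_def)
    then have "B n n = \<zero>" using integral[of "B n n" "m n"] mn Bc mc by auto
    then have "\<ominus> (B n n \<ominus> z [^] D) = z [^] D" using z by (simp add: a_minus_def)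
    then show ?thesis using low_degree_uminus[OF A z Bnn] by metis
  next
    case True
    \<comment> \<open>Row \<open>i\<close> times \<open>B n n\<close> minus row \<open>n\<close>
      times \<open>B i n\<close>: the coefficient of \<open>m n\<close> cancels and the solution
      survives, whether or not \<open>B n n\<close> is zero.\<close>
    define C where "C i j = B n n \<otimes> B i j \<ominus> B i n \<otimes> B n j" for i j
    show ?thesis
    proof (rule insert.IH[of C "D + D"])
      show "C i j \<in> carrier R" if "i \<in> J" "j \<in> J" for i j
        using that Bc by (simp add: C_def)
      show "m i \<in> carrier R" if "i \<in> J" for i using mc that by simp
      show "\<exists>i\<in>J. m i \<noteq> \<zero>" using True .
      have row: "(\<Oplus>j\<in>J. B i j \<otimes> m j) = \<ominus> (B i n \<otimes> m n)" if "i \<in> insert n J" for i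
      proof -
        have "B i n \<otimes> m n \<oplus> (\<Oplus>j\<in>J. B i j \<otimes> m j) = \<zero>"
          using insert.prems(3)[OF that] insert.hyps Bc mc that by (simp add: finsum_insert Pi_def)
        moreover have "(\<Oplus>j\<in>J. B i j \<otimes> m j) \<in> carrier R"
          using Bc mc that by (intro finsum_closed) auto
        ultimately show ?thesis using Bc mc that
          by (metis insertCI local.minus_minus local.minus_unique m_closed minus_equality)
      qed
      show "(\<Oplus>j\<in>J. C i j \<otimes> m j) = \<zero>" if i: "i \<in> J" for i
      proof -
        have "(\<Oplus>j\<in>J. C i j \<otimes> m j) = (\<Oplus>j\<in>J. B n n \<otimes> (B i j \<otimes> m j) \<oplus> \<ominus> B i n \<otimes> (B n j \<otimes> m j))"
          using Bc mc i by (intro finsum_cong') (auto simp: C_def a_minus_def l_distr m_assoc l_minus)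
        also have "\<dots> = (\<Oplus>j\<in>J. B n n \<otimes> (B i j \<otimes> m j)) \<oplus> (\<Oplus>j\<in>J. \<ominus> B i n \<otimes> (B n j \<otimes> m j))"
          using Bc mc i by (intro finsum_addf) auto
        also have "\<dots> = B n n \<otimes> (\<Oplus>j\<in>J. B i j \<otimes> m j) \<oplus> \<ominus> B i n \<otimes> (\<Oplus>j\<in>J. B n j \<otimes> m j)"
          using Bc mc i insert.hyps by (subst (1 2) finsum_rdistr) auto
        also have "\<dots> = B n n \<otimes> \<ominus> (B i n \<otimes> m n) \<oplus> \<ominus> B i n \<otimes> \<ominus> (B n n \<otimes> m n)"
          using row[of i] row[of n] i by simp
        also have "\<dots> = \<zero>"
          using Bc[of i n] Bc[of n n] mc[of n] i by (simp add: l_minus r_minus m_ac l_neg)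
        finally show ?thesis .
      qed
      show "C i j \<in> low_degree A z (D + D)" if ij: "i \<in> J" "j \<in> J" "i \<noteq> j" for i j
      proof -
        have nij: "i \<noteq> n" "n \<noteq> j" using ij insert.hyps by auto
        have "(B n n \<ominus> z [^] D) \<otimes> B i j \<in> low_degree A z (D + D)"
          using low_degree_mult[OF A z Bnn] insert.prems(5) ij by simp
        moreover have "z [^] D \<otimes> B i j \<in> low_degree A z (D + D)"
          using low_degree_pow_mult[OF A z] insert.prems(5) ij by simp
        moreover have "B i n \<otimes> B n j \<in> low_degree A z (D + D)"
          using low_degree_mult[OF A z] insert.prems(5) ij nij by simp
        moreover have "C i j = (B n n \<ominus> z [^] D) \<otimes> B i j \<oplus> z [^] D \<otimes> B i j \<ominus> B i n \<otimes> B n j"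
        proof -
          have "(B n n \<ominus> z [^] D) \<otimes> B i j \<oplus> z [^] D \<otimes> B i j = B n n \<otimes> B i j"
            using Bc[of n n] Bc[of i j] ij z
            by (simp add: a_minus_def l_distr l_minus a_assoc l_neg)
          then show ?thesis by (simp add: C_def)
        qed
        ultimately show ?thesis
          by (simp add: low_degree_minus[OF A z] low_degree_add[OF A z])
      qed
      show "C i i \<ominus> z [^] (D + D) \<in> low_degree A z (D + D)" if i: "i \<in> J" for i
      proof -
        have ni: "i \<noteq> n" using i insert.hyps by auto
        have Bii: "B i i \<ominus> z [^] D \<in> low_degree A z D" using insert.prems(4) i by simp
        \<comment> \<open>With both diagonal entries split into \<open>z [^] D\<close> and a lower
          part, their product visibly has leading term \<open>z [^] (D + D)\<close>, so the new
          diagonal is again monic.\<close>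
        define e f where "e = B n n \<ominus> z [^] D" and "f = B i i \<ominus> z [^] D"
        have ef: "e \<in> carrier R" "f \<in> carrier R" using Bc z i by (auto simp: e_def f_def)
        have Be: "B n n = z [^] D \<oplus> e" "B i i = z [^] D \<oplus> f"
          using Bc[of n n] Bc[of i i] z i by (simp_all add: e_def f_def a_minus_def a_lcomm r_neg)
        have zz: "z [^] (D + D) = z [^] D \<otimes> z [^] D" using z by (simp add: nat_pow_mult)
        have "B n n \<otimes> B i i = z [^] (D + D) \<oplus> (z [^] D \<otimes> f \<oplus> z [^] D \<otimes> e \<oplus> e \<otimes> f)"
          using ef z by (simp add: Be zz l_distr r_distr a_ac m_ac)
        then have "C i i \<ominus> z [^] (D + D) = (z [^] D \<otimes> f \<oplus> z [^] D \<otimes> e \<oplus> e \<otimes> f) \<ominus> B i n \<otimes> B n i"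
          using ef z Bc[of i n] Bc[of n i] i
          by (simp add: C_def a_minus_cancel_left)
        moreover have "z [^] D \<otimes> f \<in> low_degree A z (D + D)" "z [^] D \<otimes> e \<in> low_degree A z (D + D)"
          "e \<otimes> f \<in> low_degree A z (D + D)" "B i n \<otimes> B n i \<in> low_degree A z (D + D)"
          using low_degree_pow_mult[OF A z] low_degree_mult[OF A z] Bnn Bii insert.prems(5) i ni
          by (simp_all add: e_def f_def)
        ultimately show ?thesis
          by (simp add: low_degree_minus[OF A z] low_degree_add[OF A z])
      qed
    qed
  qed
qed

text \<open>Generators form an indexed family and not a set, because the products x^i y^j used later
  may coincide for different exponents.\<close>

definition lin_span :: "'a set \<Rightarrow> ('i \<Rightarrow> 'a) \<Rightarrow> 'i set \<Rightarrow> 'a set" where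
  "lin_span A m I = {\<Oplus>i\<in>I. a i \<otimes> m i | a. a \<in> I \<rightarrow> A}"

context
  fixes A and m :: "'i \<Rightarrow> 'a" and I
  assumes A: "subring A R" and m: "m \<in> I \<rightarrow> carrier R" and I: "finite I"
begin

lemma lin_span_closed: "x \<in> lin_span A m I \<Longrightarrow> x \<in> carrier R"
  using m subringE(1)[OF A] unfolding lin_span_def by (auto simp: Pi_iff subset_iff intro!: finsum_closed)

lemma lin_span_add:
  assumes "x \<in> lin_span A m I" "y \<in> lin_span A m I"
  shows "x \<oplus> y \<in> lin_span A m I"
proof -
  obtain a b where *: "a \<in> I \<rightarrow> A" "b \<in> I \<rightarrow> A"
    "x = (\<Oplus>i\<in>I. a i \<otimes> m i)" "y = (\<Oplus>i\<in>I. b i \<otimes> m i)"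
    using assms unfolding lin_span_def by blast
  have "x \<oplus> y = (\<Oplus>i\<in>I. a i \<otimes> m i \<oplus> b i \<otimes> m i)"
    unfolding * using * m subringE(1)[OF A] by (intro finsum_addf[symmetric]) blast+
  also have "\<dots> = (\<Oplus>i\<in>I. (a i \<oplus> b i) \<otimes> m i)"
    using * m subringE(1)[OF A] by (intro finsum_cong') (auto simp: l_distr Pi_iff subset_iff)
  finally show ?thesis
    unfolding lin_span_def using *(1,2) subringE(7)[OF A] by (auto intro!: exI[of _ "\<lambda>i. a i \<oplus> b i"])
qed

lemma lin_span_smult:
  assumes "x \<in> lin_span A m I" "c \<in> A"
  shows "c \<otimes> x \<in> lin_span A m I"
proof -
  obtain a where *: "a \<in> I \<rightarrow> A" "x = (\<Oplus>i\<in>I. a i \<otimes> m i)"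
    using assms unfolding lin_span_def by blast
  have "c \<otimes> x = (\<Oplus>i\<in>I. c \<otimes> (a i \<otimes> m i))"
    unfolding * using *(1) m subringE(1)[OF A] assms(2) I by (intro finsum_rdistr) (auto simp: Pi_iff subset_iff)
  also have "\<dots> = (\<Oplus>i\<in>I. (c \<otimes> a i) \<otimes> m i)"
    using *(1) m subringE(1)[OF A] assms(2)
    by (intro finsum_cong') (auto simp: m_assoc Pi_iff subset_iff)
  finally show ?thesis
    unfolding lin_span_def using *(1) assms(2) subringE(6)[OF A]
    by (auto intro!: exI[of _ "\<lambda>i. c \<otimes> a i"])
qed

lemma lin_span_zero: "\<zero> \<in> lin_span A m I"
proof -
  have "(\<Oplus>i\<in>I. \<zero> \<otimes> m i) = \<zero>" using m by (intro add.finprod_one_eqI) (auto simp: Pi_iff)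
  then show ?thesis unfolding lin_span_def using subringE(2)[OF A] by force
qed

lemma lin_span_base:
  assumes "i \<in> I"
  shows "m i \<in> lin_span A m I"
proof -
  have "(\<Oplus>j\<in>I. (if i = j then \<one> else \<zero>) \<otimes> m j) = (\<Oplus>j\<in>I. if i = j then m j else \<zero>)"
    using m by (intro finsum_cong') (auto simp: Pi_iff)
  also have "\<dots> = m i" using finsum_singleton[OF assms I m] .
  finally have "m i = (\<Oplus>j\<in>I. (if i = j then \<one> else \<zero>) \<otimes> m j)" by simp
  then show ?thesis unfolding lin_span_def using subringE(2,3)[OF A]
    by (auto intro!: exI[of _ "\<lambda>j. if i = j then \<one> else \<zero>"])
qed

lemma lin_span_sum:
  assumes "finite J" "f \<in> J \<rightarrow> lin_span A m I"
  shows "finsum R f J \<in> lin_span A m I"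
  using assms
proof (induction J rule: finite_induct)
  case (insert j J)
  then have "finsum R f (insert j J) = f j \<oplus> finsum R f J"
    using lin_span_closed by (intro finsum_insert) auto
  then show ?case using insert lin_span_add by auto
qed (simp add: lin_span_zero)

text \<open>Scalars commute with \<open>z\<close>, so stability on the generators suffices. This
  permits multiplying by one integral element after another.\<close>

lemma lin_span_mult:
  assumes z: "z \<in> carrier R" and "\<And>i. i \<in> I \<Longrightarrow> z \<otimes> m i \<in> lin_span A m I"
    and x: "x \<in> lin_span A m I"
  shows "z \<otimes> x \<in> lin_span A m I"
proof -
  obtain a where *: "a \<in> I \<rightarrow> A" "x = (\<Oplus>i\<in>I. a i \<otimes> m i)"
    using x unfolding lin_span_def by blast
  have "z \<otimes> x = (\<Oplus>i\<in>I. z \<otimes> (a i \<otimes> m i))"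
    unfolding * using *(1) m subringE(1)[OF A] z I by (intro finsum_rdistr) (auto simp: Pi_iff subset_iff)
  also have "\<dots> = (\<Oplus>i\<in>I. a i \<otimes> (z \<otimes> m i))"
    using *(1) m subringE(1)[OF A] z
    by (intro finsum_cong') (auto simp: m_lcomm Pi_iff subset_iff)
  finally show ?thesis
    using lin_span_sum[OF I] lin_span_smult assms(2) *(1) by (simp add: Pi_iff)
qed

text \<open>The determinant-free form of the Cayley--Hamilton argument: \<open>dependent_monic_system\<close>
  applied to the matrix of \<open>z - a\<close>, where \<open>a\<close> describes multiplication by \<open>z\<close>.\<close>

lemma stable_lin_span_imp_monic:
  assumes z: "z \<in> carrier R" and stable: "\<And>i. i \<in> I \<Longrightarrow> z \<otimes> m i \<in> lin_span A m I"
    and nz: "\<exists>i\<in>I. m i \<noteq> \<zero>"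
  shows "\<exists>D. z [^] (D::nat) \<in> low_degree A z D"
proof -
  have "\<forall>i\<in>I. \<exists>a. a \<in> I \<rightarrow> A \<and> z \<otimes> m i = (\<Oplus>j\<in>I. a j \<otimes> m j)"
    using stable unfolding lin_span_def by blast
  then obtain a where a: "\<And>i. i \<in> I \<Longrightarrow> a i \<in> I \<rightarrow> A"
    "\<And>i. i \<in> I \<Longrightarrow> z \<otimes> m i = (\<Oplus>j\<in>I. a i j \<otimes> m j)"
    by metis
  have aA: "a i j \<in> A" if "i \<in> I" "j \<in> I" for i j using a(1)[OF that(1)] that(2) by auto
  have ac: "a i j \<in> carrier R" if "i \<in> I" "j \<in> I" for i j
    using aA[OF that] subringE(1)[OF A] by auto
  define B where "B i j = (if i = j then z else \<zero>) \<ominus> a i j" for i j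
  have low1: "x \<in> A \<Longrightarrow> x \<in> low_degree A z 1" for x
    using low_degree_SucI[of A z x \<zero> 0] subringE(1)[OF A] A z by (auto simp: subset_iff)
  show ?thesis
  \<comment> \<open>The elimination starts at \<open>D = 1\<close>: diagonal entries
    \<open>z \<ominus> a i i\<close> are monic of degree one, all others are constants from
    \<open>A\<close>.\<close>
  proof (rule dependent_monic_system[OF A z I, of B m 1])
    show "B i j \<in> carrier R" if "i \<in> I" "j \<in> I" for i j
      using that ac z by (simp add: B_def)
    show "m i \<in> carrier R" if "i \<in> I" for i using m that by auto
    show "(\<Oplus>j\<in>I. B i j \<otimes> m j) = \<zero>" if i: "i \<in> I" for i
    proof -
      have "(\<Oplus>j\<in>I. B i j \<otimes> m j) =
          (\<Oplus>j\<in>I. (if i = j then z \<otimes> m j else \<zero>) \<oplus> \<ominus> \<one> \<otimes> (a i j \<otimes> m j))"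
        using m ac i z
        by (intro finsum_cong') (auto simp: B_def Pi_iff a_minus_def l_distr l_minus)
      also have "\<dots> = (\<Oplus>j\<in>I. if i = j then z \<otimes> m j else \<zero>) \<oplus> (\<Oplus>j\<in>I. \<ominus> \<one> \<otimes> (a i j \<otimes> m j))"
        using m ac i z by (intro finsum_addf) (auto simp: Pi_iff)
      also have "(\<Oplus>j\<in>I. if i = j then z \<otimes> m j else \<zero>) = z \<otimes> m i"
        using m z by (intro finsum_singleton[OF i I]) auto
      also have "(\<Oplus>j\<in>I. \<ominus> \<one> \<otimes> (a i j \<otimes> m j)) = \<ominus> \<one> \<otimes> (\<Oplus>j\<in>I. a i j \<otimes> m j)"
        using m ac i I by (intro finsum_rdistr[symmetric]) auto
      also have "z \<otimes> m i \<oplus> \<ominus> \<one> \<otimes> (\<Oplus>j\<in>I. a i j \<otimes> m j) = \<zero>"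
        using a(2)[OF i, symmetric] z m i by (auto simp: l_minus r_neg Pi_iff)
      finally show ?thesis .
    qed
    show "B i i \<ominus> z [^] (1::nat) \<in> low_degree A z 1" if i: "i \<in> I" for i
    proof -
      have "B i i \<ominus> z [^] (1::nat) = \<ominus> a i i"
        using a_minus_cancel_left[of z \<zero> "a i i"] ac[OF i i] z by (simp add: B_def a_minus_def)
      then show ?thesis using low1 aA[OF i i] subringE(5)[OF A] by simp
    qed
    show "B i j \<in> low_degree A z 1" if "i \<in> I" "j \<in> I" "i \<noteq> j" for i j
      using low1 aA[of i j] ac[of i j] that subringE(5)[OF A] by (simp add: B_def a_minus_def)
  qed (rule nz)
qed

end

end

text \<open>A monic list is \<open>\<one>\<close> followed by \<open>n\<close> coefficients; moving
  those to the other side costs a sign, which \<open>low_degree\<close> absorbs.\<close>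

lemma (in domain) integral_closure_iff:
  assumes A: "subring A R"
  shows "x \<in> integral_closure R A \<longleftrightarrow> x \<in> carrier R \<and> (\<exists>n. x [^] (n::nat) \<in> low_degree A x n)"
proof
  assume "x \<in> integral_closure R A"
  then obtain p where x: "x \<in> carrier R" and p: "p \<noteq> []" "set p \<subseteq> A" "hd p = \<one>" "eval p x = \<zero>"
    unfolding integral_closure_def by blast
  then obtain ps where ps: "p = \<one> # ps" by (metis list.collapse)
  have "eval ps x \<in> low_degree A x (length ps)"
    unfolding low_degree_eq_eval using p ps by auto
  moreover have "x [^] length ps = \<ominus> eval ps x"
    using p x ps minus_equality[of "x [^] length ps" "eval ps x"]
      subringE(1)[OF A] eval_in_carrier[of ps x] by (auto dest: subset_trans)
  ultimately show "x \<in> carrier R \<and> (\<exists>n. x [^] (n::nat) \<in> low_degree A x n)"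
    using x low_degree_uminus[OF A x] by metis
next
  assume "x \<in> carrier R \<and> (\<exists>n. x [^] (n::nat) \<in> low_degree A x n)"
  then obtain n where x: "x \<in> carrier R" and n: "x [^] (n::nat) \<in> low_degree A x n" by blast
  then obtain p where p: "set p \<subseteq> A" "length p = n" "\<ominus> (x [^] n) = eval p x"
    using low_degree_uminus[OF A x n] unfolding low_degree_eq_eval by blast
  have "eval (\<one> # p) x = \<zero>" using p(2) x by (simp add: p(3)[symmetric] r_neg)
  then show "x \<in> integral_closure R A"
    unfolding integral_closure_def using p x subringE(3)[OF A] by (auto intro!: exI[of _ "\<one> # p"])
qed

section \<open>The ring of integral elements\<close>

context domain
begin

context
  fixes A
  assumes A: "subring A R"
begin

text \<open>The span of x^i y^j with i < d and j < e is stable under multiplication by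
  \<open>x\<close> and by \<open>y\<close>, hence by their sum and product and by
  \<open>\<ominus> x\<close>; each of these is therefore integral.\<close>

lemma integral_closure_ops:
  assumes x: "x \<in> integral_closure R A" and y: "y \<in> integral_closure R A"
  shows "x \<oplus> y \<in> integral_closure R A" "x \<otimes> y \<in> integral_closure R A" "\<ominus> x \<in> integral_closure R A"
proof -
  have xc: "x \<in> carrier R" and yc: "y \<in> carrier R" using x y by (auto simp: integral_closure_iff[OF A])
  obtain d e where d: "x [^] (d::nat) \<in> low_degree A x d" and e: "y [^] (e::nat) \<in> low_degree A y e"
    using x y by (auto simp: integral_closure_iff[OF A])
  \<comment> \<open>\<open>low_degree\<close> with bound 0 contains only \<open>\<zero>\<close>,
    never the zeroth power \<open>\<one>\<close>. Positivity puts the index (0, 0), whose generator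
    is \<open>\<one>\<close>, into \<open>I\<close>.\<close>
  have pos: "d > 0" "e > 0" using d e by (auto intro!: Nat.gr0I)
  define I where "I = {..<d} \<times> {..<e}"
  define m where "m = (\<lambda>(i, j). x [^] (i::nat) \<otimes> y [^] (j::nat))"
  have I: "finite I" by (simp add: I_def)
  have m: "m \<in> I \<rightarrow> carrier R" using xc yc by (auto simp: m_def)
  note span = lin_span_base[OF A m I] lin_span_add[OF A m I] lin_span_smult[OF A m I]
    lin_span_zero[OF A m I]
  have x_low: "f \<otimes> y [^] j \<in> lin_span A m I" if "f \<in> low_degree A x k" "k \<le> d" "j < e" for f k j
    using that
  proof (induction k arbitrary: f)
    case 0
    then show ?case using span(4) yc by simp
  next
    case (Suc k)
    then obtain a f' where *: "a \<in> A" "f' \<in> low_degree A x k" "f = a \<otimes> x [^] k \<oplus> f'"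
      by (elim low_degree_SucE[OF A xc])
    have "f \<otimes> y [^] j = a \<otimes> m (k, j) \<oplus> f' \<otimes> y [^] j"
      using * xc yc low_degree_closed[OF A xc *(2)] subringE(1)[OF A]
      by (simp add: m_def l_distr m_assoc subset_iff)
    moreover have "(k, j) \<in> I" using Suc.prems by (simp add: I_def)
    ultimately show ?case using span *(1) Suc.IH[OF *(2)] Suc.prems by simp
  qed
  have y_low: "x [^] i \<otimes> f \<in> lin_span A m I" if "f \<in> low_degree A y k" "k \<le> e" "i < d" for f k i
    using that
  proof (induction k arbitrary: f)
    case 0
    then show ?case using span(4) xc by simp
  next
    case (Suc k)
    then obtain a f' where *: "a \<in> A" "f' \<in> low_degree A y k" "f = a \<otimes> y [^] k \<oplus> f'"
      by (elim low_degree_SucE[OF A yc])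
    have "x [^] i \<otimes> f = a \<otimes> m (i, k) \<oplus> x [^] i \<otimes> f'"
      using * xc yc low_degree_closed[OF A yc *(2)] subringE(1)[OF A]
      by (simp add: m_def r_distr m_lcomm subset_iff)
    moreover have "(i, k) \<in> I" using Suc.prems by (simp add: I_def)
    ultimately show ?case using span *(1) Suc.IH[OF *(2)] Suc.prems by simp
  qed
  have xm: "x \<otimes> m l \<in> lin_span A m I" if lI: "l \<in> I" for l
  proof -
    obtain i j where l: "l = (i, j)" "i < d" "j < e" using lI by (cases l) (auto simp: I_def)
    have *: "x \<otimes> m l = x [^] Suc i \<otimes> y [^] j" using l xc yc by (simp add: m_def m_ac)
    show ?thesis
    \<comment> \<open>Only the top exponent calls for the integral equation of \<open>x\<close>;
      below it, multiplication just shifts the index.\<close>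
    proof (cases "Suc i = d")
      case True
      then show ?thesis using x_low[OF d] l(3) * by simp
    next
      case False
      then have "(Suc i, j) \<in> I" using l by (simp add: I_def)
      then show ?thesis using span(1)[of "(Suc i, j)"] * by (simp add: m_def)
    qed
  qed
  have ym: "y \<otimes> m l \<in> lin_span A m I" if lI: "l \<in> I" for l
  proof -
    obtain i j where l: "l = (i, j)" "i < d" "j < e" using lI by (cases l) (auto simp: I_def)
    have *: "y \<otimes> m l = x [^] i \<otimes> y [^] Suc j" using l xc yc by (simp add: m_def m_ac)
    show ?thesis
    proof (cases "Suc j = e")
      case True
      then show ?thesis using y_low[OF e] l(2) * by simp
    next
      case False
      then have "(i, Suc j) \<in> I" using l by (simp add: I_def)
      then show ?thesis using span(1)[of "(i, Suc j)"] * by (simp add: m_def)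
    qed
  qed
  have "m (0, 0) = \<one>" by (simp add: m_def)
  moreover have "(0, 0) \<in> I" using pos by (simp add: I_def)
  ultimately have nz: "\<exists>i\<in>I. m i \<noteq> \<zero>" by force
  have mc: "m l \<in> carrier R" if "l \<in> I" for l using m that by auto
  have integralI: "z \<in> integral_closure R A"
    if "z \<in> carrier R" "\<And>l. l \<in> I \<Longrightarrow> z \<otimes> m l \<in> lin_span A m I" for z
    using stable_lin_span_imp_monic[OF A m I that(1) that(2) nz] that(1)
    by (simp add: integral_closure_iff[OF A])
  show "x \<oplus> y \<in> integral_closure R A"
    using xc yc mc xm ym span(2) by (intro integralI) (auto simp: l_distr)
  show "x \<otimes> y \<in> integral_closure R A"
    using xc yc mc xm ym lin_span_mult[OF A m I xc xm] by (intro integralI) (auto simp: m_assoc)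
  have "\<ominus> x \<otimes> m l = \<ominus> \<one> \<otimes> (x \<otimes> m l)" if "l \<in> I" for l using mc that xc by (simp add: l_minus)
  then show "\<ominus> x \<in> integral_closure R A"
    using xc xm span(3) subringE(3,5)[OF A] by (intro integralI) auto
qed

lemma integral_closure_base: "A \<subseteq> integral_closure R A"
proof
  fix x assume x: "x \<in> A"
  have xc: "x \<in> carrier R" using x subringE(1)[OF A] by blast
  have "x [^] (1::nat) = x \<otimes> x [^] (0::nat) \<oplus> \<zero>" using xc by simp
  then have "x [^] (1::nat) \<in> low_degree A x 1"
    using low_degree_SucI[OF A xc x, of \<zero> 0] by simp
  then show "x \<in> integral_closure R A" using xc integral_closure_iff[OF A] by blast
qed

lemma integral_closure_subring: "subring (integral_closure R A) R"
proof (rule subringI)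
  show "integral_closure R A \<subseteq> carrier R" by (auto simp: integral_closure_def)
  show "\<one> \<in> integral_closure R A" using integral_closure_base subringE(3)[OF A] by blast
qed (use integral_closure_ops in blast)+

end

end

section \<open>Automorphisms and the degree\<close>

context field
begin

text \<open>Induction on the equations: a nontrivial equation is solved for one unknown
  \<open>w\<close> and substituted into the others, a trivial one is dropped. Applied with
  automorphisms as unknowns and a basis as equations, and conversely, this gives both inequalities
  between group order and degree.\<close>

lemma homogeneous_system_nontrivial_solution:
  assumes "finite E" "finite U" "card E < card U"
    and "\<And>e x. e \<in> E \<Longrightarrow> x \<in> U \<Longrightarrow> a e x \<in> carrier R"
  shows "\<exists>c \<in> U \<rightarrow> carrier R. (\<exists>x\<in>U. c x \<noteq> \<zero>) \<and> (\<forall>e\<in>E. (\<Oplus>x\<in>U. a e x \<otimes> c x) = \<zero>)"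
  using assms
proof (induction E arbitrary: U a rule: finite_induct)
  case empty
  then obtain x where "x \<in> U" by (metis card_gt_0_iff card.empty ex_in_conv)
  then show ?case by (intro bexI[of _ "\<lambda>_. \<one>"]) auto
next
  case (insert e E)
  note ac = insert.prems(3)
  show ?case
  proof (cases "\<forall>x\<in>U. a e x = \<zero>")
    case True
    obtain c where c: "c \<in> U \<rightarrow> carrier R" "\<exists>x\<in>U. c x \<noteq> \<zero>" "\<forall>e\<in>E. (\<Oplus>x\<in>U. a e x \<otimes> c x) = \<zero>"
      using insert.IH[of U a] insert.prems insert.hyps by auto
    have "(\<Oplus>x\<in>U. a e x \<otimes> c x) = \<zero>"
      using True c(1) by (intro add.finprod_one_eqI) (auto simp: Pi_iff)
    then show ?thesis using c by (intro bexI[of _ c]) auto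
  next
    case False
    then obtain w where w: "w \<in> U" "a e w \<noteq> \<zero>" by blast
    define Y where "Y = U - {w}"
    have Y: "finite Y" "w \<notin> Y" "U = insert w Y" using w insert.prems(1) by (auto simp: Y_def)
    define b where "b = inv (a e w)"
    have b: "b \<in> carrier R" "b \<otimes> a e w = \<one>" "a e w \<otimes> b = \<one>"
      using w ac[of e w] field_Units by (auto simp: b_def)
    \<comment> \<open>Subtracting the right multiple of equation \<open>e\<close> makes the
      coefficient at the pivot \<open>w\<close> zero.\<close>
    define a' where "a' f x = a f x \<ominus> (a f w \<otimes> b) \<otimes> a e x" for f x
    have "card E < card Y" using insert.prems insert.hyps Y by simp
    moreover have a'c: "a' f x \<in> carrier R" if "f \<in> E" "x \<in> Y" for f x
      using that ac b w Y by (simp add: a'_def)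
    ultimately obtain c where c: "c \<in> Y \<rightarrow> carrier R" "\<exists>x\<in>Y. c x \<noteq> \<zero>"
      "\<forall>f\<in>E. (\<Oplus>x\<in>Y. a' f x \<otimes> c x) = \<zero>"
      using insert.IH[OF Y(1), of a'] by blast
    define s where "s f = (\<Oplus>x\<in>Y. a f x \<otimes> c x)" for f
    have s: "s f \<in> carrier R" if "f \<in> insert e E" for f
      using that c(1) ac Y by (auto simp: s_def Pi_iff intro!: finsum_closed)
    \<comment> \<open>The value at \<open>w\<close> is the one forced by equation \<open>e\<close>
      once the other unknowns are given by \<open>c\<close>.\<close>
    define d where "d = c(w := \<ominus> (b \<otimes> s e))"
    have dY: "d x = c x" if "x \<in> Y" for x using that Y by (auto simp: d_def)
    have dw: "d w = \<ominus> (b \<otimes> s e)" by (simp add: d_def)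
    have d: "d \<in> U \<rightarrow> carrier R" using c(1) b s unfolding Y(3) d_def by (auto simp: Pi_iff)
    have sum: "(\<Oplus>x\<in>U. a f x \<otimes> d x) = a f w \<otimes> \<ominus> (b \<otimes> s e) \<oplus> s f" if f: "f \<in> insert e E" for f
    proof -
      have "(\<Oplus>x\<in>U. a f x \<otimes> d x) = a f w \<otimes> d w \<oplus> (\<Oplus>x\<in>Y. a f x \<otimes> d x)"
        unfolding Y(3) using Y ac d f by (intro finsum_insert) (auto simp: Pi_iff)
      also have "(\<Oplus>x\<in>Y. a f x \<otimes> d x) = s f"
        unfolding s_def using dY ac c(1) f Y by (intro finsum_cong') (auto simp: Pi_iff)
      finally show ?thesis by (simp add: dw)
    qed
    have "(\<Oplus>x\<in>U. a f x \<otimes> d x) = \<zero>" if f: "f \<in> insert e E" for f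
    proof (cases "f = e")
      case True
      have "a e w \<otimes> \<ominus> (b \<otimes> s e) = \<ominus> ((a e w \<otimes> b) \<otimes> s e)"
        using b(1) s ac w by (simp add: r_minus m_assoc)
      also have "\<dots> = \<ominus> s e" unfolding b(3) using s by simp
      finally show ?thesis using sum[OF f] True s by (simp add: l_neg)
    next
      case False
      then have fE: "f \<in> E" using f by simp
      define k where "k = a f w \<otimes> b"
      have k: "k \<in> carrier R" using ac w b f by (simp add: k_def)
      have "(\<Oplus>x\<in>Y. a' f x \<otimes> c x) = (\<Oplus>x\<in>Y. a f x \<otimes> c x \<oplus> \<ominus> k \<otimes> (a e x \<otimes> c x))"
        using ac c(1) Y fE k
        by (intro finsum_cong')
          (auto simp: Pi_iff a'_def k_def[symmetric] a_minus_def l_distr l_minus m_assoc)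
      then have "\<zero> = (\<Oplus>x\<in>Y. a f x \<otimes> c x \<oplus> \<ominus> k \<otimes> (a e x \<otimes> c x))"
        using c(3) fE by simp
      also have "\<dots> = s f \<oplus> (\<Oplus>x\<in>Y. \<ominus> k \<otimes> (a e x \<otimes> c x))"
        unfolding s_def using ac c(1) Y fE k by (intro finsum_addf) (auto simp: Pi_iff)
      also have "(\<Oplus>x\<in>Y. \<ominus> k \<otimes> (a e x \<otimes> c x)) = \<ominus> k \<otimes> s e"
        unfolding s_def using ac c(1) Y fE k by (intro finsum_rdistr[symmetric]) (auto simp: Pi_iff)
      also have "\<ominus> k \<otimes> s e = a f w \<otimes> \<ominus> (b \<otimes> s e)"
        using ac w b f s by (simp add: k_def l_minus r_minus m_assoc)
      finally show ?thesis using sum[OF f] s f ac w b by (simp add: a_comm)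
    qed
    moreover have "\<exists>x\<in>U. d x \<noteq> \<zero>" using c(2) dY Y by auto
    ultimately show ?thesis using d by blast
  qed
qed

text \<open>The relation at \<open>y \<otimes> x\<close> minus \<open>\<tau> y\<close> times the
  relation at \<open>x\<close> has no \<tau>-term, so induction gives
  \<open>c \<rho> \<otimes> (\<rho> y \<ominus> \<tau> y) = \<zero>\<close> for all
  \<open>y\<close>. Extensionality ensures that distinct members of \<open>A\<close> really differ
  somewhere on the carrier.\<close>

lemma dedekind_independence:
  assumes "finite A" and "A \<subseteq> ring_hom R R" and "A \<subseteq> extensional (carrier R)"
    and "c \<in> A \<rightarrow> carrier R"
    and "\<And>x. x \<in> carrier R \<Longrightarrow> (\<Oplus>h\<in>A. c h \<otimes> h x) = \<zero>"
    and "h \<in> A"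
  shows "c h = \<zero>"
  using assms
proof (induction A arbitrary: c h rule: finite_induct)
  case empty
  then show ?case by simp
next
  case (insert \<tau> A)
  note hom = ring_hom_closed[of _ R R] ring_hom_mult[of _ R R] ring_hom_one[of _ R R]
  have hA: "\<rho> \<in> ring_hom R R" if "\<rho> \<in> insert \<tau> A" for \<rho> using insert.prems that by blast
  have cc: "c \<rho> \<in> carrier R" if "\<rho> \<in> insert \<tau> A" for \<rho> using insert.prems(3) that by blast
  define s where "s x = (\<Oplus>\<rho>\<in>A. c \<rho> \<otimes> \<rho> x)" for x
  have sc: "s x \<in> carrier R" if "x \<in> carrier R" for x
    unfolding s_def using that cc hA hom(1) by (auto intro!: finsum_closed)
  have s: "s x = \<ominus> (c \<tau> \<otimes> \<tau> x)" if x: "x \<in> carrier R" for x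
  proof -
    have "c \<tau> \<otimes> \<tau> x \<oplus> s x = \<zero>"
      using insert.prems(4)[OF x] insert.hyps cc hA hom(1) x by (simp add: s_def Pi_iff)
    then show ?thesis using minus_equality[of "s x" "c \<tau> \<otimes> \<tau> x"] sc[OF x] cc hA hom(1) x
      by (simp add: a_comm)
  qed
  have zero: "c \<rho> \<otimes> (\<rho> y \<ominus> \<tau> y) = \<zero>" if \<rho>: "\<rho> \<in> A" and y: "y \<in> carrier R" for \<rho> y
  proof (rule insert.IH[of "\<lambda>\<rho>. c \<rho> \<otimes> (\<rho> y \<ominus> \<tau> y)" \<rho>])
    show "(\<lambda>\<rho>. c \<rho> \<otimes> (\<rho> y \<ominus> \<tau> y)) \<in> A \<rightarrow> carrier R" using cc hA hom(1) y by auto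
    fix x assume x: "x \<in> carrier R"
    have "(\<Oplus>\<rho>\<in>A. c \<rho> \<otimes> (\<rho> y \<ominus> \<tau> y) \<otimes> \<rho> x) =
        (\<Oplus>\<rho>\<in>A. c \<rho> \<otimes> \<rho> (y \<otimes> x) \<oplus> \<ominus> \<tau> y \<otimes> (c \<rho> \<otimes> \<rho> x))"
    proof (rule finsum_cong'[OF refl])
      fix \<rho> assume "\<rho> \<in> A"
      then have *: "c \<rho> \<in> carrier R" "\<rho> x \<in> carrier R" "\<rho> y \<in> carrier R" "\<tau> y \<in> carrier R"
        "\<rho> (y \<otimes> x) = \<rho> y \<otimes> \<rho> x"
        using cc hA hom x y by auto
      then show "c \<rho> \<otimes> (\<rho> y \<ominus> \<tau> y) \<otimes> \<rho> x = c \<rho> \<otimes> \<rho> (y \<otimes> x) \<oplus> \<ominus> \<tau> y \<otimes> (c \<rho> \<otimes> \<rho> x)"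
        by (simp add: a_minus_def l_distr r_distr l_minus r_minus m_ac)
    qed (use cc hA hom x y in auto)
    also have "\<dots> = s (y \<otimes> x) \<oplus> (\<Oplus>\<rho>\<in>A. \<ominus> \<tau> y \<otimes> (c \<rho> \<otimes> \<rho> x))"
      unfolding s_def using cc hA hom(1) x y by (intro finsum_addf) auto
    also have "(\<Oplus>\<rho>\<in>A. \<ominus> \<tau> y \<otimes> (c \<rho> \<otimes> \<rho> x)) = \<ominus> \<tau> y \<otimes> s x"
      unfolding s_def using cc hA hom(1) x y insert.hyps by (intro finsum_rdistr[symmetric]) auto
    also have "s (y \<otimes> x) \<oplus> \<ominus> \<tau> y \<otimes> s x = \<zero>"
    proof -
      have *: "c \<tau> \<in> carrier R" "\<tau> x \<in> carrier R" "\<tau> y \<in> carrier R" "\<tau> (y \<otimes> x) = \<tau> y \<otimes> \<tau> x"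
        using cc hA hom x y by auto
      then show ?thesis using s[OF x] s[of "y \<otimes> x"] x y
        by (simp add: l_minus r_minus m_ac l_neg)
    qed
    finally show "(\<Oplus>\<rho>\<in>A. c \<rho> \<otimes> (\<rho> y \<ominus> \<tau> y) \<otimes> \<rho> x) = \<zero>" .
  qed (use insert.prems \<rho> in auto)
  have cA: "c \<rho> = \<zero>" if \<rho>: "\<rho> \<in> A" for \<rho>
  proof (rule ccontr)
    assume nz: "c \<rho> \<noteq> \<zero>"
    have "\<rho> y = \<tau> y" if y: "y \<in> carrier R" for y
      using zero[OF \<rho> y] nz integral[of "c \<rho>" "\<rho> y \<ominus> \<tau> y"] cc hA hom(1) \<rho> y by auto
    then have "\<rho> = \<tau>" using extensionalityI[of \<rho> "carrier R" \<tau>] insert.prems(2) \<rho> by blast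
    then show False using insert.hyps \<rho> by blast
  qed
  \<comment> \<open>All coefficients except that of \<tau> are gone; evaluating at
    \<open>\<one>\<close>, which \<tau> fixes, isolates the last one.\<close>
  have "s \<one> = \<zero>" unfolding s_def using cA hA hom(1) by (intro add.finprod_one_eqI) (auto simp: Pi_iff)
  then have "c \<tau> = \<zero>" using s[of \<one>] hom(3)[OF hA[of \<tau>]] cc[of \<tau>] by (simp add: add.inv_eq_1_iff)
  then show ?case using cA insert.prems(5) by blast
qed

lemma combine_map_eq_finsum:
  assumes "distinct Us" "set Us \<subseteq> carrier R" "c \<in> set Us \<rightarrow> carrier R"
  shows "combine (map c Us) Us = (\<Oplus>u\<in>set Us. c u \<otimes> u)"
  using assms by (induction Us) (auto simp: Pi_iff subset_iff)

lemma independent_imp_finsum_trivial: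
  assumes K: "subfield K R" and ind: "independent K Us" and c: "c \<in> set Us \<rightarrow> K"
    and sum: "(\<Oplus>u\<in>set Us. c u \<otimes> u) = \<zero>" and u: "u \<in> set Us"
  shows "c u = \<zero>"
proof -
  have "combine (map c Us) Us = \<zero>"
    using combine_map_eq_finsum[OF independent_distinct[OF K ind] independent_in_carrier[OF ind], of c]
      sum c subfieldE(3)[OF K] by (auto simp: Pi_iff subset_iff)
  then have "set (take (length Us) (map c Us)) \<subseteq> {\<zero>}"
    using independent_imp_trivial_combine[OF K ind, of "map c Us"] c by (auto simp: Pi_iff)
  then show ?thesis using u by auto
qed

text \<open>Maps that fix \<open>K\<close> are \<open>K\<close>-linear, so a combination of them
  that kills the generators kills their span.\<close>

lemma span_kernel:
  assumes K: "subfield K R" and A: "finite A" "A \<subseteq> ring_hom R R" and fixed: "\<And>h y. h \<in> A \<Longrightarrow> y \<in> K \<Longrightarrow> h y = y"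
    and c: "c \<in> A \<rightarrow> carrier R" and Us: "set Us \<subseteq> carrier R"
    and zero: "\<And>u. u \<in> set Us \<Longrightarrow> (\<Oplus>h\<in>A. c h \<otimes> h u) = \<zero>"
    and x: "x \<in> Span K Us"
  shows "(\<Oplus>h\<in>A. c h \<otimes> h x) = \<zero>"
  using Us zero x
proof (induction Us arbitrary: x)
  case Nil
  then have "h x = \<zero>" if "h \<in> A" for h
    using ring_hom_zero[of h R R] A(2) that is_ring by auto
  then show ?case using c by (intro add.finprod_one_eqI) (metis PiE r_null)
next
  case (Cons u Us)
  then obtain k y where *: "k \<in> K" "y \<in> Span K Us" "x = k \<otimes> u \<oplus> y"
    by (auto simp: line_extension_mem_iff)
  have **: "k \<in> carrier R" "u \<in> carrier R" "y \<in> carrier R"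
    using * Cons.prems subfieldE(3)[OF K] Span_in_carrier[OF subfieldE(3)[OF K], of Us] by auto
  have hom: "h \<in> ring_hom R R" if "h \<in> A" for h using A that by blast
  have "(\<Oplus>h\<in>A. c h \<otimes> h x) = (\<Oplus>h\<in>A. k \<otimes> (c h \<otimes> h u) \<oplus> c h \<otimes> h y)"
  proof (rule finsum_cong'[OF refl])
    fix h assume h: "h \<in> A"
    have "h x = k \<otimes> h u \<oplus> h y"
      using ** *(1,3) hom[OF h] fixed[OF h] by (simp add: ring_hom_add[of h R R] ring_hom_mult[of h R R])
    then show "c h \<otimes> h x = k \<otimes> (c h \<otimes> h u) \<oplus> c h \<otimes> h y"
      using h c ** ring_hom_closed[OF hom[OF h]] by (auto simp: r_distr m_ac Pi_iff)
  qed (use c ** ring_hom_closed[OF hom] in \<open>auto simp: Pi_iff\<close>)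
  also have "\<dots> = (\<Oplus>h\<in>A. k \<otimes> (c h \<otimes> h u)) \<oplus> (\<Oplus>h\<in>A. c h \<otimes> h y)"
    using c ** ring_hom_closed[OF hom] by (intro finsum_addf) (auto simp: Pi_iff)
  also have "(\<Oplus>h\<in>A. k \<otimes> (c h \<otimes> h u)) = k \<otimes> (\<Oplus>h\<in>A. c h \<otimes> h u)"
    using c ** ring_hom_closed[OF hom] A by (intro finsum_rdistr[symmetric]) (auto simp: Pi_iff)
  finally show ?case using Cons ** * by simp
qed

text \<open>Members of \<open>ring_iso R R\<close> are arbitrary outside the carrier; restricting to
  extensional functions gives each automorphism a single representative, so that counting them makes
  sense and \<open>BijGroup\<close> supplies the group structure.\<close>

definition gal_group :: "'a set \<Rightarrow> ('a \<Rightarrow> 'a) monoid" where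
  "gal_group K = BijGroup (carrier R)
     \<lparr>carrier := {h \<in> ring_iso R R \<inter> extensional (carrier R). \<forall>y\<in>K. h y = y}\<rparr>"

lemma gal_group_iff:
  "h \<in> carrier (gal_group K) \<longleftrightarrow> h \<in> ring_iso R R \<and> h \<in> extensional (carrier R) \<and> (\<forall>y\<in>K. h y = y)"
  by (simp add: gal_group_def conj_assoc)

lemma gal_group_hom: "h \<in> carrier (gal_group K) \<Longrightarrow> h \<in> ring_hom R R"
  by (simp add: gal_group_iff ring_iso_def)

lemma gal_group_fixes: "h \<in> carrier (gal_group K) \<Longrightarrow> y \<in> K \<Longrightarrow> h y = y"
  by (simp add: gal_group_iff)

text \<open>Passes from the unrestricted isomorphisms in the definition of a Galois extension to
  their extensional representatives.\<close>

lemma restrict_in_gal_group: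
  assumes "K \<subseteq> carrier R" "h \<in> ring_iso R R" "\<And>y. y \<in> K \<Longrightarrow> h y = y"
  shows "restrict h (carrier R) \<in> carrier (gal_group K)"
  using assms by (auto simp: gal_group_iff ring_iso_def ring_hom_def bij_betw_restrict_eq subset_iff)

lemma gal_group_subgroup:
  assumes K: "K \<subseteq> carrier R"
  shows "subgroup (carrier (gal_group K)) (BijGroup (carrier R))"
proof -
  interpret Bij: group "BijGroup (carrier R)" by (rule group_BijGroup)
  have sub: "carrier (gal_group K) \<subseteq> Bij (carrier R)"
    by (auto simp: gal_group_iff ring_iso_def Bij_def)
  show ?thesis
  proof (rule Bij.subgroupI)
    show "carrier (gal_group K) \<subseteq> carrier (BijGroup (carrier R))"
      using sub by (simp add: BijGroup_def)
    have "restrict id (carrier R) \<in> carrier (gal_group K)"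
      using K ring_iso_set_refl[of R] by (intro restrict_in_gal_group) auto
    then show "carrier (gal_group K) \<noteq> {}" by blast
  next
    fix h assume h: "h \<in> carrier (gal_group K)"
    then have hB: "h \<in> Bij (carrier R)" using sub by blast
    have "inv_into (carrier R) h \<in> ring_iso R R"
      using h ring_iso_set_sym[OF is_ring] gal_group_iff by blast
    moreover have "inv_into (carrier R) h y = y" if "y \<in> K" for y
    proof -
      have "inj_on h (carrier R)" using hB by (simp add: Bij_def bij_betw_def)
      then show ?thesis using inv_into_f_f[of h "carrier R" y] gal_group_fixes[OF h that] that K by auto
    qed
    ultimately show "inv\<^bsub>BijGroup (carrier R)\<^esub> h \<in> carrier (gal_group K)"
      using inv_BijGroup[OF hB] restrict_in_gal_group[OF K] by simp
  next
    fix h g assume hg: "h \<in> carrier (gal_group K)" "g \<in> carrier (gal_group K)"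
    then have hB: "h \<in> Bij (carrier R)" "g \<in> Bij (carrier R)" using sub by blast+
    have "h \<circ> g \<in> ring_iso R R" using hg ring_iso_set_trans[of g R R h R] by (simp add: gal_group_iff)
    then have "restrict (h \<circ> g) (carrier R) \<in> carrier (gal_group K)"
      using hg K by (intro restrict_in_gal_group) (auto simp: gal_group_fixes)
    moreover have "restrict (h \<circ> g) (carrier R) = compose (carrier R) h g"
      by (auto simp: compose_def)
    ultimately show "h \<otimes>\<^bsub>BijGroup (carrier R)\<^esub> g \<in> carrier (gal_group K)"
      using hB by (simp add: BijGroup_def)
  qed
qed

lemma gal_group_group: "K \<subseteq> carrier R \<Longrightarrow> group (gal_group K)"
  using subgroup.subgroup_is_group[OF gal_group_subgroup group_BijGroup]
  by (simp add: gal_group_def)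

lemma gal_group_mult:
  assumes "h \<in> carrier (gal_group K)" "g \<in> carrier (gal_group K)" "x \<in> carrier R"
  shows "(h \<otimes>\<^bsub>gal_group K\<^esub> g) x = h (g x)"
  using assms by (auto simp: gal_group_iff gal_group_def BijGroup_def ring_iso_def Bij_def compose_def)

lemma gal_group_one: "x \<in> carrier R \<Longrightarrow> \<one>\<^bsub>gal_group K\<^esub> x = x"
  by (simp add: gal_group_def BijGroup_def)

text \<open>More than \<open>n\<close> automorphisms would admit a nontrivial combination vanishing
  on a basis, hence everywhere, against Dedekind.\<close>

lemma gal_group_finite_card_le:
  assumes K: "subfield K R" and dim: "dimension n K (carrier R)"
  shows "finite (carrier (gal_group K))" "card (carrier (gal_group K)) \<le> n"
proof -
  obtain Us where Us: "set Us \<subseteq> carrier R" "independent K Us" "length Us = n" "Span K Us = carrier R"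
    using exists_base[OF K dim] by blast
  \<comment> \<open>Finiteness of the group is not known yet, so the bound is proved for finite
    subsets; an infinite group would contain one with \<open>n + 1\<close> elements.\<close>
  have le: "card A \<le> n" if A: "finite A" "A \<subseteq> carrier (gal_group K)" for A
  proof (rule ccontr)
    assume "\<not> card A \<le> n"
    then have "card (set Us) < card A" using card_length[of Us] Us(3) by linarith
    moreover have hom: "A \<subseteq> ring_hom R R" using A(2) gal_group_hom by blast
    moreover have "h u \<in> carrier R" if "u \<in> set Us" "h \<in> A" for u h
      using that Us(1) hom ring_hom_closed[of h R R u] by blast
    ultimately obtain c where c: "c \<in> A \<rightarrow> carrier R" "\<exists>h\<in>A. c h \<noteq> \<zero>"
      "\<forall>u\<in>set Us. (\<Oplus>h\<in>A. h u \<otimes> c h) = \<zero>"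
      using homogeneous_system_nontrivial_solution[of "set Us" A "\<lambda>u h. h u"] A(1) by auto
    have hc: "h x \<in> carrier R" if "h \<in> A" "x \<in> carrier R" for h x
      using that hom ring_hom_closed[of h R R x] by blast
    have "(\<Oplus>h\<in>A. c h \<otimes> h u) = \<zero>" if "u \<in> set Us" for u
    proof -
      have "(\<Oplus>h\<in>A. c h \<otimes> h u) = (\<Oplus>h\<in>A. h u \<otimes> c h)"
        using that Us(1) c(1) hc by (intro finsum_cong') (auto simp: m_comm Pi_iff subset_iff)
      then show ?thesis using c(3) that by simp
    qed
    then have "(\<Oplus>h\<in>A. c h \<otimes> h x) = \<zero>" if "x \<in> carrier R" for x
      using span_kernel[OF K A(1) hom _ c(1) Us(1)] A(2) gal_group_fixes that Us(4) by blast
    moreover have "A \<subseteq> extensional (carrier R)" using A(2) gal_group_iff by blast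
    ultimately have "c h = \<zero>" if "h \<in> A" for h
      using dedekind_independence[OF A(1) hom _ c(1) _ that] by blast
    then show False using c(2) by blast
  qed
  show "finite (carrier (gal_group K))"
  proof (rule ccontr)
    assume "infinite (carrier (gal_group K))"
    then obtain A where "finite A" "card A = Suc n" "A \<subseteq> carrier (gal_group K)"
      using infinite_arbitrarily_large by blast
    then show False using le[of A] by simp
  qed
  then show "card (carrier (gal_group K)) \<le> n" by (intro le) simp_all
qed

text \<open>Artin's argument: in a solution with one coefficient equal to \<open>\<one>\<close>, applying an automorphism
  and subtracting gives a solution with smaller support, so all coefficients are fixed.\<close>

lemma artin_independence:
  assumes K: "subfield K R" and fin: "finite (carrier (gal_group K))"
    and fixed: "\<And>x. x \<in> carrier R \<Longrightarrow> (\<And>h. h \<in> carrier (gal_group K) \<Longrightarrow> h x = x) \<Longrightarrow> x \<in> K"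
    and "finite U" and "U \<subseteq> carrier R"
    and "\<And>c. c \<in> U \<rightarrow> K \<Longrightarrow> (\<Oplus>u\<in>U. c u \<otimes> u) = \<zero> \<Longrightarrow> \<forall>u\<in>U. c u = \<zero>"
    and "c \<in> U \<rightarrow> carrier R"
    and "\<And>h. h \<in> carrier (gal_group K) \<Longrightarrow> (\<Oplus>u\<in>U. c u \<otimes> h u) = \<zero>"
  shows "\<forall>u\<in>U. c u = \<zero>"
  using assms(4-)
proof (induction U arbitrary: c rule: finite_induct)
  case empty
  then show ?case by simp
next
  case (insert w U)
  interpret G: group "gal_group K" using gal_group_group subfieldE(3)[OF K] .
  let ?G = "carrier (gal_group K)"
  note Kc = subfieldE(3)[OF K]
  have hc: "h x \<in> carrier R" if "h \<in> ?G" "x \<in> carrier R" for h x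
    using that gal_group_hom ring_hom_closed[of h R R x] by blast
  have Uc: "u \<in> carrier R" if "u \<in> insert w U" for u using that insert.prems(1) by blast
  \<comment> \<open>Independence over \<open>K\<close> passes to the smaller set by extending a
    relation with coefficient \<open>\<zero>\<close> at \<open>w\<close>.\<close>
  have ind: "\<forall>u\<in>U. d u = \<zero>" if d: "d \<in> U \<rightarrow> K" "(\<Oplus>u\<in>U. d u \<otimes> u) = \<zero>" for d
  proof -
    define d' where "d' = d(w := \<zero>)"
    have d'U: "d' u = d u" if "u \<in> U" for u using that insert.hyps by (auto simp: d'_def)
    have d'K: "d' \<in> insert w U \<rightarrow> K" using d(1) subringE(2)[OF subfieldE(1)[OF K]]
      by (auto simp: d'_def)
    have "(\<Oplus>u\<in>insert w U. d' u \<otimes> u) = d' w \<otimes> w \<oplus> (\<Oplus>u\<in>U. d' u \<otimes> u)"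
      using insert.hyps Uc d(1) d'U Kc by (intro finsum_insert) (auto simp: Pi_iff subset_iff d'_def)
    also have "(\<Oplus>u\<in>U. d' u \<otimes> u) = (\<Oplus>u\<in>U. d u \<otimes> u)"
      using d'U Uc d(1) Kc by (intro finsum_cong') (auto simp: Pi_iff subset_iff)
    also have "d' w \<otimes> w = \<zero>" using Uc by (simp add: d'_def)
    also have "\<zero> \<oplus> (\<Oplus>u\<in>U. d u \<otimes> u) = \<zero>" unfolding d(2) by simp
    finally have "\<forall>u\<in>insert w U. d' u = \<zero>" by (rule insert.prems(2)[OF d'K])
    then show ?thesis using d'U by auto
  qed
  have IH: "\<forall>u\<in>U. d u = \<zero>"
    if "d \<in> U \<rightarrow> carrier R" "\<And>h. h \<in> ?G \<Longrightarrow> (\<Oplus>u\<in>U. d u \<otimes> h u) = \<zero>" for d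
    using insert.IH[of d] insert.prems(1) ind that by blast
  have cc: "c u \<in> carrier R" if "u \<in> insert w U" for u using insert.prems(3) that by blast
  have split: "c w \<otimes> h w \<oplus> (\<Oplus>u\<in>U. c u \<otimes> h u) = \<zero>" if "h \<in> ?G" for h
    using insert.prems(4)[OF that] insert.hyps cc hc[OF that] Uc by (simp add: Pi_iff)
  show ?case
  proof (cases "c w = \<zero>")
    case True
    have "(\<Oplus>u\<in>U. c u \<otimes> h u) \<in> carrier R" if "h \<in> ?G" for h
      using cc hc that Uc by (intro finsum_closed) auto
    then have "\<forall>u\<in>U. c u = \<zero>" using split True cc hc Uc by (intro IH) auto
    then show ?thesis using True by simp
  next
    case False
    define b where "b = inv (c w)"
    have b: "b \<in> carrier R" "b \<otimes> c w = \<one>" using False cc field_Units by (auto simp: b_def)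
    define d where "d u = b \<otimes> c u" for u
    have dc: "d u \<in> carrier R" if "u \<in> insert w U" for u using that cc b by (simp add: d_def)
    have dw: "d w = \<one>" using b by (simp add: d_def)
    have dsum: "(\<Oplus>u\<in>U. d u \<otimes> h u) = \<ominus> h w" if h: "h \<in> ?G" for h
    proof -
      have "(\<Oplus>u\<in>U. d u \<otimes> h u) = (\<Oplus>u\<in>U. b \<otimes> (c u \<otimes> h u))"
        using b cc hc[OF h] Uc by (intro finsum_cong') (auto simp: d_def m_assoc)
      also have "\<dots> = b \<otimes> (\<Oplus>u\<in>U. c u \<otimes> h u)"
        using b cc hc[OF h] Uc insert.hyps by (intro finsum_rdistr[symmetric]) auto
      also have "(\<Oplus>u\<in>U. c u \<otimes> h u) = \<ominus> (c w \<otimes> h w)"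
        using split[OF h] cc hc[OF h] Uc
        by (intro minus_equality[symmetric]) (auto simp: a_comm intro!: finsum_closed)
      also have "b \<otimes> \<ominus> (c w \<otimes> h w) = \<ominus> ((b \<otimes> c w) \<otimes> h w)"
        using b(1) cc hc[OF h] Uc by (simp add: r_minus m_assoc)
      finally show ?thesis using b hc[OF h] Uc by simp
    qed
    have "d u \<in> K" if u: "u \<in> U" for u
    proof (rule fixed)
      show "d u \<in> carrier R" using dc u by blast
      fix g assume g: "g \<in> ?G"
      note gh = gal_group_hom[OF g]
      have "\<forall>u\<in>U. d u \<ominus> g (d u) = \<zero>"
      proof (rule IH)
        show "(\<lambda>u. d u \<ominus> g (d u)) \<in> U \<rightarrow> carrier R" using dc hc[OF g] by auto
        fix h assume h: "h \<in> ?G"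
        \<comment> \<open>Applying \<open>g\<close> to the relation belonging to the automorphism
          g^(-1) h yields a relation for \<open>h\<close> with coefficients
          \<open>g (d u)\<close>.\<close>
        define h' where "h' = inv\<^bsub>gal_group K\<^esub> g \<otimes>\<^bsub>gal_group K\<^esub> h"
        have h': "h' \<in> ?G" using g h by (simp add: h'_def)
        have gh': "g (h' x) = h x" if "x \<in> carrier R" for x
        proof -
          have "g (h' x) = (g \<otimes>\<^bsub>gal_group K\<^esub> h') x" using gal_group_mult[OF g h' that] by simp
          also have "g \<otimes>\<^bsub>gal_group K\<^esub> h' = h" using g h by (simp add: h'_def G.m_assoc[symmetric])
          finally show ?thesis .
        qed
        interpret g: ring_hom_cring R R g by unfold_locales (rule gh)
        have *: "(\<Oplus>u\<in>U. g (d u) \<otimes> h u) = \<ominus> h w"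
        proof -
          have "(\<Oplus>u\<in>U. g (d u) \<otimes> h u) = (\<Oplus>u\<in>U. g (d u \<otimes> h' u))"
            using dc hc[OF g] hc[OF h] hc[OF h'] Uc gh' by (intro finsum_cong') auto
          also have "\<dots> = g (\<Oplus>u\<in>U. d u \<otimes> h' u)"
            using dc hc[OF h'] Uc by (subst g.hom_finsum) (auto simp: comp_def)
          also have "\<dots> = \<ominus> h w" using dsum[OF h'] hc[OF h'] gh' Uc by simp
          finally show ?thesis .
        qed
        have "(\<Oplus>u\<in>U. (d u \<ominus> g (d u)) \<otimes> h u) = (\<Oplus>u\<in>U. d u \<otimes> h u \<oplus> \<ominus> \<one> \<otimes> (g (d u) \<otimes> h u))"
          using dc hc[OF g] hc[OF h] Uc
          by (intro finsum_cong') (auto simp: a_minus_def l_distr l_minus)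
        also have "\<dots> = (\<Oplus>u\<in>U. d u \<otimes> h u) \<oplus> (\<Oplus>u\<in>U. \<ominus> \<one> \<otimes> (g (d u) \<otimes> h u))"
          using dc hc[OF g] hc[OF h] Uc by (intro finsum_addf) auto
        also have "(\<Oplus>u\<in>U. \<ominus> \<one> \<otimes> (g (d u) \<otimes> h u)) = \<ominus> \<one> \<otimes> (\<Oplus>u\<in>U. g (d u) \<otimes> h u)"
          using dc hc[OF g] hc[OF h] Uc insert.hyps by (intro finsum_rdistr[symmetric]) auto
        finally show "(\<Oplus>u\<in>U. (d u \<ominus> g (d u)) \<otimes> h u) = \<zero>"
          using * dsum[OF h] hc[OF h] Uc by (simp add: l_minus l_neg)
      qed
      then show "g (d u) = d u" using u dc hc[OF g] r_right_minus_eq[of "d u" "g (d u)"] by auto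
    qed
    then have "d \<in> insert w U \<rightarrow> K" using dw subringE(3)[OF subfieldE(1)[OF K]] by auto
    \<comment> \<open>The relation belonging to the identity is now one with coefficients in
      \<open>K\<close>; independence over \<open>K\<close> then contradicts
      \<open>d w = \<one>\<close>.\<close>
    moreover have "(\<Oplus>u\<in>insert w U. d u \<otimes> u) = \<zero>"
    proof -
      have "(\<Oplus>u\<in>U. d u \<otimes> u) = (\<Oplus>u\<in>U. d u \<otimes> \<one>\<^bsub>gal_group K\<^esub> u)"
        using dc Uc by (intro finsum_cong') (auto simp: gal_group_one)
      also have "\<dots> = \<ominus> w" using dsum[OF G.one_closed] Uc by (simp add: gal_group_one)
      finally show ?thesis using insert.hyps dc Uc dw by (simp add: Pi_iff r_neg)
    qed
    ultimately have "d w = \<zero>" using insert.prems(2)[of d] by blast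
    then show ?thesis using dw by simp
  qed
qed

text \<open>If the group were smaller than a basis, one equation per automorphism would leave a
  nontrivial solution with coefficients in the large field, which Artin's argument excludes.\<close>

theorem degree_eq_card_gal_group:
  assumes K: "subfield K R" and dim: "dimension n K (carrier R)"
    and fixed: "\<And>x. x \<in> carrier R \<Longrightarrow> (\<And>h. h \<in> carrier (gal_group K) \<Longrightarrow> h x = x) \<Longrightarrow> x \<in> K"
  shows "card (carrier (gal_group K)) = n"
proof (rule antisym)
  note fin = gal_group_finite_card_le[OF K dim]
  show "card (carrier (gal_group K)) \<le> n" by (rule fin)
  show "n \<le> card (carrier (gal_group K))"
  proof (rule ccontr)
    assume less: "\<not> n \<le> card (carrier (gal_group K))"
    obtain Us where Us: "set Us \<subseteq> carrier R" "independent K Us" "length Us = n"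
      using exists_base[OF K dim] by blast
    have hc: "h x \<in> carrier R" if "h \<in> carrier (gal_group K)" "x \<in> carrier R" for h x
      using that gal_group_hom ring_hom_closed[of h R R x] by blast
    have "card (carrier (gal_group K)) < card (set Us)"
      using less Us(3) distinct_card[OF independent_distinct[OF K Us(2)]] by simp
    then obtain c where c: "c \<in> set Us \<rightarrow> carrier R" "\<exists>u\<in>set Us. c u \<noteq> \<zero>"
      "\<forall>h\<in>carrier (gal_group K). (\<Oplus>u\<in>set Us. h u \<otimes> c u) = \<zero>"
      using homogeneous_system_nontrivial_solution[OF fin(1), of "set Us" "\<lambda>h u. h u"] hc Us(1)
      by (auto simp: subset_iff)
    have "(\<Oplus>u\<in>set Us. c u \<otimes> h u) = \<zero>" if h: "h \<in> carrier (gal_group K)" for h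
    proof -
      have "(\<Oplus>u\<in>set Us. c u \<otimes> h u) = (\<Oplus>u\<in>set Us. h u \<otimes> c u)"
        using h Us(1) c(1) hc by (intro finsum_cong') (auto simp: m_comm Pi_iff subset_iff)
      then show ?thesis using c(3) h by simp
    qed
    moreover have "\<forall>u\<in>set Us. d u = \<zero>"
      if "d \<in> set Us \<rightarrow> K" "(\<Oplus>u\<in>set Us. d u \<otimes> u) = \<zero>" for d
      using independent_imp_finsum_trivial[OF K Us(2) that] by simp
    ultimately have "\<forall>u\<in>set Us. c u = \<zero>"
      by (intro artin_independence[OF K fin(1) fixed _ Us(1) _ c(1)]) simp_all
    then show False using c(2) by blast
  qed
qed

end

section \<open>Powers of sums and words\<close>

text \<open>Exponents matter only modulo the least period \<open>d\<close>, so the remainder of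
  \<open>q\<close> is again a period and must be 0. The orbit of \<open>w\<close> thus has exactly
  \<open>d\<close> elements.\<close>

lemma funpow_least_period_dvd:
  assumes d: "d = (LEAST d. 0 < d \<and> (\<rho> ^^ d) w = w)" and q: "(0::nat) < q" "(\<rho> ^^ q) w = w"
  shows "d > 0" "(\<rho> ^^ d) w = w" "d dvd q" "inj_on (\<lambda>i. (\<rho> ^^ i) w) {..<d}"
proof -
  have *: "0 < d \<and> (\<rho> ^^ d) w = w" unfolding d by (rule LeastI[of _ q]) (use q in simp)
  then show "d > 0" "(\<rho> ^^ d) w = w" by auto
  have least: "\<not> (0 < e \<and> (\<rho> ^^ e) w = w)" if "e < d" for e
    using that not_less_Least unfolding d by blast
  have period: "(\<rho> ^^ (d * k)) w = w" for k
    using * by (induction k) (simp_all add: funpow_add)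
  have mod: "(\<rho> ^^ (e mod d)) w = (\<rho> ^^ e) w" for e
  proof -
    have "(\<rho> ^^ e) w = (\<rho> ^^ (e mod d + d * (e div d))) w" by simp
    then show ?thesis by (simp only: funpow_add comp_apply period)
  qed
  show "d dvd q" using mod[of q] q least[of "q mod d"] * by (auto simp: dvd_eq_mod_eq_0)
  show "inj_on (\<lambda>i. (\<rho> ^^ i) w) {..<d}"
  proof (rule linorder_inj_onI')
    fix i j assume ij: "i \<in> {..<d}" "j \<in> {..<d}" "i < j"
    show "(\<rho> ^^ i) w \<noteq> (\<rho> ^^ j) w"
    proof
      assume eq: "(\<rho> ^^ i) w = (\<rho> ^^ j) w"
      \<comment> \<open>Applying \<rho> another \<open>d - j\<close> times turns the coincidence
        into a positive period smaller than \<open>d\<close>.\<close>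
      have "(\<rho> ^^ (d - j + i)) w = (\<rho> ^^ (d - j + j)) w" by (simp only: funpow_add comp_apply eq)
      then have "(\<rho> ^^ (d - j + i)) w = w" using * ij by simp
      then show False using least[of "d - j + i"] ij by auto
    qed
  qed
qed

text \<open>Orbit sizes divide \<open>p ^ n\<close> and differ from 1, so \<open>p\<close> divides
  them; since \<open>F\<close> is constant on orbits, each orbit contributes a multiple of
  \<open>p\<close> times a value of \<open>F\<close>. The target is an additive submonoid
  \<open>P\<close> rather than zero, because later \<open>p\<close> is not zero but only of positive
  value.\<close>

lemma (in abelian_monoid) finsum_free_orbits:
  assumes p: "Factorial_Ring.prime (p::nat)" and "finite W" and "\<rho> ` W \<subseteq> W" and "inj_on \<rho> W"
    and "\<And>w. w \<in> W \<Longrightarrow> \<rho> w \<noteq> w" and "\<And>w. w \<in> W \<Longrightarrow> (\<rho> ^^ (p ^ n)) w = w"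
    and "\<And>w. w \<in> W \<Longrightarrow> F w \<in> carrier G" and "\<And>w. w \<in> W \<Longrightarrow> F (\<rho> w) = F w"
    and P: "P \<subseteq> carrier G" "\<zero> \<in> P" "\<And>x y. x \<in> P \<Longrightarrow> y \<in> P \<Longrightarrow> x \<oplus> y \<in> P"
    and "\<And>w. w \<in> W \<Longrightarrow> add_pow G p (F w) \<in> P"
  shows "finsum G F W \<in> P"
  using assms(2-8,12)
proof (induction W rule: finite_psubset_induct)
  case (psubset W)
  show ?case
  proof (cases "W = {}")
    case True
    then show ?thesis using P by simp
  next
    case False
    then obtain w where w: "w \<in> W" by blast
    define d where "d = (LEAST d. 0 < d \<and> (\<rho> ^^ d) w = w)"
    have "0 < p ^ n" using p prime_gt_0_nat by simp
    note d = funpow_least_period_dvd[OF d_def this psubset.prems(4)[OF w]]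
    define O' where "O' = (\<lambda>i. (\<rho> ^^ i) w) ` {..<d}"
    have orb: "(\<rho> ^^ i) w \<in> W \<and> F ((\<rho> ^^ i) w) = F w" for i
    proof (induction i)
      case (Suc i)
      then show ?case using psubset.prems(1,6) by auto
    qed (use w in simp)
    have "d \<noteq> 1" using d(2) psubset.prems(3)[OF w] by auto
    then have "p dvd d"
      using d(3) p divides_primepow_nat[OF p, of d n] by (metis dvd_power power_0 bot_nat_0.not_eq_extremum)
    then obtain e where e: "d = p * e" by blast
    have sub: "O' \<subseteq> W" using orb by (auto simp: O'_def)
    have "w \<in> O'" using d(1) by (force simp: O'_def)
    have "finsum G F O' = (\<Oplus>i\<in>{..<d}. F ((\<rho> ^^ i) w))"
      unfolding O'_def using orb psubset.prems(5) by (intro finsum_reindex d(4)) auto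
    also have "\<dots> = (\<Oplus>i\<in>{..<d}. F w)"
      using orb psubset.prems(5)[OF w] by (intro finsum_cong') auto
    also have "\<dots> = add_pow G d (F w)" using psubset.prems(5)[OF w] by (simp add: add.finprod_const)
    also have "\<dots> = add_pow G e (add_pow G p (F w))"
      using psubset.prems(5)[OF w] by (simp add: e add.nat_pow_pow)
    also have "\<dots> \<in> P"
    proof (induction e)
      case (Suc e)
      then show ?case using P(3) psubset.prems(7)[OF w] by simp
    qed (use P in simp)
    finally have OP: "finsum G F O' \<in> P" .
    have step: "\<rho> x \<in> O'" if x: "x \<in> O'" for x
    proof -
      obtain i where i: "i < d" "x = (\<rho> ^^ i) w" using x by (auto simp: O'_def)
      show ?thesis
      proof (cases "Suc i = d")
        case True
        then have "\<rho> x = w" using d(2) i by auto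
        then show ?thesis using \<open>w \<in> O'\<close> by simp
      next
        case False
        then have "\<rho> x = (\<rho> ^^ Suc i) w" "Suc i < d" using i by auto
        then show ?thesis unfolding O'_def by blast
      qed
    qed
    \<comment> \<open>Since \<rho> is injective and maps the orbit onto itself, the complement is
      also stable, which the induction needs.\<close>
    have surj: "\<rho> ` O' = O'"
      using step endo_inj_surj[of O' \<rho>] inj_on_subset[OF psubset.prems(2) sub] O'_def by auto
    have "finsum G F (W - O') \<in> P"
    proof (rule psubset.IH)
      show "W - O' \<subset> W" using \<open>w \<in> O'\<close> w by blast
      show "\<rho> ` (W - O') \<subseteq> W - O'"
      proof
        fix y assume "y \<in> \<rho> ` (W - O')"
        then obtain x where x: "x \<in> W" "x \<notin> O'" "y = \<rho> x" by blast
        have "y \<notin> O'"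
        proof
          assume "y \<in> O'"
          then have "\<rho> x \<in> \<rho> ` O'" using surj x(3) by simp
          then obtain x' where "\<rho> x = \<rho> x'" "x' \<in> O'" by (rule imageE)
          then show False using x sub psubset.prems(2) by (metis inj_onD subsetD)
        qed
        then show "y \<in> W - O'" using x psubset.prems(1) by blast
      qed
      show "inj_on \<rho> (W - O')" using psubset.prems(2) by (rule inj_on_subset) blast
    qed (use psubset.prems in auto)
    moreover have "finsum G F W = finsum G F O' \<oplus> finsum G F (W - O')"
    proof -
      have "finsum G F (O' \<union> (W - O')) = finsum G F O' \<oplus> finsum G F (W - O')"
        using sub psubset.hyps finite_subset psubset.prems(5)
        by (intro finsum_Un_disjoint) (auto simp: O'_def)
      moreover have "O' \<union> (W - O') = W" using sub by blast
      ultimately show ?thesis by simp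
    qed
    ultimately show ?thesis using OP P(3) by simp
  qed
qed

text \<open>These index the monomials of weight \<gamma> in the expanded \<open>k\<close>-th power
  of a sum. Keeping the factors ordered avoids multinomial coefficients and lets rotation
  act.\<close>

definition words :: "'i set \<Rightarrow> ('i \<Rightarrow> 'g::comm_monoid_add) \<Rightarrow> nat \<Rightarrow> 'g \<Rightarrow> 'i list set" where
  "words I wt k \<gamma> = {w. length w = k \<and> set w \<subseteq> I \<and> sum_list (map wt w) = \<gamma>}"

lemma finite_words: "finite I \<Longrightarrow> finite (words I wt k \<gamma>)"
  by (rule finite_subset[OF _ finite_lists_length_eq[of I k]]) (auto simp: words_def)

lemma words_Suc:
  fixes wt :: "'i \<Rightarrow> 'g::ab_group_add"
  shows "words I wt (Suc k) \<gamma> = (\<Union>b\<in>I. (#) b ` words I wt k (\<gamma> - wt b))"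
proof (intro equalityI subsetI)
  fix w assume "w \<in> words I wt (Suc k) \<gamma>"
  then obtain b w' where "w = b # w'" "length w' = k" "b \<in> I" "set w' \<subseteq> I" "wt b + sum_list (map wt w') = \<gamma>"
    by (cases w) (auto simp: words_def)
  then have "w' \<in> words I wt k (\<gamma> - wt b)" "w = b # w'" "b \<in> I" by (auto simp: words_def)
  then show "w \<in> (\<Union>b\<in>I. (#) b ` words I wt k (\<gamma> - wt b))" by blast
qed (auto simp: words_def)

lemma words_rotate1_fixed:
  assumes "k > 0"
  shows "{w \<in> words I wt k \<gamma>. rotate1 w = w} =
    replicate k ` {i \<in> I. sum_list (replicate k (wt i)) = \<gamma>}"
proof (intro equalityI subsetI)
  fix w assume "w \<in> {w \<in> words I wt k \<gamma>. rotate1 w = w}"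
  then have w: "length w = k" "set w \<subseteq> I" "sum_list (map wt w) = \<gamma>" "rotate1 w = w"
    by (auto simp: words_def)
  then have "w \<noteq> []" using assms by auto
  then obtain i where "set w = {i}" using rotate1_fixpoint_card[OF w(4)] by (auto simp: card_1_singleton_iff)
  then have "w = replicate k i" "i \<in> I" using w(1,2) replicate_eqI[of w k i] by auto
  then show "w \<in> replicate k ` {i \<in> I. sum_list (replicate k (wt i)) = \<gamma>}" using w by auto
next
  fix w assume "w \<in> replicate k ` {i \<in> I. sum_list (replicate k (wt i)) = \<gamma>}"
  then show "w \<in> {w \<in> words I wt k \<gamma>. rotate1 w = w}"
    using assms by (auto simp: words_def rotate1_replicate)
qed

context cring
begin

definition word_prod :: "('i \<Rightarrow> 'a) \<Rightarrow> 'i list \<Rightarrow> 'a" where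
  "word_prod f w = foldr (\<lambda>i x. f i \<otimes> x) w \<one>"

text \<open>The component of weight \<gamma> in the \<open>k\<close>-th power of the sum of the
  \<open>f i\<close>, where \<open>f i\<close> is placed in weight \<open>wt i\<close>.\<close>

definition word_sum :: "'i set \<Rightarrow> ('i \<Rightarrow> 'g::comm_monoid_add) \<Rightarrow> ('i \<Rightarrow> 'a) \<Rightarrow> nat \<Rightarrow> 'g \<Rightarrow> 'a" where
  "word_sum I wt f k \<gamma> = finsum R (word_prod f) (words I wt k \<gamma>)"

lemma word_prod_simps [simp]: "word_prod f [] = \<one>" "word_prod f (i # w) = f i \<otimes> word_prod f w"
  by (simp_all add: word_prod_def)

lemma word_prod_closed: "f \<in> I \<rightarrow> carrier R \<Longrightarrow> set w \<subseteq> I \<Longrightarrow> word_prod f w \<in> carrier R"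
  by (induction w) auto

lemma word_prod_snoc:
  assumes "f \<in> I \<rightarrow> carrier R" "set w \<subseteq> I" "i \<in> I"
  shows "word_prod f (w @ [i]) = f i \<otimes> word_prod f w"
  using assms(2)
proof (induction w)
  case (Cons j w)
  have "f i \<in> carrier R" "f j \<in> carrier R" using assms Cons.prems by auto
  then show ?case using Cons word_prod_closed[OF assms(1)] by (simp add: m_lcomm)
qed (use assms in auto)

lemma word_prod_rotate1: "f \<in> I \<rightarrow> carrier R \<Longrightarrow> set w \<subseteq> I \<Longrightarrow> word_prod f (rotate1 w) = word_prod f w"
  using word_prod_snoc by (cases w) auto

lemma word_prod_replicate: "f i \<in> carrier R \<Longrightarrow> word_prod f (replicate k i) = f i [^] k"
  by (induction k) (simp_all add: m_comm)

lemma word_sum_closed: "f \<in> I \<rightarrow> carrier R \<Longrightarrow> word_sum I wt f k \<gamma> \<in> carrier R"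
  unfolding word_sum_def using word_prod_closed[of f I] by (intro finsum_closed) (auto simp: words_def)

text \<open>Words are sorted by their first letter. The result is the convolution recursion that
  powers in a graded ring obey.\<close>

lemma word_sum_Suc:
  fixes wt :: "'i \<Rightarrow> 'g::ab_group_add"
  assumes f: "f \<in> I \<rightarrow> carrier R" and I: "finite I"
  shows "word_sum I wt f (Suc k) \<gamma> = (\<Oplus>b\<in>I. f b \<otimes> word_sum I wt f k (\<gamma> - wt b))"
proof -
  have c: "word_prod f w \<in> carrier R" if "w \<in> words I wt k \<gamma>" for w k \<gamma>
    using word_prod_closed[OF f] that by (auto simp: words_def)
  have "word_sum I wt f (Suc k) \<gamma> =
      (\<Oplus>b\<in>I. finsum R (word_prod f) ((#) b ` words I wt k (\<gamma> - wt b)))"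
    unfolding word_sum_def words_Suc using I finite_words[OF I] c f
    by (intro add.finprod_UN_disjoint) (auto simp: pairwise_def disjnt_def Pi_iff)
  also have "\<dots> = (\<Oplus>b\<in>I. f b \<otimes> word_sum I wt f k (\<gamma> - wt b))"
  proof (intro finsum_cong' refl)
    fix b assume b: "b \<in> I"
    have "finsum R (word_prod f) ((#) b ` words I wt k (\<gamma> - wt b)) =
        (\<Oplus>w\<in>words I wt k (\<gamma> - wt b). f b \<otimes> word_prod f w)"
      using c f b by (subst finsum_reindex) (auto simp: Pi_iff)
    also have "\<dots> = f b \<otimes> word_sum I wt f k (\<gamma> - wt b)"
      unfolding word_sum_def using c f b finite_words[OF I] by (intro finsum_rdistr[symmetric]) auto
    finally show "finsum R (word_prod f) ((#) b ` words I wt k (\<gamma> - wt b)) =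
        f b \<otimes> word_sum I wt f k (\<gamma> - wt b)" .
  qed (use f in \<open>auto simp: Pi_iff intro!: m_closed word_sum_closed\<close>)
  finally show ?thesis .
qed

lemma word_sum_0: "word_sum I wt f 0 \<gamma> = (if \<gamma> = 0 then \<one> else \<zero>)"
proof -
  have "words I wt 0 \<gamma> = (if \<gamma> = 0 then {[]} else {})" by (auto simp: words_def)
  then show ?thesis by (simp add: word_sum_def)
qed

text \<open>Frobenius: the words of length \<open>p ^ n\<close> that are not constant fall into orbits under rotation
  whose size is divisible by \<open>p\<close>.\<close>

lemma word_sum_prime_power:
  fixes wt :: "'i \<Rightarrow> 'g::ab_group_add"
  assumes p: "Factorial_Ring.prime (p::nat)" and f: "f \<in> I \<rightarrow> carrier R" and I: "finite I"
    and P: "P \<subseteq> carrier R" "\<zero> \<in> P" "\<And>x y. x \<in> P \<Longrightarrow> y \<in> P \<Longrightarrow> x \<oplus> y \<in> P"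
    and pP: "\<And>w. w \<in> words I wt (p ^ n) \<gamma> \<Longrightarrow> add_pow R p (word_prod f w) \<in> P"
  shows "\<exists>e\<in>P. word_sum I wt f (p ^ n) \<gamma> =
    (\<Oplus>i\<in>{i \<in> I. sum_list (replicate (p ^ n) (wt i)) = \<gamma>}. f i [^] (p ^ n)) \<oplus> e"
proof -
  define W where "W = words I wt (p ^ n) \<gamma>"
  define Z where "Z = {w \<in> W. rotate1 w = w}"
  have q: "p ^ n > 0" using p prime_gt_0_nat by simp
  have W: "finite W" unfolding W_def by (rule finite_words[OF I])
  have c: "word_prod f w \<in> carrier R" if "w \<in> W" for w
    using word_prod_closed[OF f] that by (auto simp: W_def words_def)
  have rot: "rotate1 w \<in> W" if "w \<in> W" for w
  proof -
    have "sum_list (map wt (rotate1 w)) = sum_list (map wt w)" by (cases w) (simp_all add: add.commute)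
    then show ?thesis using that by (auto simp: W_def words_def)
  qed
  have inj: "inj_on rotate1 W"
    using inj_rotate1 inj_on_subset by blast
  have "finsum R (word_prod f) (W - Z) \<in> P"
  proof (rule finsum_free_orbits[OF p, where \<rho> = rotate1 and n = n])
    show "rotate1 ` (W - Z) \<subseteq> W - Z"
      using rot inj by (auto simp: Z_def dest: inj_onD)
    show "inj_on rotate1 (W - Z)" using inj by (rule inj_on_subset) blast
    show "(rotate1 ^^ (p ^ n)) w = w" if "w \<in> W - Z" for w
    proof -
      have "length w = p ^ n" using that by (simp add: W_def words_def)
      then show ?thesis using rotate_id[of "p ^ n" w] by (simp add: rotate_def)
    qed
    show "word_prod f (rotate1 w) = word_prod f w" if "w \<in> W - Z" for w
      using word_prod_rotate1[OF f] that by (simp add: W_def words_def)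
  qed (use W P pP c in \<open>auto simp: Z_def W_def\<close>)
  moreover have "word_sum I wt f (p ^ n) \<gamma> = finsum R (word_prod f) Z \<oplus> finsum R (word_prod f) (W - Z)"
  proof -
    have "finsum R (word_prod f) (Z \<union> (W - Z)) = finsum R (word_prod f) Z \<oplus> finsum R (word_prod f) (W - Z)"
      using W c by (intro finsum_Un_disjoint) (auto simp: Z_def)
    moreover have "Z \<union> (W - Z) = W" by (auto simp: Z_def)
    ultimately show ?thesis by (simp add: word_sum_def W_def)
  qed
  moreover have "finsum R (word_prod f) Z =
      (\<Oplus>i\<in>{i \<in> I. sum_list (replicate (p ^ n) (wt i)) = \<gamma>}. f i [^] (p ^ n))"
  proof -
    have Z: "Z = replicate (p ^ n) ` {i \<in> I. sum_list (replicate (p ^ n) (wt i)) = \<gamma>}"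
      unfolding Z_def W_def using q by (rule words_rotate1_fixed)
    have "inj_on (replicate (p ^ n)) {i \<in> I. sum_list (replicate (p ^ n) (wt i)) = \<gamma>}"
      using q by (auto simp: inj_on_def)
    then have "finsum R (word_prod f) Z =
        (\<Oplus>i\<in>{i \<in> I. sum_list (replicate (p ^ n) (wt i)) = \<gamma>}. word_prod f (replicate (p ^ n) i))"
      unfolding Z using c[unfolded Z_def] Z by (intro finsum_reindex) (auto simp: Z_def)
    also have "\<dots> = (\<Oplus>i\<in>{i \<in> I. sum_list (replicate (p ^ n) (wt i)) = \<gamma>}. f i [^] (p ^ n))"
      using f by (intro finsum_cong') (auto simp: word_prod_replicate Pi_iff)
    finally show ?thesis .
  qed
  ultimately show ?thesis by auto
qed

text \<open>The two-letter case with all weights 0, where the word sum is the whole power; the two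
  constant words give the two pure powers.\<close>

lemma prime_power_add:
  assumes p: "Factorial_Ring.prime (p::nat)" and ab: "a \<in> carrier R" "b \<in> carrier R"
    and P: "P \<subseteq> carrier R" "\<zero> \<in> P" "\<And>x y. x \<in> P \<Longrightarrow> y \<in> P \<Longrightarrow> x \<oplus> y \<in> P"
    and pP: "\<And>i j. add_pow R p (a [^] (i::nat) \<otimes> b [^] (j::nat)) \<in> P"
  shows "\<exists>e\<in>P. (a \<oplus> b) [^] (p ^ n) = a [^] (p ^ n) \<oplus> b [^] (p ^ n) \<oplus> e"
proof -
  define f where "f i = (if i then a else b)" for i
  have f: "f \<in> UNIV \<rightarrow> carrier R" using ab by (auto simp: f_def)
  let ?wt = "\<lambda>_::bool. 0::int"
  have "word_sum UNIV ?wt f k 0 = (a \<oplus> b) [^] k" for k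
  proof (induction k)
    case (Suc k)
    have "word_sum UNIV ?wt f (Suc k) 0 = (\<Oplus>i\<in>UNIV. f i \<otimes> (a \<oplus> b) [^] k)"
      unfolding word_sum_Suc[OF f finite] using Suc by simp
    also have "\<dots> = (a \<oplus> b) \<otimes> (a \<oplus> b) [^] k"
      unfolding UNIV_bool using ab by (simp add: f_def l_distr a_comm)
    finally show ?case using ab by (simp add: m_comm)
  qed (simp add: word_sum_0)
  moreover have "\<exists>i j. word_prod f w = a [^] (i::nat) \<otimes> b [^] (j::nat)" for w
  proof (induction w)
    case Nil
    show ?case by (intro exI[of _ 0]) simp
  next
    case (Cons c w)
    then obtain i j where ij: "word_prod f w = a [^] (i::nat) \<otimes> b [^] (j::nat)" by blast
    show ?case
    proof (cases c)
      case True
      then have "word_prod f (c # w) = a [^] Suc i \<otimes> b [^] j" using ij ab by (simp add: f_def m_ac)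
      then show ?thesis by blast
    next
      case False
      then have "word_prod f (c # w) = a [^] i \<otimes> b [^] Suc j" using ij ab by (simp add: f_def m_ac)
      then show ?thesis by blast
    qed
  qed
  then have "add_pow R p (word_prod f w) \<in> P" for w using pP by metis
  ultimately obtain e where e: "e \<in> P" "(a \<oplus> b) [^] (p ^ n) =
      (\<Oplus>i\<in>{i \<in> UNIV. sum_list (replicate (p ^ n) (?wt i)) = 0}. f i [^] (p ^ n)) \<oplus> e"
    using word_sum_prime_power[OF p f finite P, of ?wt n 0] by metis
  have "{i \<in> UNIV. sum_list (replicate (p ^ n) (?wt i)) = 0} = UNIV"
    by (simp add: sum_list_replicate)
  then have "(\<Oplus>i\<in>{i \<in> UNIV. sum_list (replicate (p ^ n) (?wt i)) = 0}. f i [^] (p ^ n)) =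
      a [^] (p ^ n) \<oplus> b [^] (p ^ n)"
    using ab by (simp add: f_def UNIV_bool a_comm)
  then show ?thesis using e by auto
qed

end

section \<open>Valued fields\<close>

locale valued_field = field L for L (structure) +
  fixes v :: "'a \<Rightarrow> 'g::linordered_ab_group_add"
  assumes val: "valuation L v"
begin

lemma val_mult:
  "x \<in> carrier L \<Longrightarrow> y \<in> carrier L \<Longrightarrow> x \<noteq> \<zero> \<Longrightarrow> y \<noteq> \<zero> \<Longrightarrow> v (x \<otimes> y) = v x + v y"
  using val by (simp add: valuation_def)

lemma val_add:
  "x \<in> carrier L \<Longrightarrow> y \<in> carrier L \<Longrightarrow> x \<noteq> \<zero> \<Longrightarrow> y \<noteq> \<zero> \<Longrightarrow> x \<oplus> y \<noteq> \<zero> \<Longrightarrow> min (v x) (v y) \<le> v (x \<oplus> y)"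
  using val by (simp add: valuation_def)

lemma val_one: "v \<one> = 0"
  using val_mult[of \<one> \<one>] by simp

lemma val_uminus: "x \<in> carrier L \<Longrightarrow> x \<noteq> \<zero> \<Longrightarrow> v (\<ominus> x) = v x"
proof -
  assume x: "x \<in> carrier L" "x \<noteq> \<zero>"
  have "v (\<ominus> \<one>) + v (\<ominus> \<one>) = v (\<ominus> \<one> \<otimes> \<ominus> \<one>)"
    by (intro val_mult[symmetric]) (auto simp: add.inv_eq_1_iff)
  also have "\<ominus> \<one> \<otimes> \<ominus> \<one> = \<one>" by (simp add: l_minus r_minus)
  finally have "v (\<ominus> \<one>) = 0" by (simp add: val_one)
  then show ?thesis using val_mult[of "\<ominus> \<one>" x] x by (simp add: l_minus add.inv_eq_1_iff)
qed

lemma inv_nonzero: "x \<in> carrier L \<Longrightarrow> x \<noteq> \<zero> \<Longrightarrow> inv x \<in> carrier L \<and> inv x \<noteq> \<zero> \<and> x \<otimes> inv x = \<one>"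
  using field_Units by (metis DiffI Units_inv_Units Units_r_inv DiffD1 DiffD2 singletonD singletonI)

lemma mult_nonzero: "x \<in> carrier L \<Longrightarrow> y \<in> carrier L \<Longrightarrow> x \<noteq> \<zero> \<Longrightarrow> y \<noteq> \<zero> \<Longrightarrow> x \<otimes> y \<noteq> \<zero>"
  using integral by blast

lemma pow_nonzero: "x \<in> carrier L \<Longrightarrow> x \<noteq> \<zero> \<Longrightarrow> x [^] (n::nat) \<noteq> \<zero>"
  by (induction n) (simp_all add: mult_nonzero)

lemma val_inv: "x \<in> carrier L \<Longrightarrow> x \<noteq> \<zero> \<Longrightarrow> v (inv x) = - v x"
  using val_mult[of x "inv x"] inv_nonzero[of x] val_one by (metis eq_neg_iff_add_eq_0 add.commute)

text \<open>The value type is only an ordered abelian group, so the \<open>n\<close>-fold multiple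
  of a value is written as the sum of a constant list, here and in all degree computations
  below.\<close>

lemma val_pow:
  "x \<in> carrier L \<Longrightarrow> x \<noteq> \<zero> \<Longrightarrow> v (x [^] (n::nat)) = sum_list (replicate n (v x))"
  by (induction n) (simp_all add: val_one val_mult pow_nonzero add.commute)

lemma sum_list_replicate_strict_mono:
  fixes a b :: "'g"
  assumes "a < b" "n > 0"
  shows "sum_list (replicate n a) < sum_list (replicate n b)"
  using assms(2)
proof (induction n rule: nat_induct_non_zero)
  case (Suc n)
  then show ?case using assms(1) by (simp add: add_strict_mono)
qed (use assms in simp)

lemma sum_list_replicate_eq_iff:
  fixes a b :: "'g"
  assumes "n > 0"
  shows "sum_list (replicate n a) = sum_list (replicate n b) \<longleftrightarrow> a = b"
  using sum_list_replicate_strict_mono[OF _ assms, of a b] sum_list_replicate_strict_mono[OF _ assms, of b a]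
  by (metis less_irrefl linorder_less_linear)

lemma sum_list_replicate_zero: "sum_list (replicate n (0::'g)) = 0"
  by (induction n) simp_all

text \<open>Working with these subsets of the whole field builds in the convention for zero;
  congruence modulo \<open>ball_plus \<gamma>\<close> then expresses equality of residues and of
  initial forms.\<close>

abbreviation "ball \<equiv> val_part L v (carrier L)"
abbreviation "ball_plus \<equiv> val_part_plus L v (carrier L)"

lemma val_ring_eq_ball: "val_ring L v = ball 0"
  by (simp add: val_ring_def val_part_def)

lemma val_ideal_eq_ball_plus: "val_ideal L v = ball_plus 0"
  by (simp add: val_ideal_def val_part_plus_def)

lemma ball_iff: "x \<in> ball \<gamma> \<longleftrightarrow> x \<in> carrier L \<and> (x = \<zero> \<or> \<gamma> \<le> v x)"
  by (simp add: val_part_def)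

lemma ball_plus_iff: "x \<in> ball_plus \<gamma> \<longleftrightarrow> x \<in> carrier L \<and> (x = \<zero> \<or> \<gamma> < v x)"
  by (simp add: val_part_plus_def)

lemma ball_plus_subset: "ball_plus \<gamma> \<subseteq> ball \<gamma>"
  by (auto simp: ball_iff ball_plus_iff)

lemma ball_add: "x \<in> ball \<gamma> \<Longrightarrow> y \<in> ball \<gamma> \<Longrightarrow> x \<oplus> y \<in> ball \<gamma>"
  using val_add[of x y] by (cases "x = \<zero>"; cases "y = \<zero>"; cases "x \<oplus> y = \<zero>") (auto simp: ball_iff min_le_iff_disj)

lemma ball_plus_add: "x \<in> ball_plus \<gamma> \<Longrightarrow> y \<in> ball_plus \<gamma> \<Longrightarrow> x \<oplus> y \<in> ball_plus \<gamma>"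
  using val_add[of x y] by (cases "x = \<zero>"; cases "y = \<zero>"; cases "x \<oplus> y = \<zero>") (auto simp: ball_plus_iff min_le_iff_disj)

lemma ball_uminus: "x \<in> ball \<gamma> \<Longrightarrow> \<ominus> x \<in> ball \<gamma>"
  using val_uminus[of x] by (cases "x = \<zero>") (auto simp: ball_iff)

lemma ball_plus_uminus: "x \<in> ball_plus \<gamma> \<Longrightarrow> \<ominus> x \<in> ball_plus \<gamma>"
  using val_uminus[of x] by (cases "x = \<zero>") (auto simp: ball_plus_iff)

lemma ball_minus: "x \<in> ball \<gamma> \<Longrightarrow> y \<in> ball \<gamma> \<Longrightarrow> x \<ominus> y \<in> ball \<gamma>"
  by (simp add: a_minus_def ball_add ball_uminus)

lemma ball_plus_minus: "x \<in> ball_plus \<gamma> \<Longrightarrow> y \<in> ball_plus \<gamma> \<Longrightarrow> x \<ominus> y \<in> ball_plus \<gamma>"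
  by (simp add: a_minus_def ball_plus_add ball_plus_uminus)

lemma ball_plus_zero: "\<zero> \<in> ball_plus \<gamma>"
  by (simp add: ball_plus_iff)

lemma ball_mult: "x \<in> ball \<alpha> \<Longrightarrow> y \<in> ball \<beta> \<Longrightarrow> x \<otimes> y \<in> ball (\<alpha> + \<beta>)"
  using val_mult[of x y] by (cases "x = \<zero>"; cases "y = \<zero>") (auto simp: ball_iff add_mono)

lemma ball_plus_mult: "x \<in> ball_plus \<alpha> \<Longrightarrow> y \<in> ball \<beta> \<Longrightarrow> x \<otimes> y \<in> ball_plus (\<alpha> + \<beta>)"
  using val_mult[of x y]
  by (cases "x = \<zero>"; cases "y = \<zero>") (auto simp: ball_iff ball_plus_iff add_less_le_mono)

lemma ball_mult_plus: "x \<in> ball \<alpha> \<Longrightarrow> y \<in> ball_plus \<beta> \<Longrightarrow> x \<otimes> y \<in> ball_plus (\<alpha> + \<beta>)"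
  using ball_plus_mult[of y \<beta> x \<alpha>] by (simp add: ball_iff ball_plus_iff m_comm add.commute)

lemma ball_pow: "x \<in> ball 0 \<Longrightarrow> x [^] (n::nat) \<in> ball 0"
proof (induction n)
  case 0
  then show ?case by (simp add: ball_iff val_one)
next
  case (Suc n)
  then show ?case using ball_mult[of "x [^] n" 0 x 0] by simp
qed

lemma ball_plus_sum: "finite A \<Longrightarrow> (\<And>i. i \<in> A \<Longrightarrow> f i \<in> ball_plus \<gamma>) \<Longrightarrow> finsum L f A \<in> ball_plus \<gamma>"
proof (induction A rule: finite_induct)
  case (insert i A)
  have "finsum L f (insert i A) = f i \<oplus> finsum L f A"
    using insert ball_plus_iff by (intro finsum_insert) auto
  then show ?case using insert ball_plus_add by auto
qed (simp add: ball_plus_zero)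

lemma ball_plus_additive_subgroup: "additive_subgroup (ball_plus \<gamma>) L"
proof (intro additive_subgroupI add.subgroupI)
  show "ball_plus \<gamma> \<subseteq> carrier L" by (auto simp: ball_plus_iff)
  show "ball_plus \<gamma> \<noteq> {}" using ball_plus_zero by blast
qed (use ball_plus_add ball_plus_uminus in auto)

text \<open>If \<open>v y\<close> were larger than \<open>v x\<close>, then \<open>x\<close>, being
  the difference of \<open>y\<close> and \<open>y \<ominus> x\<close>, would lie in
  \<open>ball_plus (v x)\<close>.\<close>

lemma val_congruent:
  assumes "x \<in> carrier L" "y \<in> carrier L" "x \<noteq> \<zero>" "y \<ominus> x \<in> ball_plus (v x)"
  shows "y \<noteq> \<zero>" "v y = v x"
proof -
  show y0: "y \<noteq> \<zero>" using assms val_uminus[of x] by (auto simp: ball_plus_iff a_minus_def add.inv_eq_1_iff)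
  have y: "y = x \<oplus> (y \<ominus> x)" and x: "x = y \<ominus> (y \<ominus> x)"
    using assms(1,2) a_lcomm[of x y "\<ominus> x"] by (simp_all add: a_minus_def r_neg minus_add r_neg1 r_neg2)
  have "x \<in> ball (v x)" using assms by (simp add: ball_iff)
  then have 1: "y \<in> ball (v x)"
    using ball_add[of x "v x" "y \<ominus> x"] y assms(4) ball_plus_subset by (metis subsetD)
  show "v y = v x"
  proof (rule ccontr)
    assume "v y \<noteq> v x"
    then have "y \<in> ball_plus (v x)" using 1 y0 by (auto simp: ball_iff ball_plus_iff)
    then have "x \<in> ball_plus (v x)" using x ball_plus_minus assms(4) by metis
    then show False using assms(3) by (simp add: ball_plus_iff)
  qed
qed

lemma congruent_trans:
  assumes "a \<in> carrier L" "b \<in> carrier L" "c \<in> carrier L"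
    and "a \<ominus> b \<in> ball_plus \<gamma>" "b \<ominus> c \<in> ball_plus \<gamma>"
  shows "a \<ominus> c \<in> ball_plus \<gamma>"
proof -
  have "a \<ominus> c = (a \<ominus> b) \<oplus> (b \<ominus> c)" using assms(1-3) by (simp add: a_minus_def a_assoc r_neg1)
  then show ?thesis using ball_plus_add[OF assms(4,5)] by simp
qed

lemma congruent_sym:
  assumes "a \<in> carrier L" "b \<in> carrier L" and "a \<ominus> b \<in> ball_plus \<gamma>"
  shows "b \<ominus> a \<in> ball_plus \<gamma>"
proof -
  have "b \<ominus> a = \<ominus> (a \<ominus> b)" using assms(1-2) by (simp add: a_minus_def minus_add a_comm)
  then show ?thesis using ball_plus_uminus[OF assms(3)] by simp
qed

lemma congruent_mult:
  assumes "a \<in> ball \<alpha>" "a' \<in> ball \<alpha>" "b \<in> ball \<beta>" "b' \<in> ball \<beta>"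
    and "a \<ominus> a' \<in> ball_plus \<alpha>" "b \<ominus> b' \<in> ball_plus \<beta>"
  shows "a \<otimes> b \<ominus> a' \<otimes> b' \<in> ball_plus (\<alpha> + \<beta>)"
proof -
  have c: "a \<in> carrier L" "a' \<in> carrier L" "b \<in> carrier L" "b' \<in> carrier L" using assms by (auto simp: ball_iff)
  have "(a \<ominus> a') \<otimes> b = a \<otimes> b \<ominus> a' \<otimes> b" "a' \<otimes> (b \<ominus> b') = a' \<otimes> b \<ominus> a' \<otimes> b'"
    using c by (simp_all add: a_minus_def l_distr r_distr l_minus r_minus)
  then show ?thesis
    using congruent_trans[of "a \<otimes> b" "a' \<otimes> b" "a' \<otimes> b'" "\<alpha> + \<beta>"] c
      ball_plus_mult[OF assms(5,3)] ball_mult_plus[OF assms(2,6)] by simp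
qed

section \<open>Valuation ring, residue field and residue characteristic\<close>

lemma val_ring_subring: "subring (val_ring L v) L"
  unfolding val_ring_eq_ball
proof (rule subringI)
  show "\<one> \<in> ball 0" by (simp add: ball_iff val_one)
qed (use ball_add ball_uminus ball_mult[of _ 0 _ 0] in \<open>auto simp: ball_iff\<close>)

lemma val_ideal_ideal: "ideal (val_ideal L v) (L\<lparr>carrier := val_ring L v\<rparr>)"
proof (rule idealI)
  show "ring (L\<lparr>carrier := val_ring L v\<rparr>)" by (rule subring_is_ring[OF val_ring_subring])
  interpret V: ring "L\<lparr>carrier := val_ring L v\<rparr>" by (rule subring_is_ring[OF val_ring_subring])
  show "subgroup (val_ideal L v) (add_monoid (L\<lparr>carrier := val_ring L v\<rparr>))"
  proof (rule V.add.subgroupI)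
    show "val_ideal L v \<subseteq> carrier (L\<lparr>carrier := val_ring L v\<rparr>)"
      using ball_plus_subset by (simp add: val_ring_eq_ball val_ideal_eq_ball_plus)
    show "val_ideal L v \<noteq> {}" using ball_plus_zero by (auto simp: val_ideal_eq_ball_plus)
  next
    fix a assume a: "a \<in> val_ideal L v"
    then have aV: "a \<in> val_ring L v" using ball_plus_subset by (auto simp: val_ring_eq_ball val_ideal_eq_ball_plus)
    have "a \<in> carrier L" using aV by (simp add: val_ring_def)
    then have "\<ominus>\<^bsub>L\<lparr>carrier := val_ring L v\<rparr>\<^esub> a = \<ominus> a"
      using aV val_ring_subring subringE(5)[OF val_ring_subring aV]
      by (intro V.minus_equality) (auto simp: l_neg)
    then show "\<ominus>\<^bsub>L\<lparr>carrier := val_ring L v\<rparr>\<^esub> a \<in> val_ideal L v"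
      using a ball_plus_uminus by (simp add: val_ideal_eq_ball_plus)
  next
    fix a b assume "a \<in> val_ideal L v" "b \<in> val_ideal L v"
    then show "a \<oplus>\<^bsub>L\<lparr>carrier := val_ring L v\<rparr>\<^esub> b \<in> val_ideal L v"
      using ball_plus_add by (simp add: val_ideal_eq_ball_plus)
  qed
qed (use ball_plus_mult[of _ 0 _ 0] ball_mult_plus[of _ 0 _ 0] in
    \<open>auto simp: val_ideal_eq_ball_plus val_ring_eq_ball\<close>)

abbreviation residue :: "'a \<Rightarrow> 'a set" where "residue x \<equiv> val_ideal L v +> x"

text \<open>Lets statements about residue classes be replaced by congruences between elements of the
  field itself.\<close>

lemma residue_eq_iff:
  assumes "x \<in> val_ring L v" "y \<in> val_ring L v"
  shows "residue x = residue y \<longleftrightarrow> x \<ominus> y \<in> ball_plus 0"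
proof -
  have c: "x \<in> carrier L" "y \<in> carrier L" using assms by (auto simp: val_ring_def)
  have sub: "additive_subgroup (val_ideal L v) L"
    unfolding val_ideal_eq_ball_plus by (rule ball_plus_additive_subgroup)
  have ab: "abelian_subgroup (val_ideal L v) L"
    by (rule abelian_subgroupI3[OF sub is_abelian_group])
  show ?thesis
  proof
    assume "residue x = residue y"
    then have "x \<in> residue y" using abelian_subgroup.a_rcos_self[OF ab c(1)] by blast
    then obtain e where e: "e \<in> val_ideal L v" "x = e \<oplus> y" unfolding a_r_coset_def' by blast
    have "e \<in> carrier L" using e(1) by (simp add: val_ideal_def)
    then have "x \<ominus> y = e" unfolding e(2) using c(2) by (simp add: a_minus_def a_assoc r_neg)
    then show "x \<ominus> y \<in> ball_plus 0" using e by (simp add: val_ideal_eq_ball_plus)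
  next
    assume "x \<ominus> y \<in> ball_plus 0"
    moreover have "x = (x \<ominus> y) \<oplus> y" using c by (simp add: a_minus_def a_assoc l_neg)
    ultimately have "x \<in> residue y" unfolding a_r_coset_def' val_ideal_eq_ball_plus by blast
    then show "residue x = residue y"
      using a_repr_independence[OF _ c(2) additive_subgroup.a_subgroup[OF sub]] by simp
  qed
qed

lemma residue_hom: "residue \<in> ring_hom (L\<lparr>carrier := val_ring L v\<rparr>) (residue_field L v)"
proof -
  have "(+>\<^bsub>L\<lparr>carrier := val_ring L v\<rparr>\<^esub>) (val_ideal L v) = residue"
    by (intro ext) (simp add: a_r_coset_def r_coset_def)
  then show ?thesis using ideal.rcos_ring_hom[OF val_ideal_ideal] by (simp add: residue_field_def)
qed

lemma add_pow_one_in_val_ring: "add_pow L (n::nat) \<one> \<in> val_ring L v"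
proof (induction n)
  case 0
  then show ?case using subringE(2)[OF val_ring_subring] by simp
next
  case (Suc n)
  then show ?case using subringE(3,7)[OF val_ring_subring] by simp
qed

lemma residue_nat: "add_pow (residue_field L v) (n::nat) \<one>\<^bsub>residue_field L v\<^esub> = residue (add_pow L n \<one>)"
proof -
  interpret V: ring "L\<lparr>carrier := val_ring L v\<rparr>" by (rule subring_is_ring[OF val_ring_subring])
  interpret Q: ring "residue_field L v"
    unfolding residue_field_def by (rule ideal.quotient_is_ring[OF val_ideal_ideal])
  interpret h: ring_hom_ring "L\<lparr>carrier := val_ring L v\<rparr>" "residue_field L v" residue
    using residue_hom by (intro ring_hom_ringI2 V.ring_axioms Q.ring_axioms)
  show ?thesis
  proof (induction n)
    case 0
    then show ?case using h.hom_zero by simp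
  next
    case (Suc n)
    have "residue (add_pow L (Suc n) \<one>) = residue (add_pow L n \<one>) \<oplus>\<^bsub>residue_field L v\<^esub> residue \<one>"
      using h.hom_add[of "add_pow L n \<one>" \<one>] add_pow_one_in_val_ring subringE(3)[OF val_ring_subring] by simp
    then show ?case using Suc h.hom_one by simp
  qed
qed

lemma residue_pow:
  assumes "x \<in> val_ring L v"
  shows "residue x [^]\<^bsub>residue_field L v\<^esub> (n::nat) = residue (x [^] n)"
proof -
  interpret V: ring "L\<lparr>carrier := val_ring L v\<rparr>" by (rule subring_is_ring[OF val_ring_subring])
  interpret Q: ring "residue_field L v"
    unfolding residue_field_def by (rule ideal.quotient_is_ring[OF val_ideal_ideal])
  interpret h: ring_hom_ring "L\<lparr>carrier := val_ring L v\<rparr>" "residue_field L v" residue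
    using residue_hom by (intro ring_hom_ringI2 V.ring_axioms Q.ring_axioms)
  have xn: "x [^] n \<in> val_ring L v" for n::nat
    using assms ball_pow by (simp add: val_ring_eq_ball)
  show ?thesis
  proof (induction n)
    case 0
    then show ?case using h.hom_one by simp
  next
    case (Suc n)
    then show ?case using h.hom_mult[of "x [^] n" x] xn assms by simp
  qed
qed

text \<open>Moves the characteristic out of the quotient: \<open>n = p\<close> shows that
  \<open>p\<close> has positive value, and any \<open>n\<close> not divisible by \<open>p\<close>
  becomes a unit of the valuation ring.\<close>

lemma residue_char_iff:
  assumes "has_characteristic (residue_field L v) p"
  shows "add_pow L (n::nat) \<one> \<in> ball_plus 0 \<longleftrightarrow> p dvd n"
proof -
  have "\<zero>\<^bsub>residue_field L v\<^esub> = residue (add_pow L (0::nat) \<one>)"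
    using residue_nat[of 0] by (simp add: add_pow_def)
  then have "p dvd n \<longleftrightarrow> residue (add_pow L n \<one>) = residue (add_pow L (0::nat) \<one>)"
    using assms by (simp add: has_characteristic_def residue_nat)
  also have "\<dots> \<longleftrightarrow> add_pow L n \<one> \<ominus> \<zero> \<in> ball_plus 0"
    using residue_eq_iff[OF add_pow_one_in_val_ring add_pow_one_in_val_ring, of n 0] by simp
  finally show ?thesis by (simp add: a_minus_def)
qed

text \<open>The residue ring has no zero divisors: if two elements of nonnegative value have a
  product of positive value, one of them has positive value. Moreover \<open>p = 1\<close> would put
  \<open>\<one>\<close> into the maximal ideal.\<close>

lemma residue_char_prime:
  assumes "has_characteristic (residue_field L v) p" "p > 0"
  shows "Factorial_Ring.prime p"
proof (rule prime_natI)
  note char = residue_char_iff[OF assms(1)]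
  have "\<one> \<notin> ball_plus 0" by (simp add: ball_plus_iff val_one)
  then have "p \<noteq> 1" using char[of 1] by auto
  then show "p \<ge> 2" using assms(2) by linarith
  fix a b :: nat assume "p dvd a * b"
  then have ab: "add_pow L (a * b) \<one> \<in> ball_plus 0" using char by blast
  have "add_pow L (a * b) \<one> = add_pow L a \<one> \<otimes> add_pow L b \<one>"
    using add_pow_ldistr[of \<one> "add_pow L b \<one>" a] by (simp add: add.nat_pow_pow mult.commute)
  moreover have "x \<in> ball_plus 0 \<or> y \<in> ball_plus 0"
    if "x \<otimes> y \<in> ball_plus 0" "x \<in> ball 0" "y \<in> ball 0" for x y
    using that val_mult[of x y] mult_nonzero[of x y]
    by (cases "x = \<zero>"; cases "y = \<zero>") (auto simp: ball_iff ball_plus_iff)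
  ultimately show "p dvd a \<or> p dvd b"
    using ab char add_pow_one_in_val_ring by (metis val_ring_eq_ball)
qed

text \<open>For \<open>s = t \<ominus> \<one>\<close> and q = p^k, t^q equals s^q + 1 up to positive
  value, so s^q has positive value, and then so has \<open>s\<close>.\<close>

lemma frobenius_injective:
  assumes char: "has_characteristic (residue_field L v) p" "p > 0"
    and t: "t \<in> ball 0" and pow: "t [^] (p ^ k) \<ominus> \<one> \<in> ball_plus 0"
  shows "t \<ominus> \<one> \<in> ball_plus 0"
proof -
  have tc: "t \<in> carrier L" using t by (simp add: ball_iff)
  define s where "s = t \<ominus> \<one>"
  have one: "\<one> \<in> ball 0" by (simp add: ball_iff val_one)
  have s: "s \<in> ball 0" "s \<in> carrier L" using ball_minus[OF t one] by (auto simp: s_def ball_iff)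
  have ts: "t = s \<oplus> \<one>" using tc by (simp add: s_def a_minus_def a_assoc l_neg)
  have "add_pow L p (s [^] (i::nat) \<otimes> \<one> [^] (j::nat)) \<in> ball_plus 0" for i j
  proof -
    have "add_pow L p (s [^] i) = add_pow L p \<one> \<otimes> s [^] i"
      using add_pow_ldistr[of \<one> "s [^] i" p] s by simp
    moreover have "add_pow L p \<one> \<in> ball_plus 0" using residue_char_iff[OF char(1), of p] by simp
    ultimately show ?thesis using ball_plus_mult[OF _ ball_pow[OF s(1)], of "add_pow L p \<one>" 0 i] s by simp
  qed
  moreover have "ball_plus 0 \<subseteq> carrier L" by (auto simp: ball_plus_iff)
  ultimately obtain e where e: "e \<in> ball_plus 0" "t [^] (p ^ k) = s [^] (p ^ k) \<oplus> \<one> [^] (p ^ k) \<oplus> e"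
    using prime_power_add[OF residue_char_prime[OF char] s(2) one_closed, of "ball_plus 0" k]
      ball_plus_zero ball_plus_add unfolding ts by blast
  have ec: "e \<in> carrier L" using e by (simp add: ball_plus_iff)
  have "t [^] (p ^ k) \<ominus> \<one> \<ominus> e = e \<oplus> (\<one> \<oplus> s [^] (p ^ k)) \<ominus> \<one> \<ominus> e"
    using s ec unfolding e(2) by (simp add: a_comm)
  also have "\<dots> = s [^] (p ^ k)"
    using a_minus_cancel_left[of e "\<one> \<oplus> s [^] (p ^ k)" \<one>]
      a_minus_cancel_left[of \<one> "s [^] (p ^ k)" \<zero>] s ec by (simp add: a_minus_def)
  finally have "t [^] (p ^ k) \<ominus> \<one> \<ominus> e = s [^] (p ^ k)" .
  then have "s [^] (p ^ k) \<in> ball_plus 0" using ball_plus_minus[OF pow e(1)] by simp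
  moreover have "s \<in> ball_plus 0" if "s [^] (p ^ k) \<in> ball_plus 0"
  proof (rule ccontr)
    assume "s \<notin> ball_plus 0"
    then have "s \<noteq> \<zero>" "v s = 0" using s by (auto simp: ball_iff ball_plus_iff)
    then show False using that s val_pow[of s "p ^ k"] pow_nonzero[of s "p ^ k"]
      by (simp add: ball_plus_iff sum_list_replicate_zero)
  qed
  ultimately show ?thesis by (simp add: s_def)
qed

end

section \<open>Galois extensions with a unique extension of the valuation\<close>

locale unibranch_galois = valued_field L v for L (structure) and v :: "'a \<Rightarrow> 'g::linordered_ab_group_add" +
  fixes K :: "'a set" and u :: "'a \<Rightarrow> 'g" and p :: nat
  assumes galois: "galois_extension L K"
    and restriction: "\<And>x. x \<in> K - {\<zero>} \<Longrightarrow> u x = v x"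
    and unique: "unique_extension L v K u"
    and residue_char: "has_characteristic (residue_field L v) p" "p > 0"
    and index: "\<exists>k::nat. group_index (value_group L v) (value_group (L\<lparr>carrier := K\<rparr>) u) = p ^ k"
    and residue_ext: "purely_inseparable_over p (residue_field L v) (residue_subfield L v K u)"
begin

abbreviation "Gal \<equiv> carrier (gal_group K)"

lemma K_subfield: "subfield K L"
  using galois by (simp add: galois_extension_def)

lemma K_subring: "subring K L"
  by (rule subfieldE(1)[OF K_subfield])

lemma K_carrier: "x \<in> K \<Longrightarrow> x \<in> carrier L"
  using subfieldE(3)[OF K_subfield] by blast

lemma K_inv: "x \<in> K \<Longrightarrow> x \<noteq> \<zero> \<Longrightarrow> inv x \<in> K"
  using subfield_m_inv(1)[OF K_subfield, of x] by simp

lemma val_ring_base: "val_ring (L\<lparr>carrier := K\<rparr>) u = val_ring L v \<inter> K"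
proof -
  have "x \<in> val_ring (L\<lparr>carrier := K\<rparr>) u \<longleftrightarrow> x \<in> val_ring L v \<inter> K" for x
    using K_carrier[of x] restriction[of x] by (cases "x = \<zero>") (auto simp: val_ring_def)
  then show ?thesis by blast
qed

lemma fixed_imp_K:
  assumes x: "x \<in> carrier L" and fixed: "\<And>h. h \<in> Gal \<Longrightarrow> h x = x"
  shows "x \<in> K"
proof -
  have "h x = x" if "h \<in> ring_iso L L" "\<forall>y\<in>K. h y = y" for h
    using fixed[OF restrict_in_gal_group[OF subfieldE(3)[OF K_subfield] that(1)]] that(2) x by simp
  then show ?thesis using galois x unfolding galois_extension_def by blast
qed

lemma Gal_finite: "finite Gal"
  and dimension_card_Gal: "dimension (card Gal) K (carrier L)"
proof -
  obtain n where n: "dimension n K (carrier L)"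
    using galois unfolding galois_extension_def finite_dimension_def by blast
  show "finite Gal" by (rule gal_group_finite_card_le[OF K_subfield n])
  show "dimension (card Gal) K (carrier L)"
    using degree_eq_card_gal_group[OF K_subfield n fixed_imp_K] n by simp
qed

lemma Gal_group: "group (gal_group K)"
  by (rule gal_group_group[OF subfieldE(3)[OF K_subfield]])

lemma Gal_hom: "h \<in> Gal \<Longrightarrow> ring_hom_cring L L h"
  by unfold_locales (rule gal_group_hom)

lemma Gal_closed: "h \<in> Gal \<Longrightarrow> x \<in> carrier L \<Longrightarrow> h x \<in> carrier L"
  using gal_group_hom ring_hom_closed[of h L L x] by blast

lemma Gal_mult: "h \<in> Gal \<Longrightarrow> x \<in> carrier L \<Longrightarrow> y \<in> carrier L \<Longrightarrow> h (x \<otimes> y) = h x \<otimes> h y"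
  using gal_group_hom ring_hom_mult[of h L L x y] by blast

lemma Gal_add: "h \<in> Gal \<Longrightarrow> x \<in> carrier L \<Longrightarrow> y \<in> carrier L \<Longrightarrow> h (x \<oplus> y) = h x \<oplus> h y"
  using gal_group_hom ring_hom_add[of h L L x y] by blast

lemma Gal_one: "h \<in> Gal \<Longrightarrow> h \<one> = \<one>"
  using gal_group_hom ring_hom_one[of h L L] by blast

lemma Gal_zero: "h \<in> Gal \<Longrightarrow> h \<zero> = \<zero>"
  using ring_hom_cring.hom_zero[OF Gal_hom] by blast

lemma Gal_minus: "h \<in> Gal \<Longrightarrow> x \<in> carrier L \<Longrightarrow> y \<in> carrier L \<Longrightarrow> h (x \<ominus> y) = h x \<ominus> h y"
  using Gal_add[of h x "\<ominus> y"] ring_hom_cring.hom_a_inv[OF Gal_hom, of h y] by (simp add: a_minus_def)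

lemma Gal_pow: "h \<in> Gal \<Longrightarrow> x \<in> carrier L \<Longrightarrow> h (x [^] (n::nat)) = h x [^] n"
  by (induction n) (simp_all add: Gal_one Gal_mult)

lemma Gal_nonzero: "h \<in> Gal \<Longrightarrow> x \<in> carrier L \<Longrightarrow> x \<noteq> \<zero> \<Longrightarrow> h x \<noteq> \<zero>"
  using Gal_mult[of h x "inv x"] Gal_one[of h] Gal_closed[of h "inv x"] inv_nonzero[of x] by force

text \<open>The preimage of the valuation ring under \<open>h\<close> is again a valuation ring and,
  as \<open>h\<close> fixes \<open>K\<close>, has the same intersection with \<open>K\<close>;
  uniqueness identifies the two.\<close>

lemma Gal_val_ring_iff:
  assumes h: "h \<in> Gal" and x: "x \<in> carrier L"
  shows "h x \<in> val_ring L v \<longleftrightarrow> x \<in> val_ring L v"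
proof -
  define W where "W = {x \<in> carrier L. h x \<in> val_ring L v}"
  have uminus: "h (\<ominus> y) = \<ominus> h y" if "y \<in> carrier L" for y
    using ring_hom_cring.hom_a_inv[OF Gal_hom[OF h] that] .
  note V = val_ring_subring
  have "subring W L"
    unfolding W_def
    by (rule subringI)
      (auto simp: Gal_one[OF h] Gal_add[OF h] Gal_mult[OF h] uminus subringE(3,5,6,7)[OF V])
  moreover have "x \<in> W \<or> inv x \<in> W" if x: "x \<in> carrier L - {\<zero>}" for x
  proof -
    have xi: "inv x \<in> carrier L" "x \<otimes> inv x = \<one>" "inv x \<noteq> \<zero>" using inv_nonzero x by auto
    have "h x \<otimes> h (inv x) = \<one>" using Gal_mult[OF h _ xi(1), of x] x xi(2) Gal_one[OF h] by simp
    then have "v (h x) + v (h (inv x)) = 0"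
      using val_mult[of "h x" "h (inv x)"] Gal_closed[OF h] Gal_nonzero[OF h] x xi val_one by simp
    then have "0 \<le> v (h x) \<or> 0 \<le> v (h (inv x))" by (metis add_neg_neg linorder_not_le order_less_irrefl)
    then show ?thesis using x xi Gal_closed[OF h] by (auto simp: W_def val_ring_def)
  qed
  moreover have "W \<inter> K = val_ring (L\<lparr>carrier := K\<rparr>) u"
    unfolding val_ring_base using gal_group_fixes[OF h] K_carrier by (auto simp: W_def)
  ultimately have "W = val_ring L v"
    using unique unfolding unique_extension_def valuation_subring_def by blast
  then show ?thesis using x by (auto simp: W_def)
qed

text \<open>Invariance of the valuation ring controls only signs of values. Applied to
  \<open>w\<close> and to its inverse it gives two nonnegative values with sum 0.\<close>

lemma Gal_val_zero:
  assumes h: "h \<in> Gal" and w: "w \<in> carrier L" "w \<noteq> \<zero>" "v w = 0"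
  shows "v (h w) = 0"
proof -
  have wi: "inv w \<in> carrier L" "w \<otimes> inv w = \<one>" "inv w \<noteq> \<zero>" "v (inv w) = 0"
    using inv_nonzero[OF w(1,2)] val_inv[OF w(1,2)] w(3) by auto
  have "h w \<otimes> h (inv w) = \<one>" using Gal_mult[OF h w(1) wi(1)] wi(2) Gal_one[OF h] by simp
  then have "v (h w) + v (h (inv w)) = 0"
    using val_mult[of "h w" "h (inv w)"] Gal_closed[OF h] Gal_nonzero[OF h] w wi val_one by simp
  moreover have "0 \<le> v (h w)" "0 \<le> v (h (inv w))"
    using Gal_val_ring_iff[OF h w(1)] Gal_val_ring_iff[OF h wi(1)] w wi Gal_nonzero[OF h]
    by (auto simp: val_ring_def)
  ultimately show ?thesis by (simp add: add_nonneg_eq_0_iff)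
qed

lemma value_group_base: "value_group (L\<lparr>carrier := K\<rparr>) u = v ` (K - {\<zero>})"
  using restriction by (auto simp: value_group_def image_iff)

lemma additive_value_group: "comm_group (additive_group (value_group L v))"
proof (rule comm_groupI)
  let ?G = "additive_group (value_group L v)"
  fix x y assume "x \<in> carrier ?G" "y \<in> carrier ?G"
  then obtain a b where ab: "a \<in> carrier L - {\<zero>}" "b \<in> carrier L - {\<zero>}" "x = v a" "y = v b"
    by (auto simp: additive_group_def value_group_def)
  then have "x + y = v (a \<otimes> b)" "a \<otimes> b \<in> carrier L - {\<zero>}" using val_mult mult_nonzero by auto
  then show "x \<otimes>\<^bsub>?G\<^esub> y \<in> carrier ?G" by (auto simp: additive_group_def value_group_def)
next
  let ?G = "additive_group (value_group L v)"
  show "\<one>\<^bsub>?G\<^esub> \<in> carrier ?G" using val_one by (force simp: additive_group_def value_group_def)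
  fix x assume "x \<in> carrier ?G"
  then obtain a where a: "a \<in> carrier L - {\<zero>}" "x = v a"
    by (auto simp: additive_group_def value_group_def)
  then have "- x = v (inv a)" "inv a \<in> carrier L - {\<zero>}" using val_inv inv_nonzero by auto
  then have "- x \<in> v ` (carrier L - {\<zero>})" by blast
  then show "\<exists>y\<in>carrier ?G. y \<otimes>\<^bsub>?G\<^esub> x = \<one>\<^bsub>?G\<^esub>"
    by (intro bexI[of _ "- x"]) (simp_all add: additive_group_def value_group_def)
qed (auto simp: additive_group_def add.assoc add.commute)

lemma base_value_subgroup:
  "subgroup (value_group (L\<lparr>carrier := K\<rparr>) u) (additive_group (value_group L v))"
proof -
  let ?G = "additive_group (value_group L v)"
  interpret comm_group ?G by (rule additive_value_group)
  have sub: "v ` (K - {\<zero>}) \<subseteq> carrier ?G"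
    using K_carrier by (auto simp: additive_group_def value_group_def)
  show ?thesis
    unfolding value_group_base
  proof (rule subgroupI[OF sub])
    show "v ` (K - {\<zero>}) \<noteq> {}" using subringE(3)[OF K_subring] by auto
    fix x assume x: "x \<in> v ` (K - {\<zero>})"
    then obtain a where a: "a \<in> K" "a \<noteq> \<zero>" "x = v a" by auto
    have "v (inv a) \<in> v ` (K - {\<zero>})" using K_inv[OF a(1,2)] inv_nonzero[OF K_carrier[OF a(1)] a(2)] by auto
    then have *: "- x \<in> v ` (K - {\<zero>})" using val_inv[OF K_carrier[OF a(1)] a(2)] a(3) by simp
    have "inv\<^bsub>?G\<^esub> x = - x"
      using sub * x by (intro inv_equality) (auto simp: additive_group_def)
    then show "inv\<^bsub>?G\<^esub> x \<in> v ` (K - {\<zero>})" using * by simp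
    fix y assume "y \<in> v ` (K - {\<zero>})"
    then obtain b where b: "b \<in> K" "b \<noteq> \<zero>" "y = v b" by auto
    have "a \<otimes> b \<in> K - {\<zero>}" using subringE(6)[OF K_subring a(1) b(1)] mult_nonzero K_carrier a b by auto
    moreover have "x + y = v (a \<otimes> b)" using val_mult K_carrier a b by simp
    ultimately show "x \<otimes>\<^bsub>?G\<^esub> y \<in> v ` (K - {\<zero>})" by (auto simp: additive_group_def)
  qed
qed

text \<open>The quotient of the value groups has order p^k, so this power annihilates it; one
  exponent serves all \<open>x\<close>.\<close>

lemma power_value_in_base:
  "\<exists>k::nat. \<forall>x\<in>carrier L - {\<zero>}. \<exists>y\<in>K - {\<zero>}. v (x [^] (p ^ k)) = v y"
proof -
  let ?G = "additive_group (value_group L v)" and ?H = "value_group (L\<lparr>carrier := K\<rparr>) u"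
  obtain k :: nat where k: "card (rcosets\<^bsub>?G\<^esub> ?H) = p ^ k" using index by (auto simp: group_index_def)
  interpret G: comm_group ?G by (rule additive_value_group)
  have normal: "?H \<lhd> ?G" by (rule G.subgroup_imp_normal[OF base_value_subgroup])
  interpret Q: group "?G Mod ?H" by (rule normal.factorgroup_is_group[OF normal])
  interpret h: group_hom ?G "?G Mod ?H" "\<lambda>x. ?H #>\<^bsub>?G\<^esub> x"
    by unfold_locales (rule normal.r_coset_hom_Mod[OF normal])
  have order: "order (?G Mod ?H) = p ^ k" using k by (simp add: order_def FactGroup_def)
  show ?thesis
  proof (intro exI[of _ k] ballI)
    fix x assume x: "x \<in> carrier L - {\<zero>}"
    then have vx: "v x \<in> carrier ?G" by (auto simp: additive_group_def value_group_def)
    have "v x [^]\<^bsub>?G\<^esub> n = v (x [^] n)" for n :: nat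
    proof (induction n)
      case 0
      then show ?case by (simp add: additive_group_def val_one)
    next
      case (Suc n)
      then show ?case using val_mult[of "x [^] n" x] x pow_nonzero[of x n]
        by (simp add: additive_group_def)
    qed
    moreover have "?H #>\<^bsub>?G\<^esub> (v x [^]\<^bsub>?G\<^esub> (p ^ k)) = ?H"
      using h.hom_nat_pow[OF vx, of "p ^ k"] Q.pow_order_eq_1[OF h.hom_closed[OF vx]] order
      by (simp add: FactGroup_def)
    ultimately have "v (x [^] (p ^ k)) \<in> ?H"
      using G.rcos_self[OF G.nat_pow_closed[OF vx] base_value_subgroup, of "p ^ k"] by simp
    then show "\<exists>y\<in>K - {\<zero>}. v (x [^] (p ^ k)) = v y" unfolding value_group_base by blast
  qed
qed

text \<open>Some p-power of \<open>x\<close> is an element \<open>y\<close> of \<open>K\<close>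
  times an element of value 0. The automorphism fixes \<open>y\<close> and preserves value 0, and
  multiples of values may be cancelled in an ordered group.\<close>

lemma Gal_val:
  assumes h: "h \<in> Gal" and x: "x \<in> carrier L" "x \<noteq> \<zero>"
  shows "v (h x) = v x"
proof -
  obtain k y where y: "y \<in> K" "y \<noteq> \<zero>" "v (x [^] (p ^ k)) = v y" using power_value_in_base x by blast
  have yc: "y \<in> carrier L" "inv y \<in> carrier L" "inv y \<noteq> \<zero>" "inv y \<in> K"
    using K_carrier y inv_nonzero K_inv by auto
  define w where "w = x [^] (p ^ k) \<otimes> inv y"
  have w: "w \<in> carrier L" "w \<noteq> \<zero>" "v w = 0"
    using x y yc pow_nonzero mult_nonzero val_mult[of "x [^] (p ^ k)" "inv y"] val_inv
    by (auto simp: w_def)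
  have "v (h w) = 0" by (rule Gal_val_zero[OF h w])
  moreover have "h w = h x [^] (p ^ k) \<otimes> inv y"
    unfolding w_def using Gal_mult[OF h] Gal_pow[OF h] gal_group_fixes[OF h] x yc by simp
  ultimately have "v (h x [^] (p ^ k)) = v y"
    using val_mult[of "h x [^] (p ^ k)" "inv y"] val_inv[OF yc(1)] y(2) yc Gal_closed[OF h x(1)]
      pow_nonzero[OF Gal_closed[OF h x(1)] Gal_nonzero[OF h x]] by simp
  then have "v (h x [^] (p ^ k)) = v (x [^] (p ^ k))" using y by simp
  moreover have "p ^ k > 0" using residue_char(2) by simp
  ultimately show ?thesis
    using val_pow[OF x] val_pow[OF Gal_closed[OF h x(1)] Gal_nonzero[OF h x]]
      sum_list_replicate_eq_iff by simp
qed

lemma Gal_ball_plus: "h \<in> Gal \<Longrightarrow> x \<in> ball_plus \<gamma> \<Longrightarrow> h x \<in> ball_plus \<gamma>"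
  using Gal_val[of h x] Gal_zero[of h] Gal_closed[of h x] by (cases "x = \<zero>") (auto simp: ball_plus_iff)

text \<open>Pure inseparability with the quotient removed; here, unlike for values, the exponent
  depends on \<open>w\<close>.\<close>

lemma residue_power_in_base:
  assumes w: "w \<in> ball 0"
  shows "\<exists>(k::nat) a. a \<in> K \<and> a \<in> ball 0 \<and> w [^] (p ^ k) \<ominus> a \<in> ball_plus 0"
proof -
  have wV: "w \<in> val_ring L v" using w by (simp add: val_ring_eq_ball)
  have "residue w \<in> carrier (residue_field L v)"
    using ring_hom_closed[OF residue_hom, of w] wV by simp
  then obtain k where "residue w [^]\<^bsub>residue_field L v\<^esub> (p ^ k) \<in> residue_subfield L v K u"
    using residue_ext unfolding purely_inseparable_over_def by blast
  then obtain a where a: "a \<in> val_ring (L\<lparr>carrier := K\<rparr>) u" "residue (w [^] (p ^ k)) = residue a"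
    using residue_pow[OF wV] unfolding residue_subfield_def by auto
  have aK: "a \<in> K" "a \<in> ball 0" using a(1) unfolding val_ring_base val_ring_eq_ball by auto
  then have "w [^] (p ^ k) \<ominus> a \<in> ball_plus 0"
    using residue_eq_iff[of "w [^] (p ^ k)" a] a(2) ball_pow[OF w] by (simp add: val_ring_eq_ball)
  then show ?thesis using aK by blast
qed

text \<open>Some \<open>p\<close>-power of \<open>x\<close> is an element of \<open>K\<close> times a unit \<open>w\<close>, and some \<open>p\<close>-power of the
  residue of \<open>w\<close> comes from \<open>K\<close>; so \<open>h x / x\<close> has residue \<open>1\<close> after raising to a \<open>p\<close>-power, hence
  before.\<close>

lemma Gal_congruent:
  assumes h: "h \<in> Gal" and x: "x \<in> carrier L" "x \<noteq> \<zero>"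
  shows "h x \<ominus> x \<in> ball_plus (v x)"
proof -
  have unit_case: "t \<in> carrier L \<and> t \<noteq> \<zero> \<and> v t = 0" if "t = h y \<otimes> inv y" "y \<in> carrier L" "y \<noteq> \<zero>" for t y
    using that val_mult[of "h y" "inv y"] Gal_val[OF h] Gal_closed[OF h] Gal_nonzero[OF h]
      inv_nonzero[of y] val_inv[of y] mult_nonzero[of "h y" "inv y"] by auto
  define t where "t = h x \<otimes> inv x"
  have xi: "inv x \<in> carrier L" "x \<otimes> inv x = \<one>" "inv x \<noteq> \<zero>" using inv_nonzero[OF x] by auto
  have t: "t \<in> carrier L" "t \<noteq> \<zero>" "v t = 0" using unit_case[OF t_def x] by auto
  have hx: "h x = t \<otimes> x" using xi x Gal_closed[OF h x(1)] by (simp add: t_def m_assoc m_comm[of "inv x" x])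
  obtain k y where y: "y \<in> K" "y \<noteq> \<zero>" "v (x [^] (p ^ k)) = v y" using power_value_in_base x by blast
  have yc: "y \<in> carrier L" "inv y \<in> carrier L" "inv y \<noteq> \<zero>" "inv y \<in> K"
    using K_carrier y inv_nonzero K_inv by auto
  define w where "w = x [^] (p ^ k) \<otimes> inv y"
  have w: "w \<in> carrier L" "w \<noteq> \<zero>" "v w = 0"
    using x y yc pow_nonzero mult_nonzero val_mult[of "x [^] (p ^ k)" "inv y"] val_inv
    by (auto simp: w_def)
  \<comment> \<open>As \<open>h\<close> fixes \<open>y\<close>, passing from \<open>w\<close> to
    \<open>h w\<close> multiplies by exactly the (p^k)-th power of \<open>t\<close>.\<close>
  have hw: "h w = t [^] (p ^ k) \<otimes> w"
  proof -
    have "h w = (t \<otimes> x) [^] (p ^ k) \<otimes> inv y"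
      unfolding w_def hx[symmetric] using Gal_mult[OF h] Gal_pow[OF h] gal_group_fixes[OF h] x yc by simp
    then show ?thesis using t x yc by (simp add: w_def nat_pow_distrib m_assoc)
  qed
  obtain j :: nat and a where a: "a \<in> K" "w [^] (p ^ j) \<ominus> a \<in> ball_plus 0"
    using residue_power_in_base[of w] w by (auto simp: ball_iff)
  let ?w = "w [^] (p ^ j)"
  have wj: "?w \<in> carrier L" "?w \<noteq> \<zero>" "v ?w = 0"
    using w pow_nonzero[of w] val_pow[of w] by (simp_all add: sum_list_replicate_zero)
  \<comment> \<open>\<open>?w\<close> is congruent to the element \<open>a\<close> fixed by
    \<open>h\<close>, and \<open>h\<close> respects smallness, so \<open>h ?w\<close> and
    \<open>?w\<close> are both congruent to \<open>a\<close>.\<close>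
  have "h (?w \<ominus> a) \<in> ball_plus 0" by (rule Gal_ball_plus[OF h a(2)])
  then have "h ?w \<ominus> a \<in> ball_plus 0"
    using Gal_minus[OF h wj(1) K_carrier[OF a(1)]] gal_group_fixes[OF h a(1)] by simp
  then have "h ?w \<ominus> ?w \<in> ball_plus 0"
    using congruent_trans[OF Gal_closed[OF h wj(1)] K_carrier[OF a(1)] wj(1)]
      congruent_sym[OF wj(1) K_carrier[OF a(1)] a(2)] by blast
  moreover have "inv ?w \<in> ball 0" using inv_nonzero[OF wj(1,2)] val_inv[OF wj(1,2)] wj(3) by (simp add: ball_iff)
  ultimately have "(h ?w \<ominus> ?w) \<otimes> inv ?w \<in> ball_plus (0 + 0)" by (rule ball_plus_mult)
  moreover have "(h ?w \<ominus> ?w) \<otimes> inv ?w = t [^] (p ^ (k + j)) \<ominus> \<one>"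
  proof -
    have "h ?w = t [^] (p ^ (k + j)) \<otimes> ?w"
      using Gal_pow[OF h w(1)] hw t w by (simp add: nat_pow_distrib nat_pow_pow power_add)
    then show ?thesis using inv_nonzero[OF wj(1,2)] wj t
      by (simp add: a_minus_def l_distr l_minus m_assoc)
  qed
  ultimately have "t [^] (p ^ (k + j)) \<ominus> \<one> \<in> ball_plus 0" by simp
  then have "t \<ominus> \<one> \<in> ball_plus 0" using frobenius_injective[OF residue_char] t by (simp add: ball_iff)
  then have "(t \<ominus> \<one>) \<otimes> x \<in> ball_plus (0 + v x)" using x by (intro ball_plus_mult) (simp_all add: ball_iff)
  moreover have "(t \<ominus> \<one>) \<otimes> x = h x \<ominus> x" using t x by (simp add: hx a_minus_def l_distr l_minus)
  ultimately show ?thesis by simp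
qed

text \<open>The congruences of the single factors are multiplied up over subsets of the group; the
  first conjunct is carried along because \<open>congruent_mult\<close> asks for it.\<close>

lemma prod_conjugates_congruent:
  assumes A: "A \<subseteq> Gal" and x: "x \<in> carrier L" "x \<noteq> \<zero>"
  shows "(\<Otimes>h\<in>A. h x) \<in> ball (sum_list (replicate (card A) (v x)))
    \<and> (\<Otimes>h\<in>A. h x) \<ominus> x [^] card A \<in> ball_plus (sum_list (replicate (card A) (v x)))"
  using finite_subset[OF A Gal_finite] A
proof (induction A rule: finite_induct)
  case empty
  then show ?case by (simp add: a_minus_def r_neg ball_plus_zero ball_iff val_one)
next
  case (insert h A)
  let ?P = "\<Otimes>h\<in>A. h x"
  have h: "h \<in> Gal" using insert.prems by blast
  have prod: "(\<Otimes>h\<in>insert h A. h x) = h x \<otimes> ?P"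
    using insert Gal_closed x(1) by (intro finprod_insert) auto
  have IH: "?P \<in> ball (sum_list (replicate (card A) (v x)))"
    "?P \<ominus> x [^] card A \<in> ball_plus (sum_list (replicate (card A) (v x)))"
    using insert.IH insert.prems by auto
  have hx: "h x \<in> ball (v x)" "x \<in> ball (v x)"
    using Gal_closed[OF h] Gal_val[OF h x] x by (auto simp: ball_iff)
  have xA: "x [^] card A \<in> ball (sum_list (replicate (card A) (v x)))"
    using x val_pow[OF x] by (simp add: ball_iff)
  have "h x \<otimes> ?P \<ominus> x \<otimes> x [^] card A \<in> ball_plus (v x + sum_list (replicate (card A) (v x)))"
    by (rule congruent_mult[OF hx IH(1) xA Gal_congruent[OF h x] IH(2)])
  moreover have "x \<otimes> x [^] card A = x [^] Suc (card A)" using x by (simp add: m_comm)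
  ultimately show ?case
    unfolding prod card_insert_disjoint[OF insert.hyps] using ball_mult[OF hx(1) IH(1)] by simp
qed

section \<open>The norm, and the order of the Galois group\<close>

definition norm :: "'a \<Rightarrow> 'a" where "norm x = (\<Otimes>h\<in>Gal. h x)"

lemma norm_closed: "x \<in> carrier L \<Longrightarrow> norm x \<in> carrier L"
  unfolding norm_def using Gal_closed by (intro finprod_closed) auto

lemma norm_in_base:
  assumes x: "x \<in> carrier L"
  shows "norm x \<in> K"
proof (rule fixed_imp_K[OF norm_closed[OF x]])
  fix g assume g: "g \<in> Gal"
  interpret G: group "gal_group K" by (rule Gal_group)
  interpret g: ring_hom_cring L L g by (rule Gal_hom[OF g])
  have c: "(\<lambda>h. h x) \<in> Gal \<rightarrow> carrier L" using Gal_closed x by auto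
  have "g (norm x) = (\<Otimes>h\<in>Gal. g (h x))"
    unfolding norm_def using g.hom_finprod[OF c] by (simp add: comp_def)
  also have "\<dots> = (\<Otimes>h\<in>Gal. (g \<otimes>\<^bsub>gal_group K\<^esub> h) x)"
    using g gal_group_mult x Gal_closed by (intro finprod_cong') auto
  also have "\<dots> = (\<Otimes>h\<in>(\<lambda>h. g \<otimes>\<^bsub>gal_group K\<^esub> h) ` Gal. h x)"
    using g Gal_closed x G.inj_on_cmult[OF g] by (intro finprod_reindex[symmetric]) auto
  also have "(\<lambda>h. g \<otimes>\<^bsub>gal_group K\<^esub> h) ` Gal = Gal" using G.surj_const_mult[OF g] .
  finally show "g (norm x) = norm x" by (simp add: norm_def)
qed

lemma norm_mult: "x \<in> carrier L \<Longrightarrow> y \<in> carrier L \<Longrightarrow> norm (x \<otimes> y) = norm x \<otimes> norm y"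
proof -
  assume xy: "x \<in> carrier L" "y \<in> carrier L"
  have "norm (x \<otimes> y) = (\<Otimes>h\<in>Gal. h x \<otimes> h y)"
    unfolding norm_def using xy Gal_closed by (intro finprod_cong') (auto simp: Gal_mult)
  then show ?thesis unfolding norm_def using xy Gal_closed by (simp add: finprod_multf Pi_iff)
qed

lemma norm_one: "norm \<one> = \<one>"
  unfolding norm_def using Gal_one by (intro finprod_one_eqI)

lemma norm_congruent:
  assumes "x \<in> carrier L" "x \<noteq> \<zero>"
  shows "norm x \<ominus> x [^] card Gal \<in> ball_plus (v (x [^] card Gal))"
  using prod_conjugates_congruent[OF subset_refl assms] by (simp add: norm_def val_pow[OF assms])

lemma norm_nonzero: "x \<in> carrier L \<Longrightarrow> x \<noteq> \<zero> \<Longrightarrow> norm x \<noteq> \<zero>"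
  and val_norm: "x \<in> carrier L \<Longrightarrow> x \<noteq> \<zero> \<Longrightarrow> v (norm x) = v (x [^] card Gal)"
  using val_congruent[of "x [^] card Gal" "norm x"] norm_congruent[of x] norm_closed[of x] pow_nonzero[of x]
  by auto

text \<open>For a subgroup \<open>H\<close> of order prime to \<open>p\<close> the trace of \<open>x\<close> is \<open>card H * x\<close> up to terms of larger
  value, hence injective; but it kills \<open>g y - y\<close> for \<open>g \<in> H\<close>.\<close>

lemma coprime_subgroup_trivial:
  assumes H: "subgroup H (gal_group K)" and card: "\<not> p dvd card H"
  shows "H = {\<one>\<^bsub>gal_group K\<^esub>}"
proof -
  interpret G: group "gal_group K" by (rule Gal_group)
  have HG: "H \<subseteq> Gal" using H subgroup.subset by blast
  then have finH: "finite H" using Gal_finite finite_subset by blast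
  define tr where "tr x = (\<Oplus>h\<in>H. h x)" for x
  have hc: "h x \<in> carrier L" if "h \<in> H" "x \<in> carrier L" for h x using Gal_closed HG that by blast
  have tr_nonzero: "tr x \<noteq> \<zero>" if x: "x \<in> carrier L" "x \<noteq> \<zero>" for x
  proof
    assume tr0: "tr x = \<zero>"
    have "tr x = (\<Oplus>h\<in>H. x \<oplus> (h x \<ominus> x))"
      unfolding tr_def using hc x
      by (intro finsum_cong') (auto simp: a_minus_def a_lcomm[of x _ "\<ominus> x"] r_neg)
    also have "\<dots> = (\<Oplus>h\<in>H. x) \<oplus> (\<Oplus>h\<in>H. h x \<ominus> x)"
      using hc x by (intro finsum_addf) auto
    also have "(\<Oplus>h\<in>H. x) = add_pow L (card H) \<one> \<otimes> x"
      using x add.finprod_const[OF x(1), of H] add_pow_ldistr[of \<one> x "card H"] by simp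
    finally have eq: "add_pow L (card H) \<one> \<otimes> x \<oplus> (\<Oplus>h\<in>H. h x \<ominus> x) = \<zero>" using tr0 by simp
    have sum: "(\<Oplus>h\<in>H. h x \<ominus> x) \<in> ball_plus (v x)"
      using finH Gal_congruent HG x by (intro ball_plus_sum) auto
    have c: "add_pow L (card H) \<one> \<in> carrier L" by simp
    have "add_pow L (card H) \<one> \<otimes> x = \<ominus> (\<Oplus>h\<in>H. h x \<ominus> x)"
      using eq c x sum by (intro minus_equality[symmetric]) (auto simp: ball_plus_iff)
    then have plus: "add_pow L (card H) \<one> \<otimes> x \<in> ball_plus (v x)"
      using ball_plus_uminus[OF sum] by simp
    have "add_pow L (card H) \<one> \<notin> ball_plus 0" using residue_char_iff[OF residue_char(1)] card by simp
    then have "add_pow L (card H) \<one> \<noteq> \<zero>" "v (add_pow L (card H) \<one>) = 0"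
      using add_pow_one_in_val_ring[of "card H"] unfolding val_ring_eq_ball
      by (auto simp: ball_iff ball_plus_iff)
    then show False using plus val_mult[OF c x(1)] mult_nonzero[OF c x(1)] x by (simp add: ball_plus_iff)
  qed
  have tr_invariant: "tr (g y) = tr y" if g: "g \<in> H" and y: "y \<in> carrier L" for g y
  proof -
    have gG: "g \<in> Gal" using HG g by blast
    \<comment> \<open>In \<open>tr (g y)\<close> each \<open>h\<close> becomes the product of
      \<open>h\<close> with \<open>g\<close>, so invariance of the trace rests on right translation
      permuting \<open>H\<close>.\<close>
    have inj: "inj_on (\<lambda>h. h \<otimes>\<^bsub>gal_group K\<^esub> g) H"
      using gG HG G.right_cancel by (intro inj_onI) blast
    have "(\<lambda>h. h \<otimes>\<^bsub>gal_group K\<^esub> g) ` H \<subseteq> H" using subgroup.m_closed[OF H] g by blast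
    then have img: "(\<lambda>h. h \<otimes>\<^bsub>gal_group K\<^esub> g) ` H = H" using endo_inj_surj[OF finH _ inj] by blast
    have "tr (g y) = (\<Oplus>h\<in>H. (h \<otimes>\<^bsub>gal_group K\<^esub> g) y)"
      unfolding tr_def using HG gG y gal_group_mult[of _ K g y] subgroup.m_closed[OF H _ g] hc
      by (intro finsum_cong') auto
    also have "\<dots> = (\<Oplus>h\<in>(\<lambda>h. h \<otimes>\<^bsub>gal_group K\<^esub> g) ` H. h y)"
      using hc y img by (intro finsum_reindex[symmetric] inj) auto
    finally show ?thesis by (simp add: img tr_def)
  qed
  have "g = \<one>\<^bsub>gal_group K\<^esub>" if g: "g \<in> H" for g
  proof -
    have gG: "g \<in> Gal" using HG g by blast
    have "g y = \<one>\<^bsub>gal_group K\<^esub> y" if y: "y \<in> carrier L" for y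
    proof (rule ccontr)
      assume "g y \<noteq> \<one>\<^bsub>gal_group K\<^esub> y"
      then have ne: "g y \<ominus> y \<noteq> \<zero>" using y Gal_closed[OF gG y] by (simp add: gal_group_one)
      have c: "g y \<in> carrier L" using Gal_closed[OF gG y] .
      have "tr (g y \<ominus> y) = (\<Oplus>h\<in>H. h (g y) \<oplus> \<ominus> \<one> \<otimes> h y)"
        unfolding tr_def
      proof (intro finsum_cong' refl)
        fix h assume h: "h \<in> H"
        then have "h (g y \<ominus> y) = h (g y) \<ominus> h y" using Gal_minus HG c y by blast
        then show "h (g y \<ominus> y) = h (g y) \<oplus> \<ominus> \<one> \<otimes> h y"
          using hc[OF h] c y by (simp add: a_minus_def l_minus)
      qed (use hc c y in auto)
      also have "\<dots> = tr (g y) \<oplus> (\<Oplus>h\<in>H. \<ominus> \<one> \<otimes> h y)"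
        unfolding tr_def using c y hc by (intro finsum_addf) auto
      also have "(\<Oplus>h\<in>H. \<ominus> \<one> \<otimes> h y) = \<ominus> \<one> \<otimes> tr y"
        unfolding tr_def using y hc finH by (intro finsum_rdistr[symmetric]) auto
      also have "tr (g y) \<oplus> \<ominus> \<one> \<otimes> tr y = \<zero>"
        using tr_invariant[OF g y] y hc by (simp add: tr_def l_minus r_neg Pi_iff)
      finally show False using tr_nonzero[OF _ ne] c y by simp
    qed
    then show ?thesis
      using extensionalityI[of g "carrier L" "\<one>\<^bsub>gal_group K\<^esub>"] gG G.one_closed
      by (auto simp: gal_group_iff)
  qed
  then show ?thesis using subgroup.one_closed[OF H] by blast
qed

text \<open>For a prime \<open>l\<close> other than \<open>p\<close> dividing the order, a Sylow
  \<open>l\<close>-subgroup would be nontrivial of order not divisible by \<open>p\<close>.\<close>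

lemma card_Gal_prime_power: "\<exists>n. card Gal = p ^ n"
proof -
  interpret G: group "gal_group K" by (rule Gal_group)
  have p: "Factorial_Ring.prime p" by (rule residue_char_prime[OF residue_char])
  have pos: "card Gal > 0" using Gal_finite G.one_closed card_gt_0_iff by blast
  have only: "l = p" if l: "Factorial_Ring.prime l" "l dvd card Gal" for l :: nat
  proof (rule ccontr)
    assume ne: "l \<noteq> p"
    obtain m where m: "card Gal = l ^ multiplicity l (card Gal) * m"
      using multiplicity_dvd[of l "card Gal"] by (elim dvdE)
    obtain H where H: "subgroup H (gal_group K)" "card H = l ^ multiplicity l (card Gal)"
      using sylow_thm[OF l(1) Gal_group _ Gal_finite] m by (auto simp: order_def)
    have "\<not> p dvd card H" using H(2) p l(1) ne by (metis prime_dvd_power primes_dvd_imp_eq)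
    then have "card H = 1" using coprime_subgroup_trivial[OF H(1)] by simp
    moreover have "l ^ multiplicity l (card Gal) > 1"
    proof -
      have "multiplicity l (card Gal) > 0"
        using l pos prime_multiplicity_gt_zero_iff[of l "card Gal"] by simp
      then show ?thesis using prime_gt_1_nat[OF l(1)] one_less_power by blast
    qed
    ultimately show False using H(2) by linarith
  qed
  obtain m where m: "card Gal = p ^ multiplicity p (card Gal) * m" "\<not> p dvd m"
    using multiplicity_decompose'[of "card Gal" p] pos p not_prime_unit by (metis less_not_refl)
  have "m = 1"
  proof (rule ccontr)
    assume "m \<noteq> 1"
    then obtain l where "Factorial_Ring.prime l" "l dvd m" using prime_factor_nat by blast
    then show False using only[of l] m by (metis dvd_mult)
  qed
  then show ?thesis using m(1) by (metis mult.right_neutral)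
qed

end

section \<open>Norms of elements of the local ring\<close>

text \<open>The inverse in the restricted record is an inverse computed in a different monoid; the
  two agree by uniqueness of inverses and not by unfolding.\<close>

lemma (in ring) subring_a_inv:
  assumes K: "subring K R" and x: "x \<in> K"
  shows "\<ominus>\<^bsub>R\<lparr>carrier := K\<rparr>\<^esub> x = \<ominus> x"
proof -
  interpret K: ring "R\<lparr>carrier := K\<rparr>" by (rule subring_is_ring[OF K])
  have "x \<in> carrier R" using x subringE(1)[OF K] by blast
  then show ?thesis
    using x subringE(5)[OF K x] by (intro K.minus_equality) (auto simp: l_neg)
qed

lemma (in ring) subring_of_subring:
  assumes K: "subring K R" and A: "subring A (R\<lparr>carrier := K\<rparr>)"
  shows "subring A R"
proof (rule subringI)
  have AK: "A \<subseteq> K" using subringE(1)[OF A] by simp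
  then show "A \<subseteq> carrier R" using subringE(1)[OF K] by blast
  show "\<ominus> x \<in> A" if "x \<in> A" for x
    using subringE(5)[OF A that] subring_a_inv[OF K, of x] AK that by auto
qed (use subringE(3,6,7)[OF A] in auto)

text \<open>Zorn on the ideals above \<open>I\<close> that avoid \<open>\<one>\<close>; local rings
  need not be Noetherian, so no chain condition is at hand.\<close>

lemma (in cring) exists_maximalideal:
  assumes I: "ideal I R" "\<one> \<notin> I"
  shows "\<exists>M. maximalideal M R \<and> I \<subseteq> M"
proof -
  define F where "F = {J. ideal J R \<and> I \<subseteq> J \<and> \<one> \<notin> J}"
  have "\<exists>M\<in>F. \<forall>J\<in>F. M \<subseteq> J \<longrightarrow> J = M"
  proof (rule subset_Zorn_nonempty)
    show "F \<noteq> {}" using I by (auto simp: F_def)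
    fix C assume C: "C \<noteq> {}" "subset.chain F C"
    have J: "ideal J R" "I \<subseteq> J" "\<one> \<notin> J" if "J \<in> C" for J
      using C(2) that by (auto simp: F_def subset_chain_def)
    have total: "J \<subseteq> J' \<or> J' \<subseteq> J" if "J \<in> C" "J' \<in> C" for J J'
      using C(2) that by (auto simp: subset_chain_def)
    obtain J0 where J0: "J0 \<in> C" using C(1) by blast
    have "ideal (\<Union>C) R"
    proof (rule idealI[OF ring_axioms])
      show "subgroup (\<Union>C) (add_monoid R)"
      proof (rule add.subgroupI)
        show "\<Union>C \<subseteq> carrier R" using ideal.Icarr[OF J(1)] by (intro Union_least subsetI)
        have "\<zero> \<in> J0" by (rule additive_subgroup.zero_closed[OF ideal.axioms(1)[OF J(1)[OF J0]]])
        then show "\<Union>C \<noteq> {}" using J0 by auto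
      next
        fix a assume "a \<in> \<Union>C"
        then obtain J1 where J1: "J1 \<in> C" "a \<in> J1" by (elim UnionE)
        then have "\<ominus> a \<in> J1"
          by (intro additive_subgroup.a_inv_closed[OF ideal.axioms(1)[OF J(1)]])
        then show "\<ominus> a \<in> \<Union>C" using J1(1) by (rule UnionI[rotated])
      next
        fix a b assume "a \<in> \<Union>C" "b \<in> \<Union>C"
        then obtain J1 J2 where J12: "J1 \<in> C" "a \<in> J1" "J2 \<in> C" "b \<in> J2" by (elim UnionE)
        then obtain J3 where J3: "J3 \<in> C" "a \<in> J3" "b \<in> J3" using total[OF J12(1,3)] by auto
        have "a \<oplus> b \<in> J3"
          by (rule additive_subgroup.a_closed[OF ideal.axioms(1)[OF J(1)[OF J3(1)]] J3(2,3)])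
        then show "a \<oplus> b \<in> \<Union>C" using J3(1) by (rule UnionI[rotated])
      qed
    next
      fix a x assume a: "a \<in> \<Union>C" and x: "x \<in> carrier R"
      then obtain J1 where J1: "J1 \<in> C" "a \<in> J1" by (elim UnionE)
      have "x \<otimes> a \<in> J1" "a \<otimes> x \<in> J1"
        using ideal.I_l_closed[OF J(1)[OF J1(1)] J1(2) x] ideal.I_r_closed[OF J(1)[OF J1(1)] J1(2) x] .
      then show "x \<otimes> a \<in> \<Union>C" "a \<otimes> x \<in> \<Union>C" using J1(1) by (auto intro: UnionI)
    qed
    moreover have "I \<subseteq> \<Union>C" using J(2)[OF J0] J0 by (meson Union_upper order_trans)
    ultimately show "\<Union>C \<in> F" using J(3) by (auto simp: F_def)
  qed
  then obtain M where M: "M \<in> F" "\<And>J. J \<in> F \<Longrightarrow> M \<subseteq> J \<Longrightarrow> J = M" by blast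
  have "maximalideal M R"
  proof (rule maximalidealI)
    show "ideal M R" "carrier R \<noteq> M" using M(1) by (auto simp: F_def)
    fix J assume J: "ideal J R" "M \<subseteq> J" "J \<subseteq> carrier R"
    show "J = M \<or> J = carrier R"
    proof (cases "\<one> \<in> J")
      case True
      then show ?thesis using ideal.one_imp_carrier[OF J(1)] by blast
    next
      case False
      then have "J \<in> F" using J M(1) by (auto simp: F_def)
      then show ?thesis using M(2) J(2) by blast
    qed
  qed
  then show ?thesis using M(1) by (auto simp: F_def)
qed

text \<open>The principal ideal of a non-unit avoids \<open>\<one>\<close> and so lies in some
  maximal ideal, which can only be the unique one.\<close>

lemma (in cring) unique_maximalideal_unit:
  assumes "\<exists>!M. maximalideal M R" "x \<in> carrier R" "x \<notin> (THE M. maximalideal M R)"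
  shows "\<exists>y\<in>carrier R. x \<otimes> y = \<one>"
proof (rule ccontr)
  assume no: "\<not> (\<exists>y\<in>carrier R. x \<otimes> y = \<one>)"
  have "\<one> \<notin> PIdl x" using no assms(2) by (auto simp: cgenideal_def m_comm)
  then obtain M where M: "maximalideal M R" "PIdl x \<subseteq> M"
    using exists_maximalideal[OF cgenideal_ideal[OF assms(2)]] by blast
  then have "x \<in> M" using cgenideal_self[OF assms(2)] by blast
  moreover have "(THE M. maximalideal M R) = M" using assms(1) M(1) by (rule the1_equality)
  ultimately show False using assms(3) by simp
qed

locale unibranch_local = unibranch_galois L v K u p
  for L (structure) and v :: "'a \<Rightarrow> 'g::linordered_ab_group_add" and K u p +
  fixes R S :: "'a set"
  assumes R_local: "local_ring_of (L\<lparr>carrier := K\<rparr>) R"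
    and R_normal: "integral_closure (L\<lparr>carrier := K\<rparr>) R = R"
    and R_dominated: "dominates (L\<lparr>carrier := K\<rparr>) u R"
    and S_def: "S = localization_at L (integral_closure L R) (val_center L v (integral_closure L R))"
begin

abbreviation "R' \<equiv> integral_closure L R"

lemma R_subset: "R \<subseteq> K"
  using R_local subringE(1)[of R "L\<lparr>carrier := K\<rparr>"] by (simp add: local_ring_of_def)

lemma R_subring: "subring R L"
  using R_local subring_of_subring[OF K_subring] by (simp add: local_ring_of_def)

text \<open>Normality is formulated inside \<open>K\<close>. Evaluating a polynomial at a point of
  \<open>K\<close> gives the same result in \<open>K\<close> and in \<open>L\<close>, so it becomes
  a statement about \<open>R'\<close>.\<close>

lemma R_eq: "R = R' \<inter> K"
  using R_normal K_carrier eval_consistent[OF K_subring] by (auto simp: integral_closure_def)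

lemma R'_subring: "subring R' L"
  by (rule integral_closure_subring[OF R_subring])

lemma R'_carrier: "x \<in> R' \<Longrightarrow> x \<in> carrier L"
  using subringE(1)[OF R'_subring] by blast

text \<open>The coefficients of a monic equation of \<open>x\<close> over \<open>R\<close> are fixed
  by \<open>h\<close>, so \<open>h x\<close> satisfies the same equation.\<close>

lemma Gal_integral:
  assumes h: "h \<in> Gal" and x: "x \<in> R'"
  shows "h x \<in> R'"
proof -
  note c = R'_carrier[OF x]
  have "h f \<in> low_degree R (h x) n" if "f \<in> low_degree R x n" for f n
    using that
  proof (induction n arbitrary: f)
    case 0
    then show ?case using Gal_zero[OF h] by simp
  next
    case (Suc n)
    then obtain a f' where *: "a \<in> R" "f' \<in> low_degree R x n" "f = a \<otimes> x [^] n \<oplus> f'"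
      by (elim low_degree_SucE[OF R_subring c])
    have ac: "a \<in> carrier L" "h a = a" using *(1) R_subset K_carrier gal_group_fixes[OF h] by auto
    have "h f = a \<otimes> h x [^] n \<oplus> h f'"
      using * ac c low_degree_closed[OF R_subring c *(2)] by (simp add: Gal_add[OF h] Gal_mult[OF h] Gal_pow[OF h])
    then show ?case
      using low_degree_SucI[OF R_subring Gal_closed[OF h c] *(1) Suc.IH[OF *(2)]] by simp
  qed
  then show ?thesis using x Gal_closed[OF h c] Gal_pow[OF h c]
    unfolding integral_closure_iff[OF R_subring] by metis
qed

lemma norm_integral:
  assumes x: "x \<in> R'"
  shows "norm x \<in> R"
proof -
  have "(\<Otimes>h\<in>A. h x) \<in> R'" if "A \<subseteq> Gal" for A
    using finite_subset[OF that Gal_finite] that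
  proof (induction A rule: finite_induct)
    case empty
    then show ?case using subringE(3)[OF R'_subring] by simp
  next
    case (insert h A)
    have "(\<Otimes>h\<in>insert h A. h x) = h x \<otimes> (\<Otimes>h\<in>A. h x)"
      using insert Gal_closed R'_carrier[OF x] by (intro finprod_insert) auto
    then show ?case using insert Gal_integral[of h x] x subringE(6)[OF R'_subring] by simp
  qed
  then show ?thesis
    using norm_in_base[OF R'_carrier[OF x]] R_eq by (auto simp: norm_def)
qed

text \<open>By domination the maximal ideal of \<open>R\<close> consists of its elements in the
  valuation ideal, and everything else in a local ring is a unit.\<close>

lemma R_unit:
  assumes x: "x \<in> R" "x \<notin> val_ideal (L\<lparr>carrier := K\<rparr>) u"
  shows "x \<noteq> \<zero>" "inv x \<in> R"
proof -
  interpret RR: cring "L\<lparr>carrier := R\<rparr>"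
    using subring_is_domain[OF R_subring] by (simp add: domain_def)
  have "x \<notin> max_ideal (L\<lparr>carrier := K\<rparr>) R"
    using x R_dominated by (auto simp: dominates_def)
  then obtain y where y: "y \<in> R" "x \<otimes> y = \<one>"
    using RR.unique_maximalideal_unit[of x] R_local x(1) by (auto simp: local_ring_of_def max_ideal_def)
  have c: "x \<in> carrier L" "y \<in> carrier L" using x(1) y(1) R_subset K_carrier by auto
  show "x \<noteq> \<zero>" using y(2) c by auto
  then show "inv x \<in> R" using y c inv_unique'[of x y] by (simp add: m_comm)
qed

text \<open>Lying outside the center means being nonzero of nonpositive value, a condition on
  denominators that products and norms inherit.\<close>

lemma S_iff: "f \<in> S \<longleftrightarrow> (\<exists>a b. a \<in> R' \<and> b \<in> R' \<and> b \<noteq> \<zero> \<and> v b \<le> 0 \<and> f = a \<otimes> inv b)"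
  unfolding S_def localization_at_def val_center_def val_ideal_def
  using R'_carrier by (auto simp: not_less)

lemma S_I: "a \<in> R' \<Longrightarrow> b \<in> R' \<Longrightarrow> b \<noteq> \<zero> \<Longrightarrow> v b \<le> 0 \<Longrightarrow> a \<otimes> inv b \<in> S"
  unfolding S_iff by blast

lemma R'_subset_S: "R' \<subseteq> S"
proof
  fix x assume x: "x \<in> R'"
  have "x = x \<otimes> inv \<one>" using R'_carrier[OF x] by simp
  then show "x \<in> S" using S_I[OF x, of \<one>] subringE(3)[OF R'_subring] val_one by simp
qed

lemma R_subset_S: "R \<subseteq> S"
  using R'_subset_S R_eq by blast

lemma S_subring: "subring S L"
proof (rule subringI)
  show "S \<subseteq> carrier L" using R'_carrier inv_nonzero by (auto simp: S_iff)
  show "\<one> \<in> S" using R'_subset_S subringE(3)[OF R'_subring] by blast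
next
  fix f assume "f \<in> S"
  then obtain a b where f: "a \<in> R'" "b \<in> R'" "b \<noteq> \<zero>" "v b \<le> 0" "f = a \<otimes> inv b" unfolding S_iff by blast
  have bc: "b \<in> carrier L" "inv b \<in> carrier L" "b \<otimes> inv b = \<one>" "a \<in> carrier L"
    using f R'_carrier inv_nonzero by auto
  have "\<ominus> f = (\<ominus> a) \<otimes> inv b" using f bc by (simp add: l_minus)
  then show "\<ominus> f \<in> S" using S_I[OF _ f(2-4)] subringE(5)[OF R'_subring f(1)] by simp
  fix g assume "g \<in> S"
  then obtain c d where g: "c \<in> R'" "d \<in> R'" "d \<noteq> \<zero>" "v d \<le> 0" "g = c \<otimes> inv d" unfolding S_iff by blast
  have dc: "d \<in> carrier L" "inv d \<in> carrier L" "d \<otimes> inv d = \<one>" "c \<in> carrier L"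
    using g R'_carrier inv_nonzero by auto
  have bd: "b \<otimes> d \<in> R'" "b \<otimes> d \<noteq> \<zero>" "v (b \<otimes> d) \<le> 0"
    using subringE(6)[OF R'_subring f(2) g(2)] mult_nonzero val_mult bc dc f g by (auto simp: add_nonpos_nonpos)
  have invbd: "inv (b \<otimes> d) = inv b \<otimes> inv d"
  proof (rule inv_unique'[symmetric])
    have "(b \<otimes> d) \<otimes> (inv b \<otimes> inv d) = (b \<otimes> inv b) \<otimes> (d \<otimes> inv d)"
      using bc(1,2) dc(1,2) by (simp add: m_ac)
    then show *: "(b \<otimes> d) \<otimes> (inv b \<otimes> inv d) = \<one>" using bc dc by simp
    then show "inv b \<otimes> inv d \<otimes> (b \<otimes> d) = \<one>" using bc(1,2) dc(1,2) by (simp add: m_comm)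
  qed (use bc dc in auto)
  have "f \<otimes> g = (a \<otimes> c) \<otimes> inv (b \<otimes> d)"
    unfolding invbd f g using bc dc by (simp add: m_ac)
  then show "f \<otimes> g \<in> S" using S_I[OF _ bd] subringE(6)[OF R'_subring f(1) g(1)] by simp
  have "f \<oplus> g = (a \<otimes> d \<oplus> c \<otimes> b) \<otimes> inv (b \<otimes> d)"
  proof -
    have "a \<otimes> d \<otimes> (inv b \<otimes> inv d) = (a \<otimes> inv b) \<otimes> (d \<otimes> inv d)"
      "c \<otimes> b \<otimes> (inv b \<otimes> inv d) = (c \<otimes> inv d) \<otimes> (b \<otimes> inv b)"
      using bc(1,2,4) dc(1,2,4) by (simp_all add: m_ac)
    then show ?thesis unfolding invbd f g using bc dc by (simp add: l_distr)
  qed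
  then show "f \<oplus> g \<in> S"
    using S_I[OF _ bd] subringE(6,7)[OF R'_subring] f g by simp
qed

text \<open>The norm of a fraction is the fraction of the norms. The norm of the denominator still
  has nonpositive value, hence lies outside the maximal ideal of \<open>R\<close> and is invertible
  there.\<close>

lemma norm_local:
  assumes f: "f \<in> S"
  shows "norm f \<in> R"
proof -
  obtain a b where ab: "a \<in> R'" "b \<in> R'" "b \<noteq> \<zero>" "v b \<le> 0" "f = a \<otimes> inv b" using f unfolding S_iff by blast
  have bc: "b \<in> carrier L" "inv b \<in> carrier L" "b \<otimes> inv b = \<one>" "a \<in> carrier L"
    using ab R'_carrier inv_nonzero by auto
  have "sum_list (replicate n (v b)) \<le> 0" for n
    by (induction n) (simp_all add: ab(4) add_nonpos_nonpos)
  then have "v (norm b) \<le> 0" using val_norm[OF bc(1) ab(3)] val_pow[OF bc(1) ab(3)] by simp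
  moreover have nbR: "norm b \<in> R" by (rule norm_integral[OF ab(2)])
  moreover have nb: "norm b \<noteq> \<zero>" by (rule norm_nonzero[OF bc(1) ab(3)])
  ultimately have "norm b \<notin> val_ideal (L\<lparr>carrier := K\<rparr>) u"
    using restriction[of "norm b"] R_subset by (auto simp: val_ideal_def)
  then have inv: "inv (norm b) \<in> R" using R_unit nbR by blast
  have nc: "norm b \<in> carrier L" "norm (inv b) \<in> carrier L" "norm a \<in> carrier L"
    using bc norm_closed by auto
  have "norm b \<otimes> norm (inv b) = \<one>" using norm_mult[OF bc(1,2)] bc(3) norm_one by simp
  then have "norm (inv b) = inv (norm b)" using nc inv_unique'[of "norm b" "norm (inv b)"] by (simp add: m_comm)
  then have "norm f = norm a \<otimes> inv (norm b)" using ab(5) norm_mult[OF bc(4,2)] by simp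
  then show ?thesis using subringE(6)[OF R_subring norm_integral[OF ab(1)] inv] by simp
qed

end

section \<open>The associated graded ring\<close>

context valued_field
begin

context
  fixes S
  assumes S: "subring S L"
begin

abbreviation "P \<equiv> val_part L v S"
abbreviation "P_plus \<equiv> val_part_plus L v S"
abbreviation "gr \<equiv> gr_part L v S"
abbreviation "\<Gamma> \<equiv> value_group L v"

text \<open>For \<open>a\<close> in \<open>P \<gamma>\<close> this is the initial form of
  \<open>a\<close> if its value is \<gamma>, and the zero class if its value is larger.\<close>

definition gr_class :: "'g \<Rightarrow> 'a \<Rightarrow> 'a set" where "gr_class \<gamma> a = P_plus \<gamma> +> a"

lemma part_iff: "x \<in> P \<gamma> \<longleftrightarrow> x \<in> S \<and> x \<in> ball \<gamma>"
  using subringE(1)[OF S] by (auto simp: val_part_def)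

lemma part_plus_iff: "x \<in> P_plus \<gamma> \<longleftrightarrow> x \<in> S \<and> x \<in> ball_plus \<gamma>"
  using subringE(1)[OF S] by (auto simp: val_part_plus_def)

lemma part_carrier: "x \<in> P \<gamma> \<Longrightarrow> x \<in> carrier L"
  using subringE(1)[OF S] by (auto simp: val_part_def)

lemma part_plus_subset: "P_plus \<gamma> \<subseteq> P \<gamma>"
  by (auto simp: part_iff part_plus_iff dest: subsetD[OF ball_plus_subset])

lemma part_plus_carrier: "x \<in> P_plus \<gamma> \<Longrightarrow> x \<in> carrier L"
  using subringE(1)[OF S] by (auto simp: val_part_plus_def)

lemma part_zero: "\<zero> \<in> P \<gamma>" and part_plus_zero: "\<zero> \<in> P_plus \<gamma>"
  using subringE(2)[OF S] by (simp_all add: val_part_def val_part_plus_def)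

lemma part_add: "x \<in> P \<gamma> \<Longrightarrow> y \<in> P \<gamma> \<Longrightarrow> x \<oplus> y \<in> P \<gamma>"
  using ball_add subringE(7)[OF S] by (auto simp: part_iff)

lemma part_uminus: "x \<in> P \<gamma> \<Longrightarrow> \<ominus> x \<in> P \<gamma>"
  using ball_uminus subringE(5)[OF S] by (auto simp: part_iff)

lemma part_mult: "x \<in> P \<alpha> \<Longrightarrow> y \<in> P \<beta> \<Longrightarrow> x \<otimes> y \<in> P (\<alpha> + \<beta>)"
  using ball_mult subringE(6)[OF S] by (auto simp: part_iff)

lemma part_sum: "f \<in> A \<rightarrow> P \<gamma> \<Longrightarrow> finsum L f A \<in> P \<gamma>"
proof (induction A rule: infinite_finite_induct)
  case (insert i A)
  have "finsum L f (insert i A) = f i \<oplus> finsum L f A"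
    using insert part_carrier by (intro finsum_insert) (auto simp: Pi_iff)
  then show ?case using insert part_add by auto
qed (use part_zero in \<open>auto simp: finsum_infinite\<close>)

lemma part_plus_add: "x \<in> P_plus \<gamma> \<Longrightarrow> y \<in> P_plus \<gamma> \<Longrightarrow> x \<oplus> y \<in> P_plus \<gamma>"
  using ball_plus_add subringE(7)[OF S] by (auto simp: part_plus_iff)

lemma part_plus_uminus: "x \<in> P_plus \<gamma> \<Longrightarrow> \<ominus> x \<in> P_plus \<gamma>"
  using ball_plus_uminus subringE(5)[OF S] by (auto simp: part_plus_iff)

lemma part_plus_sum: "f \<in> A \<rightarrow> P_plus \<gamma> \<Longrightarrow> finsum L f A \<in> P_plus \<gamma>"
proof (induction A rule: infinite_finite_induct)
  case (insert i A)
  have "finsum L f (insert i A) = f i \<oplus> finsum L f A"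
    using insert part_plus_carrier by (intro finsum_insert) (auto simp: Pi_iff)
  then show ?case using insert part_plus_add by auto
qed (use part_plus_zero in \<open>auto simp: finsum_infinite\<close>)

lemma part_minus_plus_iff:
  "x \<in> P \<gamma> \<Longrightarrow> y \<in> P \<gamma> \<Longrightarrow> x \<ominus> y \<in> P_plus \<gamma> \<longleftrightarrow> x \<ominus> y \<in> ball_plus \<gamma>"
  using subringE(5,7)[OF S] by (simp add: part_plus_iff part_iff a_minus_def)

lemma gr_class_iff: "x \<in> gr_class \<gamma> a \<longleftrightarrow> (\<exists>e\<in>P_plus \<gamma>. x = e \<oplus> a)"
  by (auto simp: gr_class_def a_r_coset_def')

lemma part_additive_group: "comm_group (add_monoid (L\<lparr>carrier := P \<gamma>\<rparr>))"
proof (rule comm_groupI)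
  fix x assume x: "x \<in> carrier (add_monoid (L\<lparr>carrier := P \<gamma>\<rparr>))"
  then show "\<exists>y\<in>carrier (add_monoid (L\<lparr>carrier := P \<gamma>\<rparr>)).
      y \<otimes>\<^bsub>add_monoid (L\<lparr>carrier := P \<gamma>\<rparr>)\<^esub> x = \<one>\<^bsub>add_monoid (L\<lparr>carrier := P \<gamma>\<rparr>)\<^esub>"
    using part_uminus part_carrier by (intro bexI[of _ "\<ominus> x"]) (auto simp: l_neg)
qed (use part_add part_zero part_carrier in \<open>auto simp: a_ac\<close>)

lemma part_plus_subgroup: "subgroup (P_plus \<gamma>) (add_monoid (L\<lparr>carrier := P \<gamma>\<rparr>))"
proof -
  interpret M: comm_group "add_monoid (L\<lparr>carrier := P \<gamma>\<rparr>)" by (rule part_additive_group)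
  show ?thesis
  proof (rule M.subgroupI)
    fix x assume x: "x \<in> P_plus \<gamma>"
    have "inv\<^bsub>add_monoid (L\<lparr>carrier := P \<gamma>\<rparr>)\<^esub> x = \<ominus> x"
      using x subsetD[OF part_plus_subset x] part_uminus part_plus_carrier[OF x]
      by (intro M.inv_equality) (auto simp: l_neg)
    then show "inv\<^bsub>add_monoid (L\<lparr>carrier := P \<gamma>\<rparr>)\<^esub> x \<in> P_plus \<gamma>" using part_plus_uminus[OF x] by simp
  next
    show "P_plus \<gamma> \<noteq> {}" using part_plus_zero by blast
  qed (use part_plus_subset part_plus_add in auto)
qed

lemma gr_comm_group: "comm_group (gr \<gamma>)"
  unfolding gr_part_def
  by (rule comm_group.abelian_FactGroup[OF part_additive_group part_plus_subgroup])

lemma gr_coset: "P_plus \<gamma> #>\<^bsub>add_monoid (L\<lparr>carrier := P \<gamma>\<rparr>)\<^esub> a = gr_class \<gamma> a"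
  by (simp add: gr_class_def a_r_coset_def r_coset_def)

lemmas gr_coset_simp = gr_coset[simplified]

lemma gr_carrier: "carrier (gr \<gamma>) = gr_class \<gamma> ` P \<gamma>"
  by (auto simp: gr_part_def FactGroup_def RCOSETS_def gr_coset_simp)

lemma gr_class_closed: "a \<in> P \<gamma> \<Longrightarrow> gr_class \<gamma> a \<in> carrier (gr \<gamma>)"
  by (simp add: gr_carrier)

lemma gr_one: "\<one>\<^bsub>gr \<gamma>\<^esub> = P_plus \<gamma>"
  by (simp add: gr_part_def)

lemma gr_class_mult:
  assumes "a \<in> P \<gamma>" "b \<in> P \<gamma>"
  shows "gr_class \<gamma> a \<otimes>\<^bsub>gr \<gamma>\<^esub> gr_class \<gamma> b = gr_class \<gamma> (a \<oplus> b)"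
proof -
  have "P_plus \<gamma> \<lhd> add_monoid (L\<lparr>carrier := P \<gamma>\<rparr>)"
    by (rule comm_group.subgroup_imp_normal[OF part_additive_group part_plus_subgroup])
  from normal.rcos_sum[OF this, of a b] assms show ?thesis
    by (simp add: gr_part_def gr_coset_simp)
qed

lemma gr_class_eqI:
  assumes a: "a \<in> P \<gamma>" and b: "b \<in> P \<gamma>" and ab: "a \<ominus> b \<in> P_plus \<gamma>"
  shows "gr_class \<gamma> a = gr_class \<gamma> b"
proof -
  have c: "a \<in> carrier L" "b \<in> carrier L" using a b part_carrier by auto
  have "gr_class \<gamma> x \<subseteq> gr_class \<gamma> y" if "x \<in> carrier L" "y \<in> carrier L" "x \<ominus> y \<in> P_plus \<gamma>" for x y
  proof
    fix z assume "z \<in> gr_class \<gamma> x"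
    then obtain e where e: "e \<in> P_plus \<gamma>" "z = e \<oplus> x" unfolding gr_class_iff by blast
    have "e \<in> carrier L" using e(1) part_plus_subset part_carrier by blast
    then have "z = (e \<oplus> (x \<ominus> y)) \<oplus> y"
      unfolding e(2) using that(1,2) by (simp add: a_minus_def a_assoc l_neg)
    then show "z \<in> gr_class \<gamma> y" unfolding gr_class_iff using part_plus_add[OF e(1) that(3)] by blast
  qed
  moreover have "b \<ominus> a \<in> P_plus \<gamma>"
    using congruent_sym[OF c] ab a b by (simp add: part_minus_plus_iff)
  ultimately show ?thesis using c ab by blast
qed

lemma gr_class_zero: "gr_class \<gamma> \<zero> = P_plus \<gamma>"
proof -
  have "e \<oplus> \<zero> = e" if "e \<in> P_plus \<gamma>" for e using part_plus_carrier[OF that] by simp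
  then show ?thesis unfolding set_eq_iff gr_class_iff by force
qed

lemma gr_class_eq_one: "a \<in> P_plus \<gamma> \<Longrightarrow> gr_class \<gamma> a = \<one>\<^bsub>gr \<gamma>\<^esub>"
  using gr_class_eqI[of a \<gamma> \<zero>] part_plus_subset part_zero gr_class_zero part_carrier
  by (auto simp: gr_one a_minus_def subset_iff)

lemma gr_class_eq_one_imp: "a \<in> P \<gamma> \<Longrightarrow> gr_class \<gamma> a = \<one>\<^bsub>gr \<gamma>\<^esub> \<Longrightarrow> a \<in> P_plus \<gamma>"
proof -
  assume a: "a \<in> P \<gamma>" "gr_class \<gamma> a = \<one>\<^bsub>gr \<gamma>\<^esub>"
  have "a = \<zero> \<oplus> a" using part_carrier[OF a(1)] by simp
  then have "a \<in> gr_class \<gamma> a" unfolding gr_class_iff using part_plus_zero by blast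
  then show ?thesis using a(2) by (simp add: gr_one)
qed

lemma gr_class_sum:
  assumes "f \<in> A \<rightarrow> P \<gamma>"
  shows "finprod (gr \<gamma>) (\<lambda>i. gr_class \<gamma> (f i)) A = gr_class \<gamma> (finsum L f A)"
  using assms
proof (induction A rule: infinite_finite_induct)
  \<comment> \<open>Over an infinite index set both sides take their default, the neutral
    element.\<close>
  case (infinite A)
  interpret gr: comm_group "gr \<gamma>" by (rule gr_comm_group)
  show ?case using infinite by (simp add: finsum_infinite gr_class_zero gr_one)
next
  case empty
  interpret gr: comm_group "gr \<gamma>" by (rule gr_comm_group)
  show ?case by (simp add: gr_class_zero gr_one)
next
  case (insert i A)
  interpret gr: comm_group "gr \<gamma>" by (rule gr_comm_group)
  have f: "f j \<in> P \<gamma>" if "j \<in> insert i A" for j using insert.prems that by blast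
  have "finprod (gr \<gamma>) (\<lambda>i. gr_class \<gamma> (f i)) (insert i A) = gr_class \<gamma> (f i) \<otimes>\<^bsub>gr \<gamma>\<^esub> gr_class \<gamma> (finsum L f A)"
    using insert f gr_class_closed by (subst gr.finprod_insert) auto
  also have "\<dots> = gr_class \<gamma> (f i \<oplus> finsum L f A)" using f part_sum[of f A \<gamma>] by (intro gr_class_mult) auto
  also have "f i \<oplus> finsum L f A = finsum L f (insert i A)"
    using insert.hyps f part_carrier by (intro finsum_insert[symmetric]) blast+
  finally show ?case .
qed

text \<open>\<open>rcoset_mult\<close> is a union over all pairs of representatives. All the cosets
  in it coincide by \<open>congruent_mult\<close>, and it is not empty because \<open>a\<close> and
  \<open>b\<close> form such a pair.\<close>

lemma gr_class_rcoset_mult: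
  assumes a: "a \<in> P \<alpha>" and b: "b \<in> P \<beta>"
  shows "rcoset_mult L (P_plus (\<alpha> + \<beta>)) (gr_class \<alpha> a) (gr_class \<beta> b) = gr_class (\<alpha> + \<beta>) (a \<otimes> b)"
proof -
  have self: "x \<in> gr_class \<gamma> x" if "x \<in> P \<gamma>" for x \<gamma>
  proof -
    have "x = \<zero> \<oplus> x" using part_carrier[OF that] by simp
    then show ?thesis unfolding gr_class_iff using part_plus_zero by blast
  qed
  have coset: "x \<in> P \<gamma> \<and> x \<ominus> y \<in> ball_plus \<gamma>" if xy: "x \<in> gr_class \<gamma> y" "y \<in> P \<gamma>" for x y \<gamma>
  proof -
    obtain e where e: "e \<in> P_plus \<gamma>" "x = e \<oplus> y" using xy(1) unfolding gr_class_iff by blast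
    have "e \<in> carrier L" "y \<in> carrier L" using part_plus_carrier[OF e(1)] part_carrier[OF xy(2)] .
    then have "x \<ominus> y = e" unfolding e(2) by (simp add: a_minus_def a_assoc r_neg)
    then show ?thesis using e part_add[OF subsetD[OF part_plus_subset e(1)] xy(2)] by (simp add: part_plus_iff)
  qed
  have "P_plus (\<alpha> + \<beta>) +> (a' \<otimes> b') = gr_class (\<alpha> + \<beta>) (a \<otimes> b)" if "a' \<in> gr_class \<alpha> a" "b' \<in> gr_class \<beta> b" for a' b'
  proof -
    have *: "a' \<in> P \<alpha>" "a' \<ominus> a \<in> ball_plus \<alpha>" "b' \<in> P \<beta>" "b' \<ominus> b \<in> ball_plus \<beta>"
      using coset that a b by auto
    have "a' \<otimes> b' \<ominus> a \<otimes> b \<in> ball_plus (\<alpha> + \<beta>)"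
      using congruent_mult[of a' \<alpha> a b' \<beta> b] * a b by (auto simp: part_iff)
    then show ?thesis
      using gr_class_eqI[of "a' \<otimes> b'" "\<alpha> + \<beta>" "a \<otimes> b"] * a b part_mult part_minus_plus_iff by (simp add: gr_class_def)
  qed
  then show ?thesis unfolding rcoset_mult_def using self[OF a] self[OF b] by blast
qed

lemma assoc_graded_carrier:
  "carrier (assoc_graded L v S) =
    {h \<in> \<Pi>\<^sub>E \<gamma>\<in>\<Gamma>. carrier (gr \<gamma>). finite {\<gamma> \<in> \<Gamma>. h \<gamma> \<noteq> \<one>\<^bsub>gr \<gamma>\<^esub>}}"
proof -
  have "group (gr \<gamma>)" for \<gamma>
    using gr_comm_group comm_group.axioms(2) by blast
  then show ?thesis by (simp add: assoc_graded_def Let_def carrier_sum_group)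
qed

lemma value_group_closed:
  "\<alpha> \<in> \<Gamma> \<Longrightarrow> \<beta> \<in> \<Gamma> \<Longrightarrow> \<alpha> - \<beta> \<in> \<Gamma>" "0 \<in> \<Gamma>"
proof -
  show "0 \<in> \<Gamma>" using val_one by (force simp: value_group_def)
  assume "\<alpha> \<in> \<Gamma>" "\<beta> \<in> \<Gamma>"
  then obtain a b where ab: "a \<in> carrier L - {\<zero>}" "b \<in> carrier L - {\<zero>}" "\<alpha> = v a" "\<beta> = v b"
    by (auto simp: value_group_def)
  then have "\<alpha> - \<beta> = v (a \<otimes> inv b)" "a \<otimes> inv b \<in> carrier L - {\<zero>}"
    using inv_nonzero val_inv val_mult mult_nonzero by auto
  then show "\<alpha> - \<beta> \<in> \<Gamma>" by (auto simp: value_group_def)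
qed

lemma word_prod_part:
  assumes "\<And>i. i \<in> I \<Longrightarrow> f i \<in> P i"
  shows "set w \<subseteq> I \<Longrightarrow> word_prod f w \<in> P (sum_list w)"
proof (induction w)
  case Nil
  then show ?case using subringE(3)[OF S] val_one by (simp add: val_part_def)
next
  case (Cons i w)
  then show ?case using part_mult assms by simp
qed

lemma word_sum_part:
  assumes "\<And>i. i \<in> I \<Longrightarrow> f i \<in> P i"
  shows "word_sum I id f k \<gamma> \<in> P \<gamma>"
  unfolding word_sum_def using word_prod_part[of I f, OF assms] by (intro part_sum) (auto simp: words_def)

text \<open>In a degree of the support the representative is not in \<open>P_plus\<close>, so its
  value is exactly the degree; elsewhere \<open>\<zero>\<close> is chosen, so that only the finite
  set \<open>I\<close> enters later sums.\<close>

lemma graded_representative: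
  assumes h: "h \<in> carrier (assoc_graded L v S)"
  obtains f I where "finite I" "I \<subseteq> \<Gamma>" "\<And>i. i \<in> I \<Longrightarrow> f i \<in> P i \<and> f i \<noteq> \<zero> \<and> v (f i) = i"
    "\<And>i. i \<notin> I \<Longrightarrow> f i = \<zero>" "h = (\<lambda>\<gamma>\<in>\<Gamma>. gr_class \<gamma> (f \<gamma>))"
proof -
  define I where "I = {\<gamma> \<in> \<Gamma>. h \<gamma> \<noteq> \<one>\<^bsub>gr \<gamma>\<^esub>}"
  have I: "finite I" "I \<subseteq> \<Gamma>" using h by (auto simp: I_def assoc_graded_carrier)
  have "\<exists>a\<in>P \<gamma>. h \<gamma> = gr_class \<gamma> a" if "\<gamma> \<in> \<Gamma>" for \<gamma>
    using h that by (auto simp: assoc_graded_carrier gr_carrier PiE_iff)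
  then obtain g where g: "\<And>\<gamma>. \<gamma> \<in> \<Gamma> \<Longrightarrow> g \<gamma> \<in> P \<gamma> \<and> h \<gamma> = gr_class \<gamma> (g \<gamma>)" by metis
  define f where "f \<gamma> = (if \<gamma> \<in> I then g \<gamma> else \<zero>)" for \<gamma>
  have "f i \<in> P i \<and> f i \<noteq> \<zero> \<and> v (f i) = i" if i: "i \<in> I" for i
  proof -
    have "g i \<in> P i" "g i \<notin> P_plus i" using g[of i] gr_class_eq_one[of "g i" i] i by (auto simp: I_def)
    then show ?thesis using i by (auto simp: f_def val_part_def val_part_plus_def)
  qed
  moreover have "h = (\<lambda>\<gamma>\<in>\<Gamma>. gr_class \<gamma> (f \<gamma>))"
  proof (rule extensionalityI[of _ \<Gamma>])
    show "h \<in> extensional \<Gamma>" using h by (auto simp: assoc_graded_carrier PiE_def)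
    show "h \<gamma> = (\<lambda>\<gamma>\<in>\<Gamma>. gr_class \<gamma> (f \<gamma>)) \<gamma>" if "\<gamma> \<in> \<Gamma>" for \<gamma>
      using g[OF that] that gr_class_zero gr_one by (auto simp: f_def I_def)
  qed simp
  ultimately show thesis using that[OF I, of f] by (simp add: f_def)
qed

text \<open>The product sums over the support of the left factor, here the previous power, whereas
  the word recursion sums over the letters, that is the support of \<open>h\<close>. Substituting
  \<open>\<alpha> = \<gamma> - b\<close> compares the two; the mismatched terms are zero or of
  larger value.\<close>

lemma graded_power:
  assumes I: "finite I" "I \<subseteq> \<Gamma>" and f: "\<And>i. i \<in> I \<Longrightarrow> f i \<in> P i" and f0: "\<And>i. i \<notin> I \<Longrightarrow> f i = \<zero>"
    and h: "h = (\<lambda>\<gamma>\<in>\<Gamma>. gr_class \<gamma> (f \<gamma>))"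
  shows "h [^]\<^bsub>assoc_graded L v S\<^esub> (k::nat) = (\<lambda>\<gamma>\<in>\<Gamma>. gr_class \<gamma> (word_sum I id f k \<gamma>))"
proof (induction k)
  case 0
  have "\<one>\<^bsub>assoc_graded L v S\<^esub> = (\<lambda>\<gamma>\<in>\<Gamma>. gr_class \<gamma> (word_sum I id f 0 \<gamma>))"
    by (auto simp: assoc_graded_def Let_def word_sum_0 gr_class_zero gr_one gr_class_def[symmetric] intro!: restrict_ext)
  then show ?case by (simp add: nat_pow_def id_def)
next
  case (Suc k)
  let ?W = "word_sum I id f"
  have fP: "f i \<in> P i" for i using f f0 part_zero by (cases "i \<in> I") auto
  have fI: "f \<in> I \<rightarrow> carrier L" using fP part_carrier by blast
  have W: "?W k \<gamma> \<in> P \<gamma>" for k \<gamma> using word_sum_part[of I f, OF f] .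
  let ?h = "\<lambda>\<gamma>\<in>\<Gamma>. gr_class \<gamma> (?W k \<gamma>)"
  have step: "finprod (gr \<gamma>) (\<lambda>\<alpha>. rcoset_mult L (P_plus \<gamma>) (?h \<alpha>) (h (\<gamma> - \<alpha>))) {\<alpha> \<in> \<Gamma>. ?h \<alpha> \<noteq> \<one>\<^bsub>gr \<alpha>\<^esub>}
      = gr_class \<gamma> (?W (Suc k) \<gamma>)" if \<gamma>: "\<gamma> \<in> \<Gamma>" for \<gamma>
  proof -
    have gr: "comm_monoid (gr \<gamma>)" using gr_comm_group comm_group.axioms(1) by blast
    define D where "D = {\<alpha> \<in> \<Gamma>. ?h \<alpha> \<noteq> \<one>\<^bsub>gr \<alpha>\<^esub>}"
    define t where "t \<alpha> = ?W k \<alpha> \<otimes> f (\<gamma> - \<alpha>)" for \<alpha>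
    define E where "E = (\<lambda>b. \<gamma> - b) ` I"
    have t: "t \<alpha> \<in> P \<gamma>" for \<alpha> using part_mult[OF W[of k \<alpha>] fP[of "\<gamma> - \<alpha>"]] by (simp add: t_def)
    have tc: "t \<alpha> \<in> carrier L" for \<alpha> using t part_carrier by blast
    have EG: "E \<subseteq> \<Gamma>" using I \<gamma> value_group_closed(1) by (auto simp: E_def)
    have E: "finite E" using I by (simp add: E_def)
    \<comment> \<open>\<open>finprod\<close> is meaningful only over a finite set: degrees with
      nontrivial class are weights of words of length \<open>k\<close> over \<open>I\<close>, of
      which there are finitely many.\<close>
    have "D \<subseteq> sum_list ` {w. set w \<subseteq> I \<and> length w = k}"
    proof
      fix \<alpha> assume a: "\<alpha> \<in> D"
      have \<alpha>: "\<alpha> \<in> \<Gamma>" "?h \<alpha> \<noteq> \<one>\<^bsub>gr \<alpha>\<^esub>" using a unfolding D_def by blast+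
      have "?W k \<alpha> \<noteq> \<zero>"
      proof
        assume 0: "?W k \<alpha> = \<zero>"
        have "?h \<alpha> = gr_class \<alpha> (?W k \<alpha>)" using \<alpha>(1) by (rule restrict_apply')
        also have "\<dots> = \<one>\<^bsub>gr \<alpha>\<^esub>" unfolding 0 gr_class_zero gr_one ..
        finally show False using \<alpha>(2) by contradiction
      qed
      then have "words I id k \<alpha> \<noteq> {}" by (auto simp: word_sum_def)
      then show "\<alpha> \<in> sum_list ` {w. set w \<subseteq> I \<and> length w = k}" by (auto simp: words_def)
    qed
    then have D: "finite D" using finite_lists_length_eq[OF I(1), of k] by (metis finite_imageI finite_subset)
    have "finprod (gr \<gamma>) (\<lambda>\<alpha>. rcoset_mult L (P_plus \<gamma>) (?h \<alpha>) (h (\<gamma> - \<alpha>))) D =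
        finprod (gr \<gamma>) (\<lambda>\<alpha>. gr_class \<gamma> (t \<alpha>)) D"
    proof (rule comm_monoid.finprod_cong'[OF gr refl])
      fix \<alpha> assume "\<alpha> \<in> D"
      then have "\<alpha> \<in> \<Gamma>" by (simp add: D_def)
      then show "rcoset_mult L (P_plus \<gamma>) (?h \<alpha>) (h (\<gamma> - \<alpha>)) = gr_class \<gamma> (t \<alpha>)"
        using gr_class_rcoset_mult[OF W[of k \<alpha>] fP[of "\<gamma> - \<alpha>"]] value_group_closed(1)[OF \<gamma>, of \<alpha>]
        by (simp add: h t_def)
    qed (use gr_class_closed t in auto)
    also have "\<dots> = gr_class \<gamma> (finsum L t D)" using t by (intro gr_class_sum) auto
    also have "\<dots> = gr_class \<gamma> (finsum L t E)"
    proof (rule gr_class_eqI)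
      have "finsum L t D = finsum L t (D \<inter> E)"
      proof (rule add.finprod_mono_neutral_cong_right[OF D])
        fix \<alpha> assume "\<alpha> \<in> D - D \<inter> E"
        then have "\<gamma> - \<alpha> \<notin> I" by (force simp: E_def)
        then show "t \<alpha> = \<zero>" using f0 part_carrier[OF W] by (simp add: t_def)
      qed (use tc in auto)
      moreover have "finsum L t E = finsum L t (D \<inter> E) \<oplus> finsum L t (E - D)"
      proof -
        have "finsum L t ((D \<inter> E) \<union> (E - D)) = finsum L t (D \<inter> E) \<oplus> finsum L t (E - D)"
          using D E tc by (intro finsum_Un_disjoint) auto
        moreover have "(D \<inter> E) \<union> (E - D) = E" by blast
        ultimately show ?thesis by simp
      qed
      \<comment> \<open>In these degrees the left factor has trivial class though it may be nonzero,
        so the terms are small rather than zero.\<close>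
      moreover have "finsum L t (E - D) \<in> P_plus \<gamma>"
      proof (rule part_plus_sum, rule Pi_I)
        fix \<alpha> assume \<alpha>: "\<alpha> \<in> E - D"
        then have "gr_class \<alpha> (?W k \<alpha>) = \<one>\<^bsub>gr \<alpha>\<^esub>" using EG by (auto simp: D_def)
        then have "?W k \<alpha> \<in> ball_plus \<alpha>" using gr_class_eq_one_imp[OF W] by (simp add: part_plus_iff)
        then have "t \<alpha> \<in> ball_plus (\<alpha> + (\<gamma> - \<alpha>))"
          unfolding t_def using fP[of "\<gamma> - \<alpha>"] by (intro ball_plus_mult) (auto simp: part_iff)
        then show "t \<alpha> \<in> P_plus \<gamma>" using t[of \<alpha>] by (simp add: part_plus_iff part_iff)
      qed
      moreover have "finsum L t (D \<inter> E) \<in> carrier L" using tc by auto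
      ultimately show "finsum L t D \<ominus> finsum L t E \<in> P_plus \<gamma>"
        using part_plus_uminus part_carrier[of _ \<gamma>] part_plus_subset[of \<gamma>]
        by (simp add: a_minus_def minus_add r_neg1 r_neg2 subset_iff)
    qed (intro part_sum Pi_I t)+
    also have "finsum L t E = ?W (Suc k) \<gamma>"
    proof -
      have "finsum L t E = (\<Oplus>b\<in>I. t (\<gamma> - b))"
        unfolding E_def using tc by (intro finsum_reindex) (auto simp: inj_on_def)
      also have "\<dots> = (\<Oplus>b\<in>I. f b \<otimes> ?W k (\<gamma> - id b))"
        using fI part_carrier[OF W] by (intro finsum_cong') (auto simp: t_def m_comm Pi_iff)
      finally show ?thesis unfolding word_sum_Suc[OF fI I(1)] .
    qed
    finally show ?thesis unfolding D_def .
  qed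
  have "h [^]\<^bsub>assoc_graded L v S\<^esub> Suc k = h [^]\<^bsub>assoc_graded L v S\<^esub> k \<otimes>\<^bsub>assoc_graded L v S\<^esub> h"
    by (simp add: nat_pow_def)
  also have "\<dots> = ?h \<otimes>\<^bsub>assoc_graded L v S\<^esub> h" unfolding Suc ..
  also have "\<dots> = (\<lambda>\<gamma>\<in>\<Gamma>. finprod (gr \<gamma>)
      (\<lambda>\<alpha>. rcoset_mult L (P_plus \<gamma>) (?h \<alpha>) (h (\<gamma> - \<alpha>))) {\<alpha> \<in> \<Gamma>. ?h \<alpha> \<noteq> \<one>\<^bsub>gr \<alpha>\<^esub>})"
    by (simp add: assoc_graded_def Let_def)
  also have "\<dots> = (\<lambda>\<gamma>\<in>\<Gamma>. gr_class \<gamma> (?W (Suc k) \<gamma>))"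
    by (intro restrict_ext step)
  finally show ?case .
qed

end

end

section \<open>Frobenius powers in the associated graded ring\<close>

context unibranch_local
begin

abbreviation "LK \<equiv> L\<lparr>carrier := K\<rparr>"

text \<open>Makes the results on graded rings available for \<open>K\<close> with \<open>u\<close>,
  which is known to agree with \<open>v\<close> only away from zero.\<close>

lemma base_valued_field: "valued_field LK u"
proof (intro valued_field.intro valued_field_axioms.intro)
  show field: "field LK" by (rule subfield_iff(2)[OF K_subfield])
  show "valuation LK u"
    unfolding valuation_def
  proof (intro conjI ballI field)
    fix x y assume "x \<in> carrier LK - {\<zero>\<^bsub>LK\<^esub>}" "y \<in> carrier LK - {\<zero>\<^bsub>LK\<^esub>}"
    then have xy: "x \<in> K" "x \<noteq> \<zero>" "y \<in> K" "y \<noteq> \<zero>" by auto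
    have "x \<otimes> y \<in> K - {\<zero>}"
      using xy subringE(6)[OF K_subring] mult_nonzero K_carrier by blast
    then show "u (x \<otimes>\<^bsub>LK\<^esub> y) = u x + u y" using xy restriction val_mult K_carrier by simp
    have "u (x \<oplus> y) = v (x \<oplus> y)" if "x \<oplus> y \<noteq> \<zero>"
      using restriction[of "x \<oplus> y"] xy that subringE(7)[OF K_subring] by simp
    then show "x \<oplus>\<^bsub>LK\<^esub> y \<noteq> \<zero>\<^bsub>LK\<^esub> \<longrightarrow> min (u x) (u y) \<le> u (x \<oplus>\<^bsub>LK\<^esub> y)"
      using val_add[of x y] xy restriction K_carrier by simp
  qed
qed

lemma R_subring_base: "subring R LK"
  using R_local by (simp add: local_ring_of_def)

lemma val_part_base: "val_part LK u R \<gamma> = val_part L v R \<gamma>"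
proof -
  have "f \<in> val_part LK u R \<gamma> \<longleftrightarrow> f \<in> val_part L v R \<gamma>" for f
    using restriction[of f] R_subset by (cases "f = \<zero>") (auto simp: val_part_def)
  then show ?thesis by blast
qed

lemma val_part_plus_base: "val_part_plus LK u R \<gamma> = val_part_plus L v R \<gamma>"
proof -
  have "f \<in> val_part_plus LK u R \<gamma> \<longleftrightarrow> f \<in> val_part_plus L v R \<gamma>" for f
    using restriction[of f] R_subset by (cases "f = \<zero>") (auto simp: val_part_plus_def)
  then show ?thesis by blast
qed

text \<open>A coset of the small \<open>P_plus\<close> of \<open>R\<close> is swallowed by that of
  \<open>S\<close>, which contains it, so the set sum is again a single coset.\<close>

lemma gr_class_base_sum:
  assumes a: "a \<in> carrier L"
  shows "val_part_plus L v S \<gamma> <+>\<^bsub>L\<^esub> valued_field.gr_class LK u R \<gamma> a = gr_class S \<gamma> a"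
proof -
  have base: "x \<in> valued_field.gr_class LK u R \<gamma> a \<longleftrightarrow> (\<exists>e\<in>val_part_plus L v R \<gamma>. x = e \<oplus> a)" for x
    unfolding valued_field.gr_class_iff[OF base_valued_field R_subring_base] val_part_plus_base by simp
  have RS: "val_part_plus L v R \<gamma> \<subseteq> val_part_plus L v S \<gamma>" using R_subset_S by (auto simp: val_part_plus_def)
  show ?thesis
  proof (intro equalityI subsetI)
    fix x assume "x \<in> val_part_plus L v S \<gamma> <+>\<^bsub>L\<^esub> valued_field.gr_class LK u R \<gamma> a"
    then obtain s y where "s \<in> val_part_plus L v S \<gamma>" "y \<in> valued_field.gr_class LK u R \<gamma> a" "x = s \<oplus> y"
      unfolding set_add_def' by blast
    moreover from this(2) obtain e where "e \<in> val_part_plus L v R \<gamma>" "y = e \<oplus> a" unfolding base by blast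
    ultimately have se: "s \<in> val_part_plus L v S \<gamma>" "e \<in> val_part_plus L v R \<gamma>" "x = s \<oplus> (e \<oplus> a)"
      by simp_all
    have e: "e \<in> val_part_plus L v S \<gamma>" using se(2) RS by blast
    have "x = (s \<oplus> e) \<oplus> a"
      using se(3) part_plus_carrier[OF S_subring se(1)] part_plus_carrier[OF S_subring e] a by (simp add: a_assoc)
    then show "x \<in> gr_class S \<gamma> a"
      unfolding gr_class_iff[OF S_subring] using part_plus_add[OF S_subring se(1) e] by blast
  next
    fix x assume "x \<in> gr_class S \<gamma> a"
    then obtain s where s: "s \<in> val_part_plus L v S \<gamma>" "x = s \<oplus> a"
      unfolding gr_class_iff[OF S_subring] by blast
    have "\<zero> \<oplus> a \<in> valued_field.gr_class LK u R \<gamma> a"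
      unfolding base using part_plus_zero[OF R_subring] by blast
    then show "x \<in> val_part_plus L v S \<gamma> <+>\<^bsub>L\<^esub> valued_field.gr_class LK u R \<gamma> a"
      unfolding set_add_def' s(2) using s(1) a by auto
  qed
qed

text \<open>Multiplying by \<open>p\<close>, an element of positive value, strictly raises the
  value; this is what makes Frobenius additive modulo \<open>P_plus\<close>.\<close>

lemma residue_char_multiple:
  assumes "x \<in> val_part L v S \<gamma>"
  shows "add_pow L p x \<in> val_part_plus L v S \<gamma>"
proof -
  have x: "x \<in> carrier L" "x \<in> ball \<gamma>" "x \<in> S" using assms part_iff[OF S_subring] by (auto simp: ball_iff)
  have eq: "add_pow L p x = add_pow L p \<one> \<otimes> x" using add_pow_ldistr[of \<one> x p] x by simp
  have "add_pow L p \<one> \<in> ball_plus 0" using residue_char_iff[OF residue_char(1), of p] by simp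
  then have "add_pow L p x \<in> ball_plus \<gamma>" unfolding eq using ball_plus_mult[OF _ x(2)] by fastforce
  moreover have "add_pow L n x \<in> S" for n :: nat
  proof (induction n)
    case 0
    then show ?case using subringE(2)[OF S_subring] by simp
  next
    case (Suc n)
    then show ?case using subringE(7)[OF S_subring] x by simp
  qed
  ultimately show ?thesis by (simp add: part_plus_iff[OF S_subring])
qed

text \<open>A preimage is written down explicitly: its class in degree \<gamma> is that of
  \<open>r \<gamma>\<close>, a sum of norms of representatives, which differs from the word sum only
  by terms of larger value.\<close>

lemma graded_prime_power_in_base:
  assumes q: "card Gal = p ^ n" and h: "h \<in> carrier (assoc_graded L v S)"
  shows "h [^]\<^bsub>assoc_graded L v S\<^esub> (p ^ n) \<in> gr_inclusion L v S K u ` carrier (assoc_graded LK u R)"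
proof -
  let ?q = "p ^ n" and ?\<Gamma> = "value_group L v" and ?\<Delta> = "value_group LK u"
  note SS = S_subring and BR = base_valued_field R_subring_base
  have p: "Factorial_Ring.prime p" by (rule residue_char_prime[OF residue_char])
  obtain f I where I: "finite I" "I \<subseteq> ?\<Gamma>"
    and f: "\<And>i. i \<in> I \<Longrightarrow> f i \<in> val_part L v S i \<and> f i \<noteq> \<zero> \<and> v (f i) = i"
    and f0: "\<And>i. i \<notin> I \<Longrightarrow> f i = \<zero>" and hf: "h = (\<lambda>\<gamma>\<in>?\<Gamma>. gr_class S \<gamma> (f \<gamma>))"
    using graded_representative[OF SS h] by blast
  have fP: "f i \<in> val_part L v S i" if "i \<in> I" for i using f[OF that] by blast
  have fc: "f i \<in> carrier L" "f i \<in> S" if "i \<in> I" for i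
    using fP[OF that] part_carrier[OF SS] part_iff[OF SS] by auto
  \<comment> \<open>The letters whose constant word of length \<open>?q\<close> has weight \<gamma>;
    only these words survive modulo larger value.\<close>
  define J where "J \<gamma> = {i \<in> I. sum_list (replicate ?q i) = \<gamma>}" for \<gamma>
  have J: "finite (J \<gamma>)" "J \<gamma> \<subseteq> I" for \<gamma> using I(1) by (auto simp: J_def)
  have vpow: "v (f i [^] ?q) = \<gamma>" if "i \<in> J \<gamma>" for i \<gamma>
    using val_pow[of "f i" ?q] f[of i] fc[of i] that by (simp add: J_def)
  have vnorm: "norm (f i) \<in> R" "norm (f i) \<noteq> \<zero>" "v (norm (f i)) = \<gamma>"
    "norm (f i) \<ominus> f i [^] ?q \<in> ball_plus \<gamma>" if i: "i \<in> J \<gamma>" for i \<gamma>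
  proof -
    have "i \<in> I" using i J(2) by blast
    then have fi: "f i \<in> carrier L" "f i \<in> S" "f i \<noteq> \<zero>" using fc f by auto
    show "norm (f i) \<in> R" by (rule norm_local[OF fi(2)])
    show "norm (f i) \<noteq> \<zero>" by (rule norm_nonzero[OF fi(1,3)])
    show "v (norm (f i)) = \<gamma>" using val_norm[OF fi(1,3)] vpow[OF i] by (simp add: q)
    show "norm (f i) \<ominus> f i [^] ?q \<in> ball_plus \<gamma>"
      using norm_congruent[OF fi(1,3)] vpow[OF i] by (simp add: q)
  qed
  define r where "r \<gamma> = (\<Oplus>i\<in>J \<gamma>. norm (f i))" for \<gamma>
  have r: "r \<gamma> \<in> val_part L v R \<gamma>" for \<gamma>
    unfolding r_def using vnorm(1,3) by (intro part_sum[OF R_subring]) (auto simp: val_part_def)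
  have rc: "r \<gamma> \<in> carrier L" for \<gamma> using part_carrier[OF R_subring r] .
  have rS: "r \<gamma> \<in> val_part L v S \<gamma>" for \<gamma> using r R_subset_S by (auto simp: val_part_def)
  define W where "W = word_sum I id f ?q"
  have WP: "W \<gamma> \<in> val_part L v S \<gamma>" for \<gamma> unfolding W_def by (rule word_sum_part[OF SS fP])
  have power: "h [^]\<^bsub>assoc_graded L v S\<^esub> ?q = (\<lambda>\<gamma>\<in>?\<Gamma>. gr_class S \<gamma> (W \<gamma>))"
    unfolding W_def by (rule graded_power[OF SS I fP f0 hf])
  have W_r: "W \<gamma> \<ominus> r \<gamma> \<in> val_part_plus L v S \<gamma>" for \<gamma>
  proof -
    have "\<exists>e\<in>val_part_plus L v S \<gamma>. W \<gamma> =
        (\<Oplus>i\<in>{i \<in> I. sum_list (replicate ?q (id i)) = \<gamma>}. f i [^] ?q) \<oplus> e"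
      unfolding W_def
    proof (rule word_sum_prime_power[OF p])
      show "f \<in> I \<rightarrow> carrier L" using fc by auto
      show "val_part_plus L v S \<gamma> \<subseteq> carrier L" using part_plus_carrier[OF SS] by blast
      fix w assume w: "w \<in> words I id ?q \<gamma>"
      then have "word_prod f w \<in> val_part L v S (sum_list w)"
        by (intro word_prod_part[OF SS fP]) (auto simp: words_def)
      then show "add_pow L p (word_prod f w) \<in> val_part_plus L v S \<gamma>"
        using residue_char_multiple w by (simp add: words_def)
    qed (use I part_plus_zero[OF SS] part_plus_add[OF SS] in auto)
    then obtain e where e: "e \<in> val_part_plus L v S \<gamma>" "W \<gamma> = (\<Oplus>i\<in>J \<gamma>. f i [^] ?q) \<oplus> e"
      by (auto simp: J_def)
    have ec: "e \<in> carrier L" by (rule part_plus_carrier[OF SS e(1)])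
    \<comment> \<open>The total error of replacing powers by norms. Both
      \<open>W \<gamma> = s \<oplus> e\<close> and \<open>r \<gamma> = s \<oplus> d\<close> contain
      the same \<open>s\<close>, which cancels.\<close>
    define d where "d = (\<Oplus>i\<in>J \<gamma>. norm (f i) \<ominus> f i [^] ?q)"
    define s where "s = (\<Oplus>i\<in>J \<gamma>. f i [^] ?q)"
    have Jc: "f i [^] ?q \<in> carrier L" "norm (f i) \<in> carrier L" if "i \<in> J \<gamma>" for i
      using fc[of i] J(2) that norm_closed[of "f i"] by auto
    have sc: "s \<in> carrier L" unfolding s_def using Jc by (intro finsum_closed) auto
    have d: "d \<in> ball_plus \<gamma>" unfolding d_def using J(1) vnorm(4) by (intro ball_plus_sum) auto
    then have dc: "d \<in> carrier L" by (simp add: ball_plus_iff)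
    have "r \<gamma> = (\<Oplus>i\<in>J \<gamma>. f i [^] ?q \<oplus> (norm (f i) \<ominus> f i [^] ?q))"
      unfolding r_def
    proof (intro finsum_cong' refl)
      fix i assume i: "i \<in> J \<gamma>"
      show "norm (f i) = f i [^] ?q \<oplus> (norm (f i) \<ominus> f i [^] ?q)"
        using Jc[OF i] a_lcomm[of "f i [^] ?q" "norm (f i)" "\<ominus> (f i [^] ?q)"] by (simp add: a_minus_def r_neg)
    qed (use Jc in auto)
    also have "\<dots> = s \<oplus> d" unfolding s_def d_def using Jc by (intro finsum_addf) auto
    finally have rd: "r \<gamma> = s \<oplus> d" .
    have "W \<gamma> \<ominus> r \<gamma> = e \<ominus> d"
      unfolding e(2) s_def[symmetric] rd using a_minus_cancel_left[OF sc ec dc] sc ec dc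
      by (simp add: a_minus_def minus_add a_assoc a_comm[of "\<ominus> d"])
    then have "W \<gamma> \<ominus> r \<gamma> \<in> ball_plus \<gamma>"
      using ball_plus_minus[OF _ d] e(1) part_plus_iff[OF SS] by simp
    then show ?thesis using part_minus_plus_iff[OF SS WP rS] by simp
  qed
  define k where "k = (\<lambda>\<gamma>\<in>?\<Delta>. valued_field.gr_class LK u R \<gamma> (r \<gamma>))"
  have "k \<in> carrier (assoc_graded LK u R)"
    unfolding valued_field.assoc_graded_carrier[OF BR]
  proof (intro CollectI conjI)
    show "k \<in> (\<Pi>\<^sub>E \<gamma>\<in>?\<Delta>. carrier (gr_part LK u R \<gamma>))"
      unfolding k_def restrict_PiE_iff using valued_field.gr_class_closed[OF BR] r val_part_base by simp
    \<comment> \<open>An empty \<open>J \<gamma>\<close> makes \<open>r \<gamma>\<close> zero, so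
      the support lies among the \<open>?q\<close>-fold multiples of the finitely many degrees in
      \<open>I\<close>.\<close>
    have "{\<gamma> \<in> ?\<Delta>. k \<gamma> \<noteq> \<one>\<^bsub>gr_part LK u R \<gamma>\<^esub>} \<subseteq> (\<lambda>i. sum_list (replicate ?q i)) ` I"
    proof
      fix \<gamma> assume \<gamma>: "\<gamma> \<in> {\<gamma> \<in> ?\<Delta>. k \<gamma> \<noteq> \<one>\<^bsub>gr_part LK u R \<gamma>\<^esub>}"
      have "J \<gamma> \<noteq> {}"
      proof
        assume "J \<gamma> = {}"
        then have "r \<gamma> = \<zero>\<^bsub>LK\<^esub>" by (simp add: r_def)
        then have "k \<gamma> = \<one>\<^bsub>gr_part LK u R \<gamma>\<^esub>"
          using \<gamma> valued_field.gr_class_zero[OF BR] valued_field.gr_one[OF BR] by (simp add: k_def)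
        then show False using \<gamma> by blast
      qed
      then show "\<gamma> \<in> (\<lambda>i. sum_list (replicate ?q i)) ` I" by (auto simp: J_def)
    qed
    then show "finite {\<gamma> \<in> ?\<Delta>. k \<gamma> \<noteq> \<one>\<^bsub>gr_part LK u R \<gamma>\<^esub>}"
      using I(1) finite_subset by blast
  qed
  moreover have "h [^]\<^bsub>assoc_graded L v S\<^esub> ?q = gr_inclusion L v S K u k"
    unfolding power gr_inclusion_def
  proof (intro restrict_ext)
    fix \<gamma> assume "\<gamma> \<in> ?\<Gamma>"
    show "gr_class S \<gamma> (W \<gamma>) =
      (if \<gamma> \<in> ?\<Delta> then val_part_plus L v S \<gamma> <+>\<^bsub>L\<^esub> k \<gamma> else \<one>\<^bsub>gr_part L v S \<gamma>\<^esub>)"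
    proof (cases "\<gamma> \<in> ?\<Delta>")
      case True
      then show ?thesis
        using gr_class_base_sum[OF rc] gr_class_eqI[OF SS WP rS W_r] by (simp add: k_def)
    next
      case False
      \<comment> \<open>A member of \<open>J \<gamma>\<close> would supply a norm in
        \<open>K\<close> of value \<gamma>, putting \<gamma> into the value group of
        \<open>K\<close>. Outside it both sides are therefore the zero class.\<close>
      have "i \<notin> J \<gamma>" for i
      proof
        assume i: "i \<in> J \<gamma>"
        have "norm (f i) \<in> K - {\<zero>}" using vnorm[OF i] R_subset by blast
        then have "\<gamma> \<in> ?\<Delta>" unfolding value_group_base using vnorm(3)[OF i] by blast
        then show False using False by simp
      qed
      then have "J \<gamma> = {}" by blast
      then have "r \<gamma> = \<zero>" by (simp add: r_def)
      then have "W \<gamma> \<in> val_part_plus L v S \<gamma>" using W_r[of \<gamma>] part_carrier[OF SS WP] by (simp add: a_minus_def)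
      then show ?thesis using False gr_class_eq_one[OF SS] by simp
    qed
  qed
  ultimately show ?thesis by blast
qed

end

theorem theorem1p5:
  fixes L :: "('a, 'b) ring_scheme" and K R S :: "'a set"
    and v u :: "'a \<Rightarrow> 'g::linordered_ab_group_add" and p :: nat
  assumes galois: "galois_extension L K"
    and valuation: "valuation L v"
    and rank_one: "val_rank L v = 1"
    and restriction: "\<And>x. x \<in> K - {\<zero>\<^bsub>L\<^esub>} \<Longrightarrow> u x = v x"
    and unique: "unique_extension L v K u"
    and residue_char: "has_characteristic (residue_field L v) p" "p > 0"
    and index: "\<exists>k::nat. group_index (value_group L v) (value_group (L\<lparr>carrier := K\<rparr>) u) = p ^ k"
    and residue_ext: "purely_inseparable_over p (residue_field L v) (residue_subfield L v K u)"
    and R_local: "local_ring_of (L\<lparr>carrier := K\<rparr>) R"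
    and R_normal: "integral_closure (L\<lparr>carrier := K\<rparr>) R = R"
    and R_dominated: "dominates (L\<lparr>carrier := K\<rparr>) u R"
    and S_def: "S = localization_at L (integral_closure L R) (val_center L v (integral_closure L R))"
  shows "\<exists>n::nat. ring.dimension L (p ^ n) K (carrier L) \<and>
           (\<forall>h \<in> carrier (assoc_graded L v S).
              h [^]\<^bsub>assoc_graded L v S\<^esub> (p ^ n)
                \<in> gr_inclusion L v S K u ` carrier (assoc_graded (L\<lparr>carrier := K\<rparr>) u R))"
proof -
  have "field L" using galois by (simp add: galois_extension_def)
  then interpret unibranch_local L v K u p R S
    using assms
    by (intro unibranch_local.intro unibranch_galois.intro valued_field.intro valued_field_axioms.intro
        unibranch_galois_axioms.intro unibranch_local_axioms.intro)
  \<comment> \<open>The exponent is read off from the group order, which is also the degree, so one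
    \<open>n\<close> serves both conjuncts.\<close>
  obtain n where "card Gal = p ^ n" using card_Gal_prime_power by blast
  then show ?thesis using dimension_card_Gal graded_prime_power_in_base by auto
qed

end
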